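(* Let $\mathbf X\in\mathscr C^p_\omega([0,T],V)$ and let $\overline H\in\mathscr D_{\mathbf X}(U)$ be a $U$-valued $\mathbf X$-controlled path with trace $H$. Define $\widetilde{\mathbf H}:\Delta_T\to T^{\lfloor p\rfloor}(U)$ by $\widetilde{\mathbf H}^0_{st}:=1$, $\widetilde{\mathbf H}^1_{st}:=H_t-H_s$ and, for $2\le m\le\lfloor p\rfloor$, $$\widetilde{\mathbf H}^m_{st}:=\sum_{\substack{n_1,\ldots,n_m\ge 1\\ n_1+\cdots+n_m\le\lfloor p\rfloor}}\big\langle \overline H_{n_1;s}\boxtimes\cdots\boxtimes\overline H_{n_m;s},\ \widetilde\Delta_{\mathrm{osh}}^{n_1,\ldots,n_m}\,\mathbf X^{n_1+\cdots+n_m}_{st}\big\rangle\in U^{\otimes m}.$$ Then $\widetilde{\mathbf H}$ is an almost rough path. Therefore, for any sequence $(\pi_n)_n$ of partitions of $[s,t]$ with vanishing step size, the limit $$(\uparrow_{\mathbf X}\overline H)_{st}:=\lim_{n\to\infty}\bigotimes_{[u,v]\in\pi_n}\widetilde{\mathbf H}_{uv}$$ (product taken in the truncated tensor algebra $T^{\lfloor p\rfloor}(U)$) exists and defines a $U$-valued $p$-weakly geometric rough path controlled by $\omega$ on $[0,T]$, with trace $H$.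
   Context: $V,U$ are finite-dimensional real vector spaces; $T^N(V)=\bigoplus_{n=0}^N V^{\otimes n}$, with $a^n$ the component of $a$ in $V^{\otimes n}$. $T>0$, $p\ge1$, $\Delta_T=\{(s,t):0\le s\le t\le T\}$. A control is a continuous $\omega:\Delta_T\to[0,\infty)$ with $\omega(t,t)=0$ and $\omega(s,u)+\omega(u,t)\le\omega(s,t)$ for $s\le u\le t$. For a path $Y$, $Y_{st}:=Y_t-Y_s$; $\mathcal C^p_\omega([0,T],E)$ is the set of continuous $E$-valued paths with $|Y_{st}|\le C\omega(s,t)^{1/p}$ for some $C$. We write $a_{st}\approx_m b_{st}$ if $a_{st}-b_{st}=O(\omega(s,t)^{m/p})$, i.e. $|a_{st}-b_{st}|\le C\omega(s,t)^{m/p}$ for a constant $C$ (for quantities also depending on $u$ with $s\le u\le t$, $C$ is independent of $u$), and $\approx$ means $\approx_{\lfloor p\rfloor+1}$. Shuffles: $\mathrm{Sh}(n_1,\ldots,n_m)$ is the set of permutations $\sigma$ of $\{1,\ldots,n_1+\cdots+n_m\}$ increasing on each of the consecutive blocks of sizes $n_1,\ldots,n_m$; $\overline{\mathrm{Sh}}(n_1,\ldots,n_m)$ (for $n_i\ge1$) is the subset of those with also $\sigma(n_1)<\sigma(n_1+n_2)<\cdots<\sigma(n_1+\cdots+n_m)$. For $n=n_1+\cdots+n_m$ define the linear map on $V^{\otimes n}$ $$\widetilde\Delta^{n_1,\ldots,n_m}_{\mathrm{osh}}(v_1\otimes\cdots\otimes v_n)=\sum_{\sigma\in\overline{\mathrm{Sh}}(n_1,\ldots,n_m)}(v_{\sigma(1)}\otimes\cdots\otimes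 v_{\sigma(n_1)})\boxtimes\cdots\boxtimes(v_{\sigma(n-n_m+1)}\otimes\cdots\otimes v_{\sigma(n)}),$$ and $\Delta^{a,b}_{\mathrm{sh}}$ on $V^{\otimes(a+b)}$ by the same formula with $\mathrm{Sh}(a,b)$ ($a,b\ge0$); $\boxtimes$ denotes the external tensor product. A ($p$-weakly geometric) rough path $\mathbf X\in\mathscr C^p_\omega([0,T],V)$ is a continuous map $\mathbf X:\Delta_T\to T^{\lfloor p\rfloor}(V)$ with $\mathbf X^0=1$ satisfying: (regularity) $|\mathbf X^n_{st}|\le C\omega(s,t)^{n/p}$, $1\le n\le\lfloor p\rfloor$; (multiplicativity) $\mathbf X_{st}=\mathbf X_{su}\otimes\mathbf X_{ut}$ truncated at degree $\lfloor p\rfloor$, $s\le u\le t$; (integration by parts) $\mathbf X^a_{st}\boxtimes\mathbf X^b_{st}=\Delta^{a,b}_{\mathrm{sh}}\mathbf X^{a+b}_{st}$ for $a+b\le\lfloor p\rfloor$. Its trace is $X=\mathbf X^1$ (increments of a path $X$). An almost rough path is a continuous map $\Delta_T\to T^{\lfloor p\rfloor}(V)$ with degree-0 part $1$ satisfying regularity, and satisfying multiplicativity and integration by parts with $\approx$ in place of $=$. An $\mathbf X$-controlled path $\overline H\in\mathscr D_{\mathbf X}(U)$ is an element of $\mathcal C^p_\omega([0,T],\mathcal L(T^{\lfloor p\rfloor-1}(V),U))$ such that, with $\overline H_n:=\overline H|_{V^{\otimes n}}$, for $n=0,\ldots,\lfloor p\rfloor-2$ and $a\in V^{\otimes n}$: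 $\langle\overline H_{n;t},a\rangle\approx_{\lfloor p\rfloor-n}\sum_{k=0}^{\lfloor p\rfloor-1-n}\langle\overline H_{n+k;s},\mathbf X^k_{st}\otimes a\rangle$. Its trace is $H:=\overline H_0$ (with $\mathcal L(\mathbb R,U)=U$). *)

theory Defs
  imports "HOL-Analysis.Analysis" "HOL-Combinatorics.Permutations"
begin

section \<open>Tensors over a Euclidean space\<close>

text \<open>
  A tensor over \<open>'v\<close> is given by its coefficients in the basis
  \<open>e\<^sub>b\<^sub>1 \<otimes> \<dots> \<otimes> e\<^sub>b\<^sub>n\<close> induced by the orthonormal basis \<open>Basis\<close>: it is a function
  on words over \<open>Basis\<close>, extended by \<open>0\<close> to all other lists. The empty word is the basis
  element \<open>1\<close> of the tensor power of degree \<open>0\<close>.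
\<close>

type_synonym 'v tensor = "'v list \<Rightarrow> real"

definition words :: "nat \<Rightarrow> 'v::euclidean_space list set" where
  "words n = {w. length w = n \<and> set w \<subseteq> Basis}"

definition words_upto :: "nat \<Rightarrow> 'v::euclidean_space list set" where
  "words_upto N = (\<Union>n\<le>N. words n)"

text \<open>
  With values in \<open>real\<close> this is the truncated tensor algebra of level \<open>N\<close>; with values in a
  vector space \<open>U\<close> it is the space of linear maps from the truncated tensor algebra to \<open>U\<close>,
  a map being recorded by its values on the basis words. The topology used on it is the
  product topology on functions, i.e. convergence of all coefficients, which is the usual
  topology of this finite-dimensional space.
\<close>

definition trunc_space :: "nat \<Rightarrow> ('v::euclidean_space list \<Rightarrow> 'c::zero) set" where
  "trunc_space N = {a. \<forall>w. w \<notin> words_upto N \<longrightarrow> a w = 0}"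

definition tensor_power :: "nat \<Rightarrow> 'v::euclidean_space tensor set" where
  "tensor_power n = {a. \<forall>w. w \<notin> words n \<longrightarrow> a w = 0}"

definition tcomp :: "nat \<Rightarrow> 'v tensor \<Rightarrow> 'v tensor" where
  "tcomp n a = (\<lambda>w. if length w = n then a w else 0)"

definition tnorm :: "nat \<Rightarrow> 'v::euclidean_space tensor \<Rightarrow> real" where
  "tnorm n a = L2_set a (words n)"

definition tone :: "'v tensor" where
  "tone = (\<lambda>w. if w = [] then 1 else 0)"

definition tprod :: "'v tensor \<Rightarrow> 'v tensor \<Rightarrow> 'v tensor" where
  "tprod a b = (\<lambda>w. \<Sum>i\<le>length w. a (take i w) * b (drop i w))"

definition ttrunc :: "nat \<Rightarrow> 'v tensor \<Rightarrow> 'v tensor" where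
  "ttrunc N a = (\<lambda>w. if length w \<le> N then a w else 0)"

text \<open>The elementary tensor \<open>v\<^sub>1 \<otimes> \<dots> \<otimes> v\<^sub>n\<close>.\<close>

definition pure_tensor :: "'v::euclidean_space list \<Rightarrow> 'v tensor" where
  "pure_tensor vs =
     (\<lambda>w. if w \<in> words (length vs) then \<Prod>(v, b)\<leftarrow>zip vs w. v \<bullet> b else 0)"

text \<open>
  Elements of an external tensor product of tensor powers of degrees \<open>n\<^sub>1, \<dots>, n\<^sub>m\<close> are
  functions on lists of words, supported on \<open>listset (map words [n\<^sub>1, \<dots>, n\<^sub>m])\<close>.
\<close>

type_synonym 'v ext_tensor = "'v list list \<Rightarrow> real"

fun ext_prod :: "'v tensor list \<Rightarrow> 'v ext_tensor" where
  "ext_prod [] [] = 1"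
| "ext_prod (a # as) (w # ws) = a w * ext_prod as ws"
| "ext_prod _ _ = 0"

definition ext_norm :: "nat list \<Rightarrow> 'v::euclidean_space ext_tensor \<Rightarrow> real" where
  "ext_norm ns Y = L2_set Y (listset (map words ns))"


section \<open>Shuffles\<close>

text \<open>Positions are counted from \<open>0\<close>; block \<open>i\<close> consists of \<open>ns ! i\<close> consecutive positions.\<close>

definition block :: "nat list \<Rightarrow> nat \<Rightarrow> nat set" where
  "block ns i = {sum_list (take i ns)..<sum_list (take (Suc i) ns)}"

definition Sh :: "nat list \<Rightarrow> (nat \<Rightarrow> nat) set" where
  "Sh ns = {\<sigma>. \<sigma> permutes {..<sum_list ns} \<and>
      (\<forall>i<length ns. strict_mono_on (block ns i) \<sigma>)}"

definition OSh :: "nat list \<Rightarrow> (nat \<Rightarrow> nat) set" where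
  "OSh ns = {\<sigma> \<in> Sh ns.
      strict_mono_on {..<length ns} (\<lambda>i. \<sigma> (sum_list (take (Suc i) ns) - 1))}"

fun split_blocks :: "nat list \<Rightarrow> 'a list \<Rightarrow> 'a list list" where
  "split_blocks [] xs = []"
| "split_blocks (n # ns) xs = take n xs # split_blocks ns (drop n xs)"

definition permute_word :: "(nat \<Rightarrow> nat) \<Rightarrow> 'a list \<Rightarrow> 'a list" where
  "permute_word \<sigma> xs = map (\<lambda>i. xs ! \<sigma> i) [0..<length xs]"

text \<open>
  Linear extension of
  \<open>v\<^sub>1 \<otimes> \<dots> \<otimes> v\<^sub>n \<mapsto> \<Sum>\<sigma>\<in>S. (v\<^bsub>\<sigma>(1)\<^esub> \<otimes> \<dots>) \<boxtimes> \<dots> \<boxtimes> (\<dots> \<otimes> v\<^bsub>\<sigma>(n)\<^esub>)\<close>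
  from basis words; \<open>unshuffle_pure_tensor\<close> below gives the formula for arbitrary
  elementary tensors.
\<close>

definition unshuffle ::
  "(nat \<Rightarrow> nat) set \<Rightarrow> nat list \<Rightarrow> 'v::euclidean_space tensor \<Rightarrow> 'v ext_tensor" where
  "unshuffle S ns x = (\<lambda>ws. \<Sum>w\<in>words (sum_list ns). \<Sum>\<sigma>\<in>S.
      x w * of_bool (split_blocks ns (permute_word \<sigma> w) = ws))"

definition Delta_sh :: "nat \<Rightarrow> nat \<Rightarrow> 'v::euclidean_space tensor \<Rightarrow> 'v ext_tensor" where
  "Delta_sh a b = unshuffle (Sh [a, b]) [a, b]"

definition Delta_osh :: "nat list \<Rightarrow> 'v::euclidean_space tensor \<Rightarrow> 'v ext_tensor" where
  "Delta_osh ns = unshuffle (OSh ns) ns"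


section \<open>Pairings\<close>

text \<open>\<open>\<langle>h\<^sub>n, a\<rangle>\<close> for \<open>a\<close> of degree \<open>n\<close>, where \<open>h\<^sub>n\<close> is the restriction of the linear map \<open>h\<close>.\<close>

definition pairing ::
  "nat \<Rightarrow> ('v::euclidean_space list \<Rightarrow> 'u::euclidean_space) \<Rightarrow> 'v tensor \<Rightarrow> 'u" where
  "pairing n h a = (\<Sum>w\<in>words n. a w *\<^sub>R h w)"

text \<open>
  \<open>\<langle>h\<^bsub>n\<^sub>1\<^esub> \<boxtimes> \<dots> \<boxtimes> h\<^bsub>n\<^sub>m\<^esub>, Y\<rangle>\<close>, the linear extension of
  \<open>a\<^sub>1 \<boxtimes> \<dots> \<boxtimes> a\<^sub>m \<mapsto> \<langle>h\<^bsub>n\<^sub>1\<^esub>, a\<^sub>1\<rangle> \<otimes> \<dots> \<otimes> \<langle>h\<^bsub>n\<^sub>m\<^esub>, a\<^sub>m\<rangle>\<close>; see \<open>ext_pairing_ext_prod\<close>.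
\<close>

definition ext_pairing ::
  "nat list \<Rightarrow> ('v::euclidean_space list \<Rightarrow> 'u::euclidean_space) \<Rightarrow> 'v ext_tensor \<Rightarrow> 'u tensor"
where
  "ext_pairing ns h Y =
     (\<lambda>u. \<Sum>ws\<in>listset (map words ns). Y ws * pure_tensor (map h ws) u)"


section \<open>Rough paths and controlled paths\<close>

definition simplex2 :: "real \<Rightarrow> (real \<times> real) set" where
  "simplex2 T = {(s, t). 0 \<le> s \<and> s \<le> t \<and> t \<le> T}"

definition control :: "real \<Rightarrow> (real \<Rightarrow> real \<Rightarrow> real) \<Rightarrow> bool" where
  "control T \<omega> \<longleftrightarrow>
     continuous_on (simplex2 T) (\<lambda>(s, t). \<omega> s t) \<and>
     (\<forall>(s, t)\<in>simplex2 T. 0 \<le> \<omega> s t) \<and>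
     (\<forall>t. 0 \<le> t \<and> t \<le> T \<longrightarrow> \<omega> t t = 0) \<and>
     (\<forall>s u t. 0 \<le> s \<and> s \<le> u \<and> u \<le> t \<and> t \<le> T \<longrightarrow> \<omega> s u + \<omega> u t \<le> \<omega> s t)"

definition level :: "real \<Rightarrow> nat" where
  "level p = nat \<lfloor>p\<rfloor>"

text \<open>\<open>f\<^sub>s\<^sub>t = O(\<omega>(s,t)\<^bsup>m/p\<^esup>)\<close>, for the norm \<open>f\<close> of some two-parameter quantity.\<close>

definition bigO_ctrl ::
  "real \<Rightarrow> real \<Rightarrow> (real \<Rightarrow> real \<Rightarrow> real) \<Rightarrow> nat \<Rightarrow> (real \<Rightarrow> real \<Rightarrow> real) \<Rightarrow> bool" where
  "bigO_ctrl p T \<omega> m f \<longleftrightarrow>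
     (\<exists>C. \<forall>(s, t)\<in>simplex2 T. f s t \<le> C * \<omega> s t powr (real m / p))"

definition regular_tensor_map ::
  "real \<Rightarrow> real \<Rightarrow> (real \<Rightarrow> real \<Rightarrow> real) \<Rightarrow>
   (real \<Rightarrow> real \<Rightarrow> 'v::euclidean_space tensor) \<Rightarrow> bool" where
  "regular_tensor_map p T \<omega> X \<longleftrightarrow>
     (\<forall>(s, t)\<in>simplex2 T. X s t \<in> trunc_space (level p)) \<and>
     continuous_on (simplex2 T) (\<lambda>(s, t). X s t) \<and>
     (\<forall>(s, t)\<in>simplex2 T. tcomp 0 (X s t) = tone) \<and>
     (\<forall>n. 1 \<le> n \<and> n \<le> level p \<longrightarrow> bigO_ctrl p T \<omega> n (\<lambda>s t. tnorm n (X s t)))"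

definition rough_path ::
  "real \<Rightarrow> real \<Rightarrow> (real \<Rightarrow> real \<Rightarrow> real) \<Rightarrow>
   (real \<Rightarrow> real \<Rightarrow> 'v::euclidean_space tensor) \<Rightarrow> bool" where
  "rough_path p T \<omega> X \<longleftrightarrow>
     regular_tensor_map p T \<omega> X \<and>
     (\<forall>s u t. 0 \<le> s \<and> s \<le> u \<and> u \<le> t \<and> t \<le> T \<longrightarrow>
        X s t = ttrunc (level p) (tprod (X s u) (X u t))) \<and>
     (\<forall>a b. a + b \<le> level p \<longrightarrow> (\<forall>(s, t)\<in>simplex2 T.
        ext_prod [tcomp a (X s t), tcomp b (X s t)] = Delta_sh a b (tcomp (a + b) (X s t))))"

definition almost_rough_path ::
  "real \<Rightarrow> real \<Rightarrow> (real \<Rightarrow> real \<Rightarrow> real) \<Rightarrow>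
   (real \<Rightarrow> real \<Rightarrow> 'v::euclidean_space tensor) \<Rightarrow> bool" where
  "almost_rough_path p T \<omega> X \<longleftrightarrow>
     regular_tensor_map p T \<omega> X \<and>
     (\<forall>n\<le>level p. \<exists>C. \<forall>s u t. 0 \<le> s \<and> s \<le> u \<and> u \<le> t \<and> t \<le> T \<longrightarrow>
        tnorm n (\<lambda>w. X s t w - tprod (X s u) (X u t) w)
          \<le> C * \<omega> s t powr (real (level p + 1) / p)) \<and>
     (\<forall>a b. a + b \<le> level p \<longrightarrow>
        bigO_ctrl p T \<omega> (level p + 1) (\<lambda>s t. ext_norm [a, b]
          (\<lambda>ws. ext_prod [tcomp a (X s t), tcomp b (X s t)] ws
               - Delta_sh a b (tcomp (a + b) (X s t)) ws)))"

definition controlled_path ::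
  "real \<Rightarrow> real \<Rightarrow> (real \<Rightarrow> real \<Rightarrow> real) \<Rightarrow> (real \<Rightarrow> real \<Rightarrow> 'v::euclidean_space tensor) \<Rightarrow>
   (real \<Rightarrow> 'v list \<Rightarrow> 'u::euclidean_space) \<Rightarrow> bool" where
  "controlled_path p T \<omega> X H \<longleftrightarrow>
     (\<forall>t\<in>{0..T}. H t \<in> trunc_space (level p - 1)) \<and>
     continuous_on {0..T} H \<and>
     bigO_ctrl p T \<omega> 1
       (\<lambda>s t. L2_set (\<lambda>w. norm (H t w - H s w)) (words_upto (level p - 1))) \<and>
     (\<forall>n. n + 2 \<le> level p \<longrightarrow> (\<forall>a\<in>tensor_power n.
        bigO_ctrl p T \<omega> (level p - n) (\<lambda>s t. norm (pairing n (H t) a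
          - (\<Sum>k\<le>level p - 1 - n. pairing (n + k) (H s) (tprod (tcomp k (X s t)) a))))))"

text \<open>The trace of a controlled path: \<open>H\<^sub>0\<close> evaluated at \<open>1\<close>, the empty word.\<close>

definition ctrace :: "(real \<Rightarrow> 'v list \<Rightarrow> 'u) \<Rightarrow> real \<Rightarrow> 'u" where
  "ctrace H t = H t []"

definition lift_comp ::
  "nat \<Rightarrow> (real \<Rightarrow> real \<Rightarrow> 'v::euclidean_space tensor) \<Rightarrow>
   (real \<Rightarrow> 'v list \<Rightarrow> 'u::euclidean_space) \<Rightarrow> nat \<Rightarrow> real \<Rightarrow> real \<Rightarrow> 'u tensor" where
  "lift_comp N X H m s t =
     (if m = 0 then tone
      else if m = 1 then pure_tensor [ctrace H t - ctrace H s]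
      else (\<lambda>u. \<Sum>ns | length ns = m \<and> (\<forall>n\<in>set ns. 1 \<le> n) \<and> sum_list ns \<le> N.
              ext_pairing ns (H s) (Delta_osh ns (tcomp (sum_list ns) (X s t))) u))"

text \<open>The map whose components of degree \<open>m = 0, \<dots>, N\<close> are \<open>lift_comp N X H m\<close>.\<close>

definition almost_lift ::
  "nat \<Rightarrow> (real \<Rightarrow> real \<Rightarrow> 'v::euclidean_space tensor) \<Rightarrow>
   (real \<Rightarrow> 'v list \<Rightarrow> 'u::euclidean_space) \<Rightarrow> real \<Rightarrow> real \<Rightarrow> 'u tensor" where
  "almost_lift N X H s t =
     (\<lambda>u. if length u \<le> N then lift_comp N X H (length u) s t u else 0)"


section \<open>Products over partitions\<close>

text \<open>A partition is given by the increasing list of its points.\<close>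

definition partition_of :: "real \<Rightarrow> real \<Rightarrow> real list \<Rightarrow> bool" where
  "partition_of s t ts \<longleftrightarrow> ts \<noteq> [] \<and> hd ts = s \<and> last ts = t \<and> sorted_wrt (<) ts"

definition mesh :: "real list \<Rightarrow> real" where
  "mesh ts = Max (insert 0 {ts ! Suc i - ts ! i | i. Suc i < length ts})"

fun partition_prod :: "nat \<Rightarrow> (real \<Rightarrow> real \<Rightarrow> 'v tensor) \<Rightarrow> real list \<Rightarrow> 'v tensor" where
  "partition_prod N F (u # v # ts) = ttrunc N (tprod (F u v) (partition_prod N F (v # ts)))"
| "partition_prod N F _ = tone"


section \<open>Defining formulas on elementary tensors\<close>

lemma finite_words [simp]: "finite (words n :: 'v::euclidean_space list set)"
proof -
  have "words n = {w :: 'v list. set w \<subseteq> Basis \<and> length w = n}" by (auto simp: words_def)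
  then show ?thesis by (simp only: finite_lists_length_eq finite_Basis)
qed

lemma finite_listset_words [simp]:
  "finite (listset (map words ns) :: 'v::euclidean_space list list set)"
proof (induction ns)
  case (Cons n ns)
  have "listset (map words (n # ns))
      = (\<lambda>(x :: 'v list, xs). x # xs) ` (words n \<times> listset (map words ns))"
    by (auto simp: set_Cons_def)
  then show ?case using Cons by (simp only: finite_imageI finite_cartesian_product finite_words)
qed simp

lemma length_split_blocks: "length (split_blocks ns xs) = length ns"
  by (induction ns arbitrary: xs) auto

lemma pure_tensor_append:
  assumes "length w = n" "length v = length vs - n" "n \<le> length vs"
  shows "pure_tensor vs (w @ v) = pure_tensor (take n vs) w * pure_tensor (drop n vs) v"
proof -
  have "zip vs (w @ v) = zip (take n vs) w @ zip (drop n vs) v"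
    using assms by (simp add: zip_append2)
  moreover have "length vs = n + (length vs - n)" using assms by simp
  ultimately show ?thesis
    using assms by (auto simp: pure_tensor_def words_def)
qed

lemma sum_split_blocks:
  fixes vs :: "'v::euclidean_space list"
  assumes "length vs = sum_list ns"
  shows "(\<Sum>w\<in>words (sum_list ns). pure_tensor vs w * of_bool (split_blocks ns w = ws))
       = ext_prod (map pure_tensor (split_blocks ns vs)) ws"
  using assms
proof (induction ns arbitrary: vs ws)
  case Nil
  have "words 0 = {[] :: 'v list}" by (auto simp: words_def)
  then show ?case using Nil by (cases ws) (auto simp: pure_tensor_def)
next
  case (Cons n ns)
  let ?m = "sum_list ns"
  have len: "length vs = n + ?m" using Cons.prems by simp
  have bij: "bij_betw (\<lambda>(x, y). x @ y) (words n \<times> words ?m) (words (n + ?m) :: 'v list set)"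
  proof (rule bij_betwI[where g = "\<lambda>w. (take n w, drop n w)"])
    show "(\<lambda>w. (take n w, drop n w)) \<in> words (n + ?m) \<rightarrow> words n \<times> words ?m"
      by (auto simp: words_def dest: in_set_takeD in_set_dropD)
  qed (auto simp: words_def)
  show ?case
  proof (cases ws)
    case Nil
    then show ?thesis by simp
  next
    case (Cons x xs)
    have "(\<Sum>w\<in>words (n + ?m). pure_tensor vs w * of_bool (split_blocks (n # ns) w = ws))
        = (\<Sum>(a, b)\<in>words n \<times> words ?m.
             pure_tensor vs (a @ b) * of_bool (split_blocks (n # ns) (a @ b) = ws))"
      by (subst sum.reindex_bij_betw[OF bij, symmetric]) (simp only: case_prod_unfold)
    also have "\<dots> = (\<Sum>(a, b)\<in>words n \<times> words ?m.
        (pure_tensor (take n vs) a * of_bool (a = x)) *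
        (pure_tensor (drop n vs) b * of_bool (split_blocks ns b = xs)))"
      by (rule sum.cong) (use len Cons in
          \<open>auto simp: words_def pure_tensor_append split: if_splits\<close>)
    also have "\<dots> = (\<Sum>a\<in>words n. pure_tensor (take n vs) a * of_bool (a = x)) *
        (\<Sum>b\<in>words ?m. pure_tensor (drop n vs) b * of_bool (split_blocks ns b = xs))"
      by (simp only: sum_product sum.cartesian_product)
    also have "(\<Sum>a\<in>words n. pure_tensor (take n vs) a * of_bool (a = x))
        = pure_tensor (take n vs) x"
      using len by (auto simp: of_bool_def if_distrib pure_tensor_def sum.delta cong: if_cong)
    also have "(\<Sum>b\<in>words ?m. pure_tensor (drop n vs) b * of_bool (split_blocks ns b = xs))
        = ext_prod (map pure_tensor (split_blocks ns (drop n vs))) xs"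
      using Cons.IH[of "drop n vs"] len by simp
    finally show ?thesis using Cons by simp
  qed
qed

lemma permute_word_words:
  assumes "\<sigma> permutes {..<n}" "w \<in> words n"
  shows "permute_word \<sigma> w \<in> words n"
  using assms permutes_in_image[OF assms(1)]
  by (force simp: words_def permute_word_def)

lemma permute_word_inverse:
  assumes "\<sigma> permutes {..<length w}"
  shows "permute_word \<sigma> (permute_word (inv \<sigma>) w) = w"
    and "permute_word (inv \<sigma>) (permute_word \<sigma> w) = w"
  using permutes_in_image[OF assms] permutes_in_image[OF permutes_inv[OF assms]]
    permutes_inverses[OF assms]
  by (auto simp: permute_word_def intro!: nth_equalityI)

lemma pure_tensor_permute:
  assumes "\<sigma> permutes {..<n}" "length vs = n" "w \<in> words n"
  shows "pure_tensor (permute_word \<sigma> vs) (permute_word \<sigma> w) = pure_tensor vs w"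
proof -
  have len: "length w = n" using assms by (simp add: words_def)
  have "(\<Prod>(v, b)\<leftarrow>zip xs ys. v \<bullet> b) = (\<Prod>i<n. xs ! i \<bullet> ys ! i)"
    if "length xs = n" "length ys = n" for xs ys :: "'a list"
    using that
    by (induction n arbitrary: xs ys)
      (auto simp: length_Suc_conv prod.lessThan_Suc_shift simp del: prod.lessThan_Suc)
  then show ?thesis
    using assms len permute_word_words[OF assms(1,3)]
      prod.permute[OF assms(1), of "\<lambda>i. vs ! i \<bullet> w ! i"]
    by (simp add: pure_tensor_def permute_word_def o_def)
qed

lemma unshuffle_pure_tensor:
  assumes len: "length vs = sum_list ns"
    and S: "\<And>\<sigma>. \<sigma> \<in> S \<Longrightarrow> \<sigma> permutes {..<sum_list ns}"
  shows "unshuffle S ns (pure_tensor vs) ws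
       = (\<Sum>\<sigma>\<in>S. ext_prod (map pure_tensor (split_blocks ns (permute_word \<sigma> vs))) ws)"
proof -
  let ?n = "sum_list ns"
  have "(\<Sum>w\<in>words ?n. pure_tensor vs w * of_bool (split_blocks ns (permute_word \<sigma> w) = ws))
      = ext_prod (map pure_tensor (split_blocks ns (permute_word \<sigma> vs))) ws"
    if "\<sigma> \<in> S" for \<sigma>
  proof -
    have p: "\<sigma> permutes {..<?n}" using S that by simp
    have bij: "bij_betw (permute_word \<sigma>) (words ?n :: 'a list set) (words ?n)"
      by (rule bij_betwI[where g = "permute_word (inv \<sigma>)"])
        (use p permutes_inv[OF p] in
          \<open>auto simp: permute_word_words permute_word_inverse words_def[of ?n]
             intro!: permute_word_words[unfolded words_def, simplified]
             dest: permute_word_words[OF p, unfolded words_def, simplified]\<close>)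
    have "(\<Sum>w\<in>words ?n. pure_tensor vs w * of_bool (split_blocks ns (permute_word \<sigma> w) = ws))
        = (\<Sum>w\<in>words ?n. pure_tensor (permute_word \<sigma> vs) (permute_word \<sigma> w) *
             of_bool (split_blocks ns (permute_word \<sigma> w) = ws))"
      by (rule sum.cong) (simp_all add: pure_tensor_permute[OF p len])
    also have "\<dots> = (\<Sum>w\<in>words ?n. pure_tensor (permute_word \<sigma> vs) w *
             of_bool (split_blocks ns w = ws))"
      by (rule sum.reindex_bij_betw[OF bij])
    also have "\<dots> = ext_prod (map pure_tensor (split_blocks ns (permute_word \<sigma> vs))) ws"
      by (rule sum_split_blocks) (simp add: len permute_word_def)
    finally show ?thesis .
  qed
  then show ?thesis
    unfolding unshuffle_def by (subst sum.swap) simp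
qed

lemma ext_pairing_ext_prod:
  assumes "length as = length ns"
  shows "ext_pairing ns h (ext_prod as)
       = pure_tensor (map (\<lambda>(n, a). pairing n h a) (zip ns as))"
proof
  fix u
  show "ext_pairing ns h (ext_prod as) u
      = pure_tensor (map (\<lambda>(n, a). pairing n h a) (zip ns as)) u"
    using assms
  proof (induction ns arbitrary: as u)
    case Nil
    then show ?case by (simp add: ext_pairing_def)
  next
    case (Cons n ns)
    then obtain a as' where as: "as = a # as'" and l: "length as' = length ns"
      by (cases as) auto
    have inj: "inj_on (\<lambda>(x, xs). x # xs) (words n \<times> listset (map words ns))"
      by (auto simp: inj_on_def)
    have img: "listset (map words (n # ns))
        = (\<lambda>(x, xs). x # xs) ` (words n \<times> listset (map words ns))"
      by (auto simp: set_Cons_def)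
    have pc: "pure_tensor (v # vs) (b # u') = of_bool (b \<in> Basis) * (v \<bullet> b) * pure_tensor vs u'"
      for v b :: 'b and vs u'
      by (auto simp: pure_tensor_def words_def)
    show ?case
    proof (cases u)
      case Nil
      then show ?thesis using l as
        by (auto simp: ext_pairing_def pure_tensor_def words_def img sum.reindex[OF inj]
            intro!: sum.neutral)
    next
      case (Cons b u')
      have "ext_pairing (n # ns) h (ext_prod as) u
          = (\<Sum>(x, xs)\<in>words n \<times> listset (map words ns).
              a x * ext_prod as' xs * pure_tensor (h x # map h xs) (b # u'))"
        by (simp only: ext_pairing_def img sum.reindex[OF inj] as Cons)
          (simp add: case_prod_unfold)
      also have "\<dots> = of_bool (b \<in> Basis) * (\<Sum>x\<in>words n. a x * (h x \<bullet> b)) *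
          ext_pairing ns h (ext_prod as') u'"
        by (simp add: pc ext_pairing_def sum_product sum.cartesian_product sum_distrib_left
            mult_ac case_prod_unfold)
      also have "(\<Sum>x\<in>words n. a x * (h x \<bullet> b)) = pairing n h a \<bullet> b"
        by (simp add: pairing_def inner_sum_left)
      finally show ?thesis
        using Cons.IH[OF l] by (simp add: as Cons pc)
    qed
  qed
qed

end

theory Submission
  imports Defs
begin

text \<open>
  The ordered unshuffles, applied to \<open>H\<^sub>s\<close>, define a linear map \<open>\<Psi>\<^sub>s\<close> from words over \<open>V\<close> to
  words over \<open>U\<close> (\<open>osh (H s)\<close> below) with
  \<open>\<Psi>\<^sub>s(w x) = \<Sum> \<Psi>\<^sub>s(a) \<otimes> H\<^sub>s(b x)\<close>, the sum running over all splittings of \<open>w\<close> into subwords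
  \<open>a\<close>, \<open>b\<close>. This map is a morphism for the unshuffle coproducts, so \<open>\<Psi>\<^sub>s(X\<^sub>s\<^sub>t)\<close> satisfies
  integration by parts up to words of total length \<open>> N\<close>. For multiplicativity, one shows
  \<open>\<Psi>\<^sub>s(X\<^sub>s\<^sub>u \<otimes> w) \<approx> \<Psi>\<^sub>s(X\<^sub>s\<^sub>u) \<otimes> \<Psi>\<^sub>u(w)\<close> letter by letter: as \<open>X\<^sub>s\<^sub>u\<close> is group-like, its unshuffle
  coproduct separates the factors, and \<open>H\<^sub>s(X\<^sub>s\<^sub>u \<otimes> b x) \<approx> H\<^sub>u(b x)\<close> because \<open>H\<close> is controlled.

  The products over partitions satisfy a maximal inequality, proved by induction on the level and
  by removing points, which makes them Cauchy as the mesh vanishes. The limit is multiplicative; the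
  defect of an identity between limits (trace, integration by parts) is an additive function of
  order \<open>\<omega>(s,t)\<^bsup>\<theta>\<^esup>\<close> with \<open>\<theta> > 1\<close>, hence zero.
\<close>

section \<open>Words, unshuffles and ordered unshuffles\<close>

text \<open>Tensors are treated one coefficient at a time, so each comparison becomes a finite sum
  over words in which orders of vanishing add. Two things lose order. Truncation at level
  \<open>N\<close> is harmless: the pairs of words it discards have total length above
  \<open>N\<close>. The expansion of \<open>H\<close> is not: on a word \<open>w\<close> it is
  accurate to order \<open>N - length w\<close> only. The coefficient of \<open>X\<close> at
  \<open>w\<close> returns \<open>length w\<close>, which gives order \<open>N\<close>; the one
  order still missing has to come from another nonempty block. This is why degree \<open>1\<close>
  of the lift cannot be the expansion of the trace and is its true increment, and why that degree is
  always a separate case.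

  Ordering blocks by their last letters means that an appended letter only affects the final block,
  so the recursion for ordered unshuffles and the comparison of base points both run from the right
  end of words.

  The passage to the limit starts from an arbitrary almost rough path. It rests on
  \<open>Suc N / p\<close> exceeding 1: defects of that order, summed over a partition, vanish with
  the mesh, and the cost of removing points one by one is a convergent series.\<close>

declare sum_of_bool_mult_eq [simp del] sum_mult_of_bool_eq [simp del] sum_of_bool_eq [simp del]

section \<open>Indicator sums and sums over words\<close>

lemma sum_of_bool_mult:
  fixes f :: "'a \<Rightarrow> real"
  assumes "finite A"
  shows "(\<Sum>x\<in>A. of_bool (a = x) * f x) = (if a \<in> A then f a else 0)"
    "(\<Sum>x\<in>A. of_bool (x = a) * f x) = (if a \<in> A then f a else 0)"
proof -
  have "(\<Sum>x\<in>A. of_bool (x = a) * f x) = (\<Sum>x\<in>A. if x = a then f x else 0)"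
    by (rule sum.cong) auto
  then show "(\<Sum>x\<in>A. of_bool (x = a) * f x) = (if a \<in> A then f a else 0)"
    using assms by (simp add: sum.delta)
  then show "(\<Sum>x\<in>A. of_bool (a = x) * f x) = (if a \<in> A then f a else 0)"
    by (simp add: eq_commute)
qed

lemma words_0 [simp]: "words 0 = {[]}"
  by (auto simp: words_def)

lemma Nil_in_words [simp]: "[] \<in> words n \<longleftrightarrow> n = 0"
  by (auto simp: words_def)

lemma words_upto_iff: "w \<in> words_upto n \<longleftrightarrow> length w \<le> n \<and> set w \<subseteq> Basis"
  by (auto simp: words_upto_def words_def)

lemma words_iff: "w \<in> words n \<longleftrightarrow> length w = n \<and> set w \<subseteq> Basis"
  by (auto simp: words_def)

lemma finite_words_upto [simp]: "finite (words_upto n :: 'v::euclidean_space list set)"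
  by (simp add: words_upto_def)

text \<open>The last letter is split off rather than the first, to match the recursion of
  \<open>osh\<close>.\<close>

lemma sum_words_Suc:
  "(\<Sum>w\<in>words (Suc n). f w) = (\<Sum>w\<in>words n. \<Sum>x\<in>Basis. f (w @ [x]))"
    for f :: "'v::euclidean_space list \<Rightarrow> 'c::comm_monoid_add"
proof -
  have bij: "bij_betw (\<lambda>(w, x). w @ [x]) (words n \<times> Basis) (words (Suc n) :: 'v list set)"
    by (rule bij_betwI[where g = "\<lambda>w. (butlast w, last w)"])
      (auto simp: words_def length_Suc_conv_rev)
  show ?thesis
    by (subst sum.reindex_bij_betw[OF bij, symmetric]) (simp add: sum.cartesian_product
        case_prod_unfold)
qed

lemma sum_words_upto_levels:
  "(\<Sum>w\<in>words_upto n. f w) = (\<Sum>k\<le>n. \<Sum>w\<in>words k. f w)"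
    for f :: "'v::euclidean_space list \<Rightarrow> 'c::comm_monoid_add"
  unfolding words_upto_def
  by (rule sum.UNION_disjoint) (auto simp: words_iff)

lemma sum_words_cut:
  fixes f :: "'v::euclidean_space list \<Rightarrow> 'v list \<Rightarrow> 'c::comm_monoid_add"
  assumes "i \<le> n"
  shows "(\<Sum>w\<in>words n. f (take i w) (drop i w)) = (\<Sum>x\<in>words i. \<Sum>y\<in>words (n - i). f x y)"
proof -
  have "(\<Sum>w\<in>words n. f (take i w) (drop i w)) = (\<Sum>(x, y)\<in>words i \<times> words (n - i). f x y)"
    by (rule sum.reindex_bij_witness[where i = "\<lambda>(x, y). x @ y" and j = "\<lambda>w. (take i w, drop i w)"])
      (use assms in \<open>auto simp: words_iff dest!: in_set_takeD in_set_dropD\<close>)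
  then show ?thesis by (simp add: sum.cartesian_product)
qed

text \<open>Truncation of a concatenation product appears here as the condition on the total length
  of a pair of words; \<open>err_truncate\<close> later measures the pairs that this condition
  excludes.\<close>

lemma sum_words_upto_cut:
  "(\<Sum>w\<in>words_upto n. \<Sum>i\<le>length w. f (take i w) (drop i w))
    = (\<Sum>(x, y) | x \<in> words_upto n \<and> y \<in> words_upto n \<and> length x + length y \<le> n. f x y)"
    for f :: "'v::euclidean_space list \<Rightarrow> 'v list \<Rightarrow> 'c::comm_monoid_add"
proof -
  have "(\<Sum>w\<in>words_upto n. \<Sum>i\<le>length w. f (take i w) (drop i w))
     = (\<Sum>(w, i)\<in>(SIGMA w:words_upto n. {..length w}). f (take i w) (drop i w))"
    by (rule sum.Sigma) auto
  also have "\<dots> = (\<Sum>(x, y) | x \<in> words_upto n \<and> y \<in> words_upto n \<and> length x + length y \<le> n. f x y)"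
    by (rule sum.reindex_bij_witness[where
          i = "\<lambda>(x, y). (x @ y, length x)" and j = "\<lambda>(w, i). (take i w, drop i w)"])
      (auto simp: words_upto_iff dest!: in_set_takeD in_set_dropD)
  finally show ?thesis .
qed

section \<open>The unshuffle coproduct in dual form\<close>

text \<open>The sum of \<open>f a b\<close> over all ways to distribute the letters of a word to a subword \<open>a\<close>
  and the complementary subword \<open>b\<close>, i.e. \<open>f\<close> applied to the unshuffle coproduct of the word.\<close>

fun split_sum :: "('a list \<Rightarrow> 'a list \<Rightarrow> real) \<Rightarrow> 'a list \<Rightarrow> real" where
  "split_sum f [] = f [] []"
| "split_sum f (x # xs) = split_sum (\<lambda>a b. f (x # a) b) xs + split_sum (\<lambda>a b. f a (x # b)) xs"

lemma split_sum_cong: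
  assumes "\<And>a b. length a + length b = length w \<Longrightarrow> set a \<union> set b = set w \<Longrightarrow> f a b = g a b"
  shows "split_sum f w = split_sum g w"
  using assms
proof (induction w arbitrary: f g)
  case (Cons x w)
  have "split_sum (\<lambda>a b. f (x # a) b) w = split_sum (\<lambda>a b. g (x # a) b) w"
    "split_sum (\<lambda>a b. f a (x # b)) w = split_sum (\<lambda>a b. g a (x # b)) w"
    by (rule Cons.IH, rule Cons.prems, auto)+
  then show ?case by simp
qed simp

lemma split_sum_append:
  "split_sum f (v @ w) = split_sum (\<lambda>a b. split_sum (\<lambda>c d. f (a @ c) (b @ d)) w) v"
  by (induction v arbitrary: f) auto

lemma split_sum_snoc:
  "split_sum f (w @ [x]) = split_sum (\<lambda>a b. f (a @ [x]) b + f a (b @ [x])) w"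
  by (simp add: split_sum_append)

lemma split_sum_add: "split_sum (\<lambda>a b. f a b + g a b) w = split_sum f w + split_sum g w"
  by (induction w arbitrary: f g) auto

lemma split_sum_mult_left: "split_sum (\<lambda>a b. c * f a b) w = c * split_sum f w"
  by (induction w arbitrary: f) (auto simp: algebra_simps)

lemma split_sum_mult_right: "split_sum (\<lambda>a b. f a b * c) w = split_sum f w * c"
  by (induction w arbitrary: f) (auto simp: algebra_simps)

lemma split_sum_diff: "split_sum (\<lambda>a b. f a b - g a b) w = split_sum f w - split_sum g w"
  using split_sum_add[of f "\<lambda>a b. - 1 * g a b" w] split_sum_mult_left[of "-1" g w] by simp

lemma split_sum_0 [simp]: "split_sum (\<lambda>a b. 0) w = 0"
  by (induction w) auto

lemma split_sum_sum: "split_sum (\<lambda>a b. \<Sum>i\<in>I. f i a b) w = (\<Sum>i\<in>I. split_sum (f i) w)"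
  by (induction I rule: infinite_finite_induct) (auto simp: split_sum_add)

text \<open>Coassociativity of the unshuffle coproduct: a word is distributed to three subwords,
  whichever pair is separated last.\<close>

lemma split_sum_assoc:
  "split_sum (\<lambda>a b. split_sum (\<lambda>p q. f p q b) a) w = split_sum (\<lambda>a b. split_sum (\<lambda>p q. f a p q) b)
      w"
  by (induction w arbitrary: f) (auto simp: split_sum_add)

text \<open>Coassociativity together with cocommutativity: of the three subwords, the last two may
  exchange their roles.\<close>

lemma split_sum_comm3:
  "split_sum (\<lambda>a b. split_sum (\<lambda>p q. f p q b) a) w = split_sum (\<lambda>a b. split_sum (\<lambda>p q. f p b q) a)
      w"
proof (induction w arbitrary: f)
  case (Cons x w)
  show ?case
    using Cons.IH[of "\<lambda>p q b. f (x # p) q b"] Cons.IH[of "\<lambda>p q b. f p (x # q) b"]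
      Cons.IH[of "\<lambda>p q b. f p q (x # b)"]
    unfolding split_sum.simps split_sum_add by linarith
qed simp

text \<open>A splitting is determined by the set of positions given to the second subword. The word
  is written as the image under \<open>g\<close> of distinct positions because its letters may
  repeat. This connects the letter recursion with shuffles as permutations.\<close>

lemma split_sum_subsets:
  assumes "distinct xs"
  shows "split_sum f (map g xs) =
    (\<Sum>A\<in>Pow (set xs). f (map g (filter (\<lambda>i. i \<notin> A) xs)) (map g (filter (\<lambda>i. i \<in> A) xs)))"
  using assms
proof (induction xs arbitrary: f)
  case (Cons x xs)
  have 1: "inj_on (insert x) (Pow (set xs))"
    using Cons.prems by (auto simp: inj_on_def)
  have 2: "Pow (set xs) \<inter> insert x ` Pow (set xs) = {}"
    using Cons.prems by auto
  have 3: "filter (\<lambda>i. i \<notin> insert x A) xs = filter (\<lambda>i. i \<notin> A) xs"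
    "filter (\<lambda>i. i = x \<or> i \<in> A) xs = filter (\<lambda>i. i \<in> A) xs"
    "filter (\<lambda>i. i \<noteq> x \<and> i \<notin> A) xs = filter (\<lambda>i. i \<notin> A) xs" for A
    using Cons.prems by (auto intro!: filter_cong)
  have 4: "x \<notin> A" if "A \<subseteq> set xs" for A using that Cons.prems by auto
  let ?F = "\<lambda>A. f (map g (filter (\<lambda>i. i \<notin> A) (x # xs))) (map g (filter (\<lambda>i. i \<in> A) (x # xs)))"
  have "(\<Sum>A\<in>Pow (set (x # xs)). ?F A)
      = (\<Sum>A\<in>Pow (set xs). ?F A) + (\<Sum>A\<in>Pow (set xs). ?F (insert x A))"
    using 1 2 by (simp add: Pow_insert sum.union_disjoint sum.reindex del: filter.simps)
  also have "(\<Sum>A\<in>Pow (set xs). ?F A) = split_sum (\<lambda>a b. f (g x # a) b) (map g xs)"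
    using Cons.prems by (subst Cons.IH) (auto intro!: sum.cong dest: 4)
  also have "(\<Sum>A\<in>Pow (set xs). ?F (insert x A)) = split_sum (\<lambda>a b. f a (g x # b)) (map g xs)"
    using Cons.prems by (subst Cons.IH) (auto simp: 3 intro!: sum.cong)
  finally show ?case by simp
qed auto

section \<open>Coefficients of the shuffle product of two words\<close>

definition shuffle_count :: "'a list \<Rightarrow> 'a list \<Rightarrow> 'a list \<Rightarrow> real" where
  "shuffle_count x y w = split_sum (\<lambda>a b. of_bool (a = x \<and> b = y)) w"

lemma shuffle_count_eq_0:
  assumes "length w \<noteq> length x + length y"
  shows "shuffle_count x y w = 0"
proof -
  have "shuffle_count x y w = split_sum (\<lambda>a b. 0) w"
    unfolding shuffle_count_def by (rule split_sum_cong) (use assms in auto)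
  then show ?thesis by simp
qed

lemma split_sum_indicator_Nil:
  "split_sum (\<lambda>a b. of_bool (a = []) * f b) w = f w"
  "split_sum (\<lambda>a b. f a * of_bool (b = [])) w = f w"
  by (induction w arbitrary: f) auto

lemma shuffle_count_Nil [simp]:
  "shuffle_count [] y w = of_bool (w = y)" "shuffle_count x [] w = of_bool (w = x)"
  using split_sum_indicator_Nil(1)[of "\<lambda>b. of_bool (b = y)" w]
    split_sum_indicator_Nil(2)[of "\<lambda>b. of_bool (b = x)" w]
  by (simp_all add: shuffle_count_def of_bool_conj)

lemma shuffle_count_empty [simp]: "shuffle_count x y [] = of_bool (x = [] \<and> y = [])"
  by (auto simp: shuffle_count_def)

text \<open>The last letter of a shuffle is the last letter of one of the two words; this is the
  usual recursive definition of the shuffle product, read from the right.\<close>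

lemma shuffle_count_snoc:
  "shuffle_count (x @ [a]) (y @ [b]) (w @ [c])
    = of_bool (a = c) * shuffle_count x (y @ [b]) w + of_bool (b = c) * shuffle_count (x @ [a]) y w"
proof -
  have "split_sum (\<lambda>p q. of_bool (p @ [c] = x @ [a] \<and> q = y @ [b])) w
      = split_sum (\<lambda>p q. of_bool (a = c) * of_bool (p = x \<and> q = y @ [b])) w"
    "split_sum (\<lambda>p q. of_bool (p = x @ [a] \<and> q @ [c] = y @ [b])) w
      = split_sum (\<lambda>p q. of_bool (b = c) * of_bool (p = x @ [a] \<and> q = y)) w"
    by (rule split_sum_cong, auto)+
  then show ?thesis
    by (simp only: shuffle_count_def split_sum_snoc split_sum_add split_sum_mult_left)
qed

text \<open>At most one cut, the one at \<open>length a\<close>, can succeed. Written as a sum of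
  products, the condition on \<open>a @ c\<close> separates into conditions on \<open>a\<close> and
  on \<open>c\<close>.\<close>

lemma of_bool_append_eq:
  "of_bool (a @ c = x) = (\<Sum>i\<le>length x. of_bool (a = take i x) * of_bool (c = drop i x) :: real)"
proof -
  have "(\<Sum>i\<le>length x. of_bool (a = take i x) * of_bool (c = drop i x) :: real)
      = (\<Sum>i\<le>length x. if i = length a then of_bool (a @ c = x) else 0)"
    by (rule sum.cong) (auto simp: append_eq_conv_conj)
  also have "\<dots> = of_bool (a @ c = x)"
    by (auto simp: sum.delta)
  finally show ?thesis ..
qed

text \<open>The compatibility of the shuffle product with deconcatenation: each of \<open>x\<close>
  and \<open>y\<close> is cut where its letters pass from \<open>v\<close> to
  \<open>w\<close>.\<close>

lemma shuffle_count_append: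
  "shuffle_count x y (v @ w) = (\<Sum>i\<le>length x. \<Sum>j\<le>length y.
     shuffle_count (take i x) (take j y) v * shuffle_count (drop i x) (drop j y) w)"
proof -
  have "shuffle_count x y (v @ w) = split_sum (\<lambda>a b. split_sum (\<lambda>c d.
      of_bool (a @ c = x) * of_bool (b @ d = y)) w) v"
    by (simp add: shuffle_count_def split_sum_append of_bool_conj)
  also have "\<dots> = split_sum (\<lambda>a b. split_sum (\<lambda>c d. \<Sum>i\<le>length x. \<Sum>j\<le>length y.
      of_bool (a = take i x \<and> b = take j y) * of_bool (c = drop i x \<and> d = drop j y)) w) v"
    by (simp only: of_bool_append_eq sum_product of_bool_conj mult_ac)
  also have "\<dots> = (\<Sum>i\<le>length x. \<Sum>j\<le>length y.
     shuffle_count (take i x) (take j y) v * shuffle_count (drop i x) (drop j y) w)"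
    by (simp only: shuffle_count_def split_sum_sum split_sum_mult_left split_sum_mult_right)
  finally show ?thesis .
qed

text \<open>Brings \<open>split_sum\<close> into coordinates, so that integration by parts, which is
  known on pairs of basis words, can be applied to an arbitrary \<open>f\<close>.\<close>

lemma split_sum_shuffle_count:
  assumes "w \<in> words n"
  shows "split_sum f w = (\<Sum>k\<le>n. \<Sum>x\<in>words k. \<Sum>y\<in>words (n - k). shuffle_count x y w * f x y)"
proof -
  have "split_sum f w = split_sum (\<lambda>a b. \<Sum>k\<le>n. \<Sum>x\<in>words k. \<Sum>y\<in>words (n - k).
      of_bool (a = x \<and> b = y) * f x y) w"
  proof (rule split_sum_cong)
    fix a b assume l: "length a + length b = length w" "set a \<union> set b = set w"
    have m: "a \<in> words (length a)" "b \<in> words (n - length a)" "length a \<le> n"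
      using assms l by (auto simp: words_iff)
    have "(\<Sum>k\<le>n. \<Sum>x\<in>words k. \<Sum>y\<in>words (n - k). of_bool (a = x \<and> b = y) * f x y)
      = (\<Sum>k\<le>n. \<Sum>x\<in>words k. of_bool (a = x) * (\<Sum>y\<in>words (n - k). of_bool (b = y) * f x y))"
      by (simp only: sum_distrib_left of_bool_conj mult.assoc)
    also have "\<dots> = (\<Sum>k\<le>n. of_bool (k = length a) * (\<Sum>y\<in>words (n - k). of_bool (b = y) * f a y))"
      using m by (intro sum.cong) (auto simp: sum_of_bool_mult words_iff)
    also have "\<dots> = f a b"
      using m by (simp add: sum_of_bool_mult)
    finally show "f a b = (\<Sum>k\<le>n. \<Sum>x\<in>words k. \<Sum>y\<in>words (n - k).
      of_bool (a = x \<and> b = y) * f x y)" ..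
  qed
  also have "\<dots> = (\<Sum>k\<le>n. \<Sum>x\<in>words k. \<Sum>y\<in>words (n - k). shuffle_count x y w * f x y)"
    by (simp only: split_sum_sum split_sum_mult_right shuffle_count_def)
  finally show ?thesis .
qed

section \<open>Ordered unshuffles by recursion on the last letter\<close>

text \<open>The coefficient at \<open>u\<close> of \<open>\<Sum> h(B\<^sub>1) \<otimes> \<dots> \<otimes> h(B\<^sub>m)\<close> over the ordered unshuffles of \<open>w\<close> into
  nonempty blocks. Since the blocks are ordered by their last letters, the last letter of \<open>w\<close>
  lies in \<open>B\<^sub>m\<close>; this gives the recursion, for which \<open>u\<close> is read backwards.\<close>

primrec osh_rev :: "('v::euclidean_space list \<Rightarrow> 'u::euclidean_space) \<Rightarrow> 'u list \<Rightarrow> 'v list \<Rightarrow> real"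
    where
  "osh_rev h [] w = of_bool (w = [])"
| "osh_rev h (c # u) w = (if w = [] then 0 else
     split_sum (\<lambda>a b. osh_rev h u a * (h (b @ [last w]) \<bullet> c)) (butlast w))"

definition osh where "osh h u w = osh_rev h (rev u) w"

lemma osh_simps [simp]:
  "osh h [] w = of_bool (w = [])"
  "osh h (u @ [c]) [] = 0"
  "osh h (u @ [c]) (w @ [x]) = split_sum (\<lambda>a b. osh h u a * (h (b @ [x]) \<bullet> c)) w"
  by (simp_all add: osh_def)

lemma osh_Nil: "osh h u [] = of_bool (u = [])"
  by (cases u rule: rev_cases) simp_all

text \<open>All blocks are nonempty, so there are at most as many blocks as letters. This is what
  gives the degree \<open>m\<close> part of the lift its order \<open>m\<close>.\<close>

lemma osh_eq_0: "length w < length u \<Longrightarrow> osh h u w = 0"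
proof (induction u arbitrary: w rule: rev_induct)
  case (snoc c u)
  show ?case
  proof (cases w rule: rev_cases)
    case (snoc v x)
    have "osh h (u @ [c]) w = split_sum (\<lambda>a b. 0) v"
      unfolding snoc osh_simps
      by (rule split_sum_cong) (use snoc snoc.prems snoc.IH in auto)
    then show ?thesis by simp
  qed simp
qed auto

lemma sum_shuffle_count_snoc:
  fixes F :: "'u::euclidean_space list \<Rightarrow> 'u \<Rightarrow> real"
  assumes "a \<in> Basis" "b \<in> Basis"
  shows "(\<Sum>w\<in>words (Suc n). shuffle_count (x @ [a]) (y @ [b]) w * F (butlast w) (last w))
    = (\<Sum>w\<in>words n. shuffle_count x (y @ [b]) w * F w a) + (\<Sum>w\<in>words n. shuffle_count (x @ [a]) y w
        * F w b)"
proof -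
  have "(\<Sum>c\<in>Basis. shuffle_count (x @ [a]) (y @ [b]) (w @ [c]) * F w c)
      = shuffle_count x (y @ [b]) w * F w a + shuffle_count (x @ [a]) y w * F w b" for w
    using assms
    by (simp add: shuffle_count_snoc distrib_right sum.distrib mult.assoc sum_of_bool_mult)
  then show ?thesis
    by (simp add: sum_words_Suc sum.distrib)
qed

text \<open>In other words, \<open>w \<mapsto> \<Sum>\<^sub>z osh h z w \<cdot> z\<close> is a morphism for the unshuffle coproducts.\<close>

lemma osh_shuffle:
  fixes h :: "'v::euclidean_space list \<Rightarrow> 'u::euclidean_space"
  assumes "u \<in> words m" "v \<in> words n"
  shows "(\<Sum>z\<in>words (m + n). shuffle_count u v z * osh h z w)
    = split_sum (\<lambda>a b. osh h u a * osh h v b) w"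
  using assms
proof (induction "m + n" arbitrary: m n u v w rule: less_induct)
  case less
  show ?case
  proof (cases u rule: rev_cases)
    case Nil
    with less.prems show ?thesis
      by (simp add: words_iff split_sum_indicator_Nil sum_of_bool_mult words_0)
  next
    case u: (snoc u' c)
    show ?thesis
    proof (cases v rule: rev_cases)
      case Nil
      with less.prems show ?thesis
        by (simp add: words_iff split_sum_indicator_Nil sum_of_bool_mult words_0)
    next
      case v: (snoc v' d)
      obtain m' n' where mn: "m = Suc m'" "n = Suc n'"
        using less.prems u v by (auto simp: words_iff)
      have mem: "u' \<in> words m'" "v' \<in> words n'" "c \<in> Basis" "d \<in> Basis"
        using less.prems u v mn by (auto simp: words_iff)
      show ?thesis
      proof (cases w rule: rev_cases)
        case Nil
        then show ?thesis using u v
          by (auto simp: osh_Nil intro!: sum.neutral)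
      next
        case w: (snoc w' x)
        have "(\<Sum>z\<in>words (m + n). shuffle_count u v z * osh h z w)
          = (\<Sum>z\<in>words (Suc (m' + n)). shuffle_count (u' @ [c]) (v' @ [d]) z *
              split_sum (\<lambda>a b. osh h (butlast z) a * (h (b @ [x]) \<bullet> last z)) w')"
        proof (intro sum.cong)
          fix z :: "'u list" assume "z \<in> words (Suc (m' + n))"
          then obtain z' e where "z = z' @ [e]"
            by (cases z rule: rev_cases) (auto simp: words_iff)
          then show "shuffle_count u v z * osh h z w = shuffle_count (u' @ [c]) (v' @ [d]) z *
              split_sum (\<lambda>a b. osh h (butlast z) a * (h (b @ [x]) \<bullet> last z)) w'"
            by (simp add: u v w)
        qed (simp add: mn)
        also have "\<dots> = (\<Sum>z\<in>words (m' + n). shuffle_count u' v z *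
              split_sum (\<lambda>a b. osh h z a * (h (b @ [x]) \<bullet> c)) w')
            + (\<Sum>z\<in>words (m + n'). shuffle_count u v' z *
              split_sum (\<lambda>a b. osh h z a * (h (b @ [x]) \<bullet> d)) w')"
          using sum_shuffle_count_snoc[OF mem(3,4), where n = "m' + n" and
              F = "\<lambda>z e. split_sum (\<lambda>a b. osh h z a * (h (b @ [x]) \<bullet> e)) w'"]
          by (simp add: u v mn)
        also have "(\<Sum>z\<in>words (m' + n). shuffle_count u' v z *
              split_sum (\<lambda>a b. osh h z a * (h (b @ [x]) \<bullet> c)) w')
            = split_sum (\<lambda>a b. (\<Sum>z\<in>words (m' + n). shuffle_count u' v z * osh h z a)
                * (h (b @ [x]) \<bullet> c)) w'"
          by (simp add: split_sum_mult_left[symmetric] split_sum_sum sum_distrib_right mult.assoc)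
        also have "\<dots> = split_sum (\<lambda>a b. split_sum (\<lambda>p q. osh h u' p * osh h v q * (h (b @ [x]) \<bullet> c))
            a) w'"
          using less.hyps[of m' n u' v] less.prems mem mn by (simp add: split_sum_mult_right)
        \<comment> \<open>The letter \<open>x\<close> ends the final block attached either to
          \<open>u\<close> or to \<open>v\<close>. Here it is the one of \<open>u\<close>, so the
          subword preceding \<open>x\<close> has to be grouped with the blocks of \<open>u'\<close>
          instead of being the outer part.\<close>
        also have "\<dots> = split_sum (\<lambda>a b. split_sum (\<lambda>p q. osh h u' p * osh h v b * (h (q @ [x]) \<bullet> c))
            a) w'"
          by (rule split_sum_comm3)
        also have "\<dots> = split_sum (\<lambda>a b. osh h u (a @ [x]) * osh h v b) w'"
          by (simp only: u osh_simps split_sum_mult_right[symmetric] split_sum_mult_left[symmetric]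
              mult_ac)
        also have "(\<Sum>z\<in>words (m + n'). shuffle_count u v' z *
              split_sum (\<lambda>a b. osh h z a * (h (b @ [x]) \<bullet> d)) w')
            = split_sum (\<lambda>a b. (\<Sum>z\<in>words (m + n'). shuffle_count u v' z * osh h z a)
                * (h (b @ [x]) \<bullet> d)) w'"
          by (simp add: split_sum_mult_left[symmetric] split_sum_sum sum_distrib_right mult.assoc)
        also have "\<dots> = split_sum (\<lambda>a b. split_sum (\<lambda>p q. osh h u p * osh h v' q * (h (b @ [x]) \<bullet> d))
            a) w'"
          using less.hyps[of m n' u v'] less.prems mem mn by (simp add: split_sum_mult_right)
        also have "\<dots> = split_sum (\<lambda>a b. split_sum (\<lambda>p q. osh h u a * osh h v' p * (h (q @ [x]) \<bullet> d))
            b) w'"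
          by (rule split_sum_assoc)
        also have "\<dots> = split_sum (\<lambda>a b. osh h u a * osh h v (b @ [x])) w'"
          by (simp only: v osh_simps split_sum_mult_right[symmetric] split_sum_mult_left[symmetric]
              mult_ac)
        finally show ?thesis
          by (simp add: w split_sum_snoc split_sum_add)
      qed
    qed
  qed
qed

section \<open>Ordered shuffles as ordered set partitions\<close>

lemma concat_split_blocks: "length xs = sum_list ns \<Longrightarrow> concat (split_blocks ns xs) = xs"
  by (induction ns arbitrary: xs) auto

lemma map_length_split_blocks: "length xs = sum_list ns \<Longrightarrow> map length (split_blocks ns xs) = ns"
  by (induction ns arbitrary: xs) auto

lemma split_blocks_concat: "split_blocks (map length Bs) (concat Bs) = Bs"
  by (induction Bs) auto

lemma split_blocks_map: "split_blocks ns (map f xs) = map (map f) (split_blocks ns xs)"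
  by (induction ns arbitrary: xs) (auto simp: take_map drop_map)

lemma nth_split_blocks:
  "i < length ns \<Longrightarrow> split_blocks ns xs ! i = take (ns ! i) (drop (sum_list (take i ns)) xs)"
proof (induction ns arbitrary: xs i)
  case (Cons n ns)
  then show ?case by (cases i) (auto simp: add.commute)
qed simp

lemma split_blocks_in_listset_words:
  "w \<in> words (sum_list ns) \<Longrightarrow> split_blocks ns w \<in> listset (map words ns)"
proof (induction ns arbitrary: w)
  case (Cons n ns)
  have "take n w \<in> words n" "drop n w \<in> words (sum_list ns)"
    using Cons.prems by (auto simp: words_iff dest!: in_set_takeD in_set_dropD)
  then show ?case using Cons.IH by (auto simp: set_Cons_def)
qed simp

lemma sum_list_take_Suc: "i < length ns \<Longrightarrow> sum_list (take (Suc i) ns) = sum_list (take i ns)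
    + ns ! i"
  for ns :: "nat list"
  by (simp add: take_Suc_conv_app_nth)

lemma sum_list_take_le: "sum_list (take i ns) \<le> sum_list ns" for ns :: "nat list"
  by (metis append_take_drop_id le_add1 sum_list_append)

text \<open>The one-line notation of \<open>\<sigma>\<close>, cut into blocks: each block lists the
  positions from which the corresponding factor of the unshuffled word takes its letters.\<close>

definition perm_blocks :: "nat list \<Rightarrow> (nat \<Rightarrow> nat) \<Rightarrow> nat list list" where
  "perm_blocks ns \<sigma> = split_blocks ns (map \<sigma> [0..<sum_list ns])"

lemma split_blocks_permute_word:
  "length w = sum_list ns \<Longrightarrow> split_blocks ns (permute_word \<sigma> w) = map (map ((!) w)) (perm_blocks ns
      \<sigma>)"
  unfolding perm_blocks_def permute_word_def
  by (simp add: split_blocks_map[symmetric] o_def)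

lemma length_perm_blocks [simp]: "length (perm_blocks ns \<sigma>) = length ns"
  by (simp add: perm_blocks_def length_split_blocks)

lemma nth_perm_blocks:
  assumes "i < length ns"
  shows "perm_blocks ns \<sigma> ! i = map \<sigma> [sum_list (take i ns)..<sum_list (take (Suc i) ns)]"
proof -
  have "sum_list (take i ns) + ns ! i \<le> sum_list ns"
    using sum_list_take_le[of "Suc i" ns] sum_list_take_Suc[OF assms] by simp
  then show ?thesis
    using assms
    by (simp add: perm_blocks_def nth_split_blocks sum_list_take_Suc drop_map take_map)
qed

lemma strict_mono_on_iff_sorted_map_upt:
  "strict_mono_on {a..<b} \<sigma> \<longleftrightarrow> sorted_wrt (<) (map \<sigma> [a..<b])" for \<sigma> :: "nat \<Rightarrow> nat"
proof
  assume *: "sorted_wrt (<) (map \<sigma> [a..<b])"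
  show "strict_mono_on {a..<b} \<sigma>"
  proof (rule strict_mono_onI)
    fix r s assume rs: "r \<in> {a..<b}" "s \<in> {a..<b}" "r < s"
    then show "\<sigma> r < \<sigma> s"
      using sorted_wrt_nth_less[OF *, of "r - a" "s - a"] by auto
  qed
next
  assume *: "strict_mono_on {a..<b} \<sigma>"
  then show "sorted_wrt (<) (map \<sigma> [a..<b])"
    by (simp add: sorted_wrt_iff_nth_less strict_mono_onD[OF *])
qed

lemma Sh_iff_perm_blocks:
  "\<sigma> \<in> Sh ns \<longleftrightarrow> \<sigma> permutes {..<sum_list ns} \<and> (\<forall>B\<in>set (perm_blocks ns \<sigma>). sorted_wrt (<) B)"
  by (auto simp: Sh_def block_def strict_mono_on_iff_sorted_map_upt nth_perm_blocks
      all_set_conv_all_nth)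

text \<open>With positive sizes, \<open>sum_list (take (Suc i) ns) - 1\<close> is the last position
  of block \<open>i\<close>, so the ordering condition compares the last entries of the blocks. An
  empty block would make it refer to an earlier one.\<close>

lemma OSh_iff_perm_blocks:
  assumes "\<forall>n\<in>set ns. 1 \<le> n"
  shows "\<sigma> \<in> OSh ns \<longleftrightarrow> \<sigma> \<in> Sh ns \<and> sorted_wrt (<) (map last (perm_blocks ns \<sigma>))"
proof -
  have "last (perm_blocks ns \<sigma> ! i) = \<sigma> (sum_list (take (Suc i) ns) - 1)" if i: "i < length ns"
      for i
  proof -
    have "1 \<le> ns ! i" using assms i by auto
    then show ?thesis
      using sum_list_take_Suc[OF i] by (auto simp: nth_perm_blocks[OF i] last_map)
  qed
  then have "map last (perm_blocks ns \<sigma>) = map (\<lambda>i. \<sigma> (sum_list (take (Suc i) ns) - 1)) [0..<length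
      ns]"
    by (auto intro!: nth_equalityI)
  then show ?thesis
    by (simp add: OSh_def strict_mono_on_iff_sorted_map_upt[symmetric] lessThan_atLeast0)
qed

definition shuffle_blocks :: "nat list \<Rightarrow> nat list list set" where
  "shuffle_blocks ns = {Bs. map length Bs = ns \<and> (\<forall>B\<in>set Bs. sorted_wrt (<) B) \<and>
     distinct (concat Bs) \<and> set (concat Bs) = {..<sum_list ns}}"

text \<open>Concatenating the blocks restores the one-line notation. The inverse has to be the
  identity from \<open>sum_list ns\<close> on, because a permutation of a set fixes all other
  points.\<close>

lemma bij_betw_perm_blocks: "bij_betw (perm_blocks ns) (Sh ns) (shuffle_blocks ns)"
proof (rule bij_betwI[where g = "\<lambda>Bs i. if i < sum_list ns then concat Bs ! i else i"])
  let ?g = "\<lambda>Bs i. if i < sum_list ns then concat Bs ! i else i"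
  have len: "length (concat Bs) = sum_list ns" if "Bs \<in> shuffle_blocks ns" for Bs
    using that by (auto simp: shuffle_blocks_def length_concat)
  have pg: "perm_blocks ns (?g Bs) = Bs" if "Bs \<in> shuffle_blocks ns" for Bs
  proof -
    have "map (?g Bs) [0..<sum_list ns] = concat Bs"
      using len[OF that] by (auto intro!: nth_equalityI)
    then show ?thesis
      using that split_blocks_concat[of Bs] by (simp add: perm_blocks_def shuffle_blocks_def)
  qed
  show "perm_blocks ns \<in> Sh ns \<rightarrow> shuffle_blocks ns"
  proof
    fix \<sigma> assume s: "\<sigma> \<in> Sh ns"
    then have p: "\<sigma> permutes {..<sum_list ns}" by (simp add: Sh_def)
    have "concat (perm_blocks ns \<sigma>) = map \<sigma> [0..<sum_list ns]"
      by (simp add: perm_blocks_def concat_split_blocks)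
    moreover have "\<sigma> ` {0..<sum_list ns} = {..<sum_list ns}"
      using permutes_image[OF p] by (simp add: lessThan_atLeast0)
    ultimately have "distinct (concat (perm_blocks ns \<sigma>))"
      "set (concat (perm_blocks ns \<sigma>)) = {..<sum_list ns}"
      using permutes_inj_on[OF p] by (simp_all add: distinct_map del: set_concat)
    then show "perm_blocks ns \<sigma> \<in> shuffle_blocks ns"
      using s by (simp add: Sh_iff_perm_blocks shuffle_blocks_def perm_blocks_def
          map_length_split_blocks del: set_concat)
  qed
  show "?g \<in> shuffle_blocks ns \<rightarrow> Sh ns"
  proof
    fix Bs assume B: "Bs \<in> shuffle_blocks ns"
    have "bij_betw (?g Bs) {..<sum_list ns} {..<sum_list ns}"
    proof -
      have "bij_betw ((!) (concat Bs)) {..<sum_list ns} {..<sum_list ns}"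
        by (rule bij_betw_nth) (use B len[OF B] in \<open>auto simp: shuffle_blocks_def\<close>)
      then show ?thesis by (rule bij_betw_cong[THEN iffD1, rotated]) auto
    qed
    then have "?g Bs permutes {..<sum_list ns}"
      by (rule bij_imp_permutes) auto
    then show "?g Bs \<in> Sh ns"
      using B pg[OF B] by (auto simp: Sh_iff_perm_blocks shuffle_blocks_def)
  qed
  show "perm_blocks ns (?g Bs) = Bs" if "Bs \<in> shuffle_blocks ns" for Bs
    by (rule pg[OF that])
  show "?g (perm_blocks ns \<sigma>) = \<sigma>" if "\<sigma> \<in> Sh ns" for \<sigma>
    using that by (auto simp: perm_blocks_def concat_split_blocks Sh_def permutes_def fun_eq_iff)
qed

lemma filter_upt_conv_sorted:
  assumes "sorted_wrt (<) B" "set B \<subseteq> {..<n}" and P: "\<And>i. i < n \<Longrightarrow> P i \<longleftrightarrow> i \<in> set B"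
  shows "filter P [0..<n] = B"
proof (rule strict_sorted_equal)
  show "sorted_wrt (<) (filter P [0..<n])"
    by (simp add: sorted_wrt_filter)
qed (use assms in auto)

text \<open>A shuffle of two blocks is determined by the set of positions in its second block, and
  \<open>split_sum_subsets\<close> is a sum over such sets. Sets of the wrong size contribute
  nothing since the lengths of \<open>x\<close> and \<open>y\<close> are fixed.\<close>

lemma sum_Sh_eq_shuffle_count:
  assumes "length x = a" "length y = b" "length w = a + b"
  shows "(\<Sum>\<sigma>\<in>Sh [a, b]. of_bool (split_blocks [a, b] (permute_word \<sigma> w) = [x, y]))
    = shuffle_count x y w"
proof -
  let ?n = "a + b"
  let ?P = "\<lambda>A. [filter (\<lambda>i. i \<notin> A) [0..<?n], filter (\<lambda>i. i \<in> A) [0..<?n]]"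
  let ?F = "\<lambda>Bs. of_bool (map (map ((!) w)) Bs = [x, y]) :: real"
  have w: "map ((!) w) [0..<?n] = w"
    using assms map_nth[of w] by simp
  have "shuffle_count x y w = (\<Sum>A\<in>Pow {..<?n}. ?F (?P A))"
    using split_sum_subsets[of "[0..<?n]" "\<lambda>p q. of_bool (p = x \<and> q = y)" "(!) w"]
    by (simp add: w shuffle_count_def lessThan_atLeast0)
  also have "\<dots> = (\<Sum>A | A \<in> Pow {..<?n} \<and> map length (?P A) = [a, b]. ?F (?P A))"
  proof (rule sum.mono_neutral_right)
    show "\<forall>A\<in>Pow {..<?n} - {A. A \<in> Pow {..<?n} \<and> map length (?P A) = [a, b]}. ?F (?P A) = 0"
    proof
      fix A assume "A \<in> Pow {..<?n} - {A. A \<in> Pow {..<?n} \<and> map length (?P A) = [a, b]}"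
      then have "map length (?P A) \<noteq> [a, b]" by simp
      moreover have "map length (map (map ((!) w)) (?P A)) = map length (?P A)" by simp
      moreover have "map length [x, y] = [a, b]" using assms by simp
      ultimately have "map (map ((!) w)) (?P A) \<noteq> [x, y]" by metis
      then show "?F (?P A) = 0" by simp
    qed
  qed auto
  also have "\<dots> = (\<Sum>Bs\<in>shuffle_blocks [a, b]. ?F Bs)"
  proof (rule sum.reindex_bij_witness[where i = "\<lambda>Bs. set (Bs ! 1)" and j = ?P])
    fix Bs assume B: "Bs \<in> shuffle_blocks [a, b]"
    then obtain C D where CD: "Bs = [C, D]" "length C = a" "length D = b"
      by (auto simp: shuffle_blocks_def map_eq_Cons_conv)
    have s: "sorted_wrt (<) C" "sorted_wrt (<) D" "set C \<inter> set D = {}" "set C \<union> set D = {..<?n}"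
      using B by (auto simp: shuffle_blocks_def CD(1))
    have "filter (\<lambda>i. i \<notin> set D) [0..<?n] = C" "filter (\<lambda>i. i \<in> set D) [0..<?n] = D"
      using s by (auto intro!: filter_upt_conv_sorted)
    then show "?P (set (Bs ! 1)) = Bs"
      by (simp add: CD)
    then show "set (Bs ! 1) \<in> {A. A \<in> Pow {..<?n} \<and> map length (?P A) = [a, b]}"
      using CD s by auto
  next
    fix A assume "A \<in> {A. A \<in> Pow {..<?n} \<and> map length (?P A) = [a, b]}"
    then show "set (?P A ! 1) = A" "?P A \<in> shuffle_blocks [a, b]"
      by (auto simp: shuffle_blocks_def sorted_wrt_filter)
  qed simp
  also have "\<dots> = (\<Sum>\<sigma>\<in>Sh [a, b]. ?F (perm_blocks [a, b] \<sigma>))"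
    by (rule sum.reindex_bij_betw[OF bij_betw_perm_blocks, symmetric])
  also have "\<dots> = (\<Sum>\<sigma>\<in>Sh [a, b]. of_bool (split_blocks [a, b] (permute_word \<sigma> w) = [x, y]))"
    using assms by (simp only: split_blocks_permute_word sum_list.Cons sum_list.Nil add_0_right)
  finally show ?thesis ..
qed

lemma Delta_sh_eq:
  assumes "x \<in> words a" "y \<in> words b"
  shows "Delta_sh a b Y [x, y] = (\<Sum>w\<in>words (a + b). Y w * shuffle_count x y w)"
  using assms
  by (auto simp: Delta_sh_def unshuffle_def sum_distrib_left[symmetric] sum_Sh_eq_shuffle_count
      words_iff
      simp del: split_blocks.simps intro!: sum.cong)

lemma Delta_sh_eq_0:
  assumes "ws \<notin> listset (map words [a, b])"
  shows "Delta_sh a b Y ws = 0"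
proof -
  have "split_blocks [a, b] (permute_word \<sigma> w) \<noteq> ws" if "w \<in> words (sum_list [a, b])"
      "\<sigma> \<in> Sh [a, b]" for w \<sigma>
    using split_blocks_in_listset_words[OF permute_word_words[OF _ that(1)], of \<sigma>] that(2) assms
    by (auto simp: Sh_def simp del: split_blocks.simps listset.simps list.map)
  then show ?thesis
    by (auto simp: Delta_sh_def unshuffle_def simp del: split_blocks.simps intro!: sum.neutral)
qed

text \<open>Ordering the blocks by their maxima lists each set partition of \<open>S\<close> into
  \<open>m\<close> nonempty blocks exactly once. Block sizes are not prescribed, so the double sum
  over sizes and ordered shuffles becomes a single one.\<close>

definition ordered_parts :: "nat set \<Rightarrow> nat \<Rightarrow> nat list list set" where
  "ordered_parts S m = {Bs. length Bs = m \<and> (\<forall>B\<in>set Bs. B \<noteq> [] \<and> sorted_wrt (<) B) \<and>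
     distinct (concat Bs) \<and> set (concat Bs) = S \<and> sorted_wrt (<) (map last Bs)}"

lemma ordered_parts_0: "ordered_parts S 0 = (if S = {} then {[]} else {})"
  by (auto simp: ordered_parts_def)

lemma ordered_parts_empty: "ordered_parts {} (Suc m) = {}"
  by (auto simp: ordered_parts_def length_Suc_conv)

lemma sorted_le_last: "sorted_wrt (<) B \<Longrightarrow> x \<in> set B \<Longrightarrow> x \<le> last B" for B :: "nat list"
  by (cases B rule: rev_cases) (auto simp: sorted_wrt_append)

text \<open>The maximum \<open>M\<close> ends whichever block contains it, and no block has a larger
  last element than the final one.\<close>

lemma ordered_parts_last:
  assumes "Bs @ [B] \<in> ordered_parts (insert M S) m" "\<And>i. i \<in> S \<Longrightarrow> i < M"
  shows "last B = M"
proof -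
  have s: "sorted_wrt (<) (map last Bs @ [last B])" "\<forall>C\<in>set (Bs @ [B]). C \<noteq> [] \<and> sorted_wrt (<) C"
    and u: "set (concat (Bs @ [B])) = insert M S"
    using assms(1) by (auto simp: ordered_parts_def)
  obtain C where C: "C \<in> set (Bs @ [B])" "M \<in> set C"
    using u by (auto simp: set_eq_iff)
  have "M \<le> last C" using C s(2) sorted_le_last by blast
  also have "last C \<le> last B"
    using C(1) s(1) by (auto simp: sorted_wrt_append less_imp_le)
  finally have "M \<le> last B" .
  moreover have "last B \<in> insert M S"
    using u s(2) last_in_set[of B] by auto
  ultimately show ?thesis using assms(2)[of "last B"] by auto
qed

text \<open>\<open>A\<close> collects what joins \<open>M\<close> in the final block, and the
  remaining blocks partition the rest. This is the recursion of \<open>osh\<close>, with sets of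
  positions in place of subwords.\<close>

lemma sum_ordered_parts_Suc:
  assumes "finite S" and M: "\<And>i. i \<in> S \<Longrightarrow> i < M"
  shows "(\<Sum>Bs\<in>ordered_parts (insert M S) (Suc m). F (butlast Bs) (last Bs))
    = (\<Sum>A\<in>Pow S. \<Sum>Bs\<in>ordered_parts (S - A) m. F Bs (sorted_list_of_set A @ [M]))"
proof -
  have fin: "finite A" if "A \<subseteq> S" for A using assms(1) that finite_subset by blast
  have "finite (ordered_parts (S - A) m)" for A
  proof (rule finite_subset)
    show "ordered_parts (S - A) m \<subseteq> {Bs. set Bs \<subseteq> {B. set B \<subseteq> S \<and> distinct B} \<and> length Bs = m}"
      by (auto simp: ordered_parts_def strict_sorted_iff)
  qed (simp add: finite_lists_length_eq assms(1) finite_subset_distinct)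
  then have "(\<Sum>A\<in>Pow S. \<Sum>Bs\<in>ordered_parts (S - A) m. F Bs (sorted_list_of_set A @ [M]))
     = (\<Sum>(A, Bs)\<in>(SIGMA A:Pow S. ordered_parts (S - A) m). F Bs (sorted_list_of_set A @ [M]))"
    using assms(1) by (intro sum.Sigma) auto
  also have "\<dots> = (\<Sum>Bs\<in>ordered_parts (insert M S) (Suc m). F (butlast Bs) (last Bs))"
  proof (rule sum.reindex_bij_witness[where
        j = "\<lambda>(A, Bs). Bs @ [sorted_list_of_set A @ [M]]" and
        i = "\<lambda>Bs. (set (butlast (last Bs)), butlast Bs)"])
    fix z assume z: "z \<in> (SIGMA A:Pow S. ordered_parts (S - A) m)"
    obtain A Bs where zz: "z = (A, Bs)" by force
    have A: "A \<subseteq> S" "finite A" and Bs: "Bs \<in> ordered_parts (S - A) m"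
      using z zz fin by auto
    have "last B < M" if "B \<in> set Bs" for B
      using that Bs M by (auto simp: ordered_parts_def dest!: bspec[of _ _ B] intro!: M)
        (metis DiffE UN_I last_in_set)
    then show "(case z of (A, Bs) \<Rightarrow> Bs @ [sorted_list_of_set A @ [M]]) \<in> ordered_parts (insert M S)
        (Suc m)"
      using A Bs M
      by (auto simp: ordered_parts_def zz sorted_wrt_append subset_eq)
    show "(set (butlast (last (case z of (A, Bs) \<Rightarrow> Bs @ [sorted_list_of_set A @ [M]]))),
        butlast (case z of (A, Bs) \<Rightarrow> Bs @ [sorted_list_of_set A @ [M]])) = z"
      using A by (simp add: zz)
  next
    fix Cs assume C: "Cs \<in> ordered_parts (insert M S) (Suc m)"
    then obtain Bs B where Cs: "Cs = Bs @ [B]"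
      by (cases Cs rule: rev_cases) (auto simp: ordered_parts_def)
    have lB: "last B = M" using ordered_parts_last C M unfolding Cs by blast
    have sB: "B \<noteq> []" "sorted_wrt (<) B" using C by (auto simp: ordered_parts_def Cs)
    obtain A where B: "B = A @ [M]" using sB(1) lB by (metis append_butlast_last_id)
    have A: "sorted_wrt (<) A" "M \<notin> set A" using sB(2) by (auto simp: B sorted_wrt_append)
    have sA: "sorted_list_of_set (set A) = A"
      using A(1) by (simp add: sorted_list_of_set.idem_if_sorted_distinct strict_sorted_iff)
    show "(case (set (butlast (last Cs)), butlast Cs) of (A, Bs) \<Rightarrow> Bs @ [sorted_list_of_set A @
        [M]]) = Cs"
      by (simp add: Cs B sA)
    have d: "distinct (concat Bs)" "set (concat Bs) \<inter> set (A @ [M]) = {}"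
      "set (concat Bs) \<union> set (A @ [M]) = insert M S"
      using C by (auto simp: ordered_parts_def Cs B)
    have MS: "M \<notin> S" using M by blast
    have "set A \<subseteq> S" "set (concat Bs) = S - set A"
      using d A(2) MS by auto
    then show "(set (butlast (last Cs)), butlast Cs) \<in> (SIGMA A:Pow S. ordered_parts (S - A) m)"
      using C by (auto simp: ordered_parts_def Cs B sorted_wrt_append)
  qed auto
  finally show ?thesis ..
qed

lemma pure_tensor_snoc:
  "c \<in> Basis \<Longrightarrow> length vs = length u \<Longrightarrow> pure_tensor (vs @ [v]) (u @ [c]) = pure_tensor vs u * (v \<bullet> c)"
  using pure_tensor_append[of u "length u" "[c]" "vs @ [v]"]
  by (simp add: pure_tensor_def words_iff)

text \<open>Induction on \<open>u\<close> from its end: the final block is removed by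
  \<open>sum_ordered_parts_Suc\<close>, and the sum over its possible contents is a
  \<open>split_sum\<close> by \<open>split_sum_subsets\<close>. The map \<open>f\<close> assigns
  letters to positions, so repeated letters cause no identification.\<close>

lemma sum_ordered_parts_eq_osh:
  fixes h :: "'v::euclidean_space list \<Rightarrow> 'u::euclidean_space"
  assumes "finite S" "u \<in> words m"
  shows "(\<Sum>Bs\<in>ordered_parts S m. pure_tensor (map (\<lambda>B. h (map f B)) Bs) u)
    = osh h u (map f (sorted_list_of_set S))"
  using assms
proof (induction u arbitrary: S m rule: rev_induct)
  case Nil
  then show ?case by (auto simp: words_iff ordered_parts_0 pure_tensor_def)
next
  case (snoc c u)
  then obtain k where k: "m = Suc k" "u \<in> words k" "c \<in> Basis"
    by (auto simp: words_iff)
  show ?case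
  proof (cases "S = {}")
    case True
    then show ?thesis by (simp add: k(1) ordered_parts_empty)
  next
    case False
    define M where "M = Max S"
    define R where "R = S - {M}"
    have MS: "M \<in> S" unfolding M_def using snoc.prems(1) False by (rule Max_in)
    have S: "S = insert M R" and R: "finite R" and lt: "\<And>i. i \<in> R \<Longrightarrow> i < M"
      using snoc.prems(1) MS by (auto simp: R_def) (simp add: M_def le_neq_implies_less)
    have sl: "sorted_list_of_set S = sorted_list_of_set R @ [M]"
    proof (rule strict_sorted_equal)
      show "sorted_wrt (<) (sorted_list_of_set R @ [M])"
        using R lt by (simp add: sorted_wrt_append)
      show "sorted_wrt (<) (sorted_list_of_set S)" by simp
      have "set (sorted_list_of_set S) = S" "set (sorted_list_of_set R) = R"
        using R snoc.prems(1) by simp_all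
      then show "set (sorted_list_of_set S) = set (sorted_list_of_set R @ [M])"
        using S by simp
    qed
    have fil: "filter (\<lambda>i. i \<in> A) (sorted_list_of_set R) = sorted_list_of_set (R \<inter> A)" for A
      by (rule strict_sorted_equal) (use R in \<open>auto simp: sorted_wrt_filter\<close>)
    let ?h = "\<lambda>B. h (map f B)"
    have "(\<Sum>Bs\<in>ordered_parts S m. pure_tensor (map ?h Bs) (u @ [c]))
        = (\<Sum>Bs\<in>ordered_parts S m. pure_tensor (map ?h (butlast Bs)) u * (?h (last Bs) \<bullet> c))"
    proof (rule sum.cong[OF refl])
      fix Cs assume C: "Cs \<in> ordered_parts S m"
      then obtain Bs B where Cs: "Cs = Bs @ [B]"
        by (cases Cs rule: rev_cases) (auto simp: ordered_parts_def k)
      then show "pure_tensor (map ?h Cs) (u @ [c])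
          = pure_tensor (map ?h (butlast Cs)) u * (?h (last Cs) \<bullet> c)"
        using C k by (simp add: pure_tensor_snoc ordered_parts_def words_iff)
    qed
    also have "\<dots> = (\<Sum>A\<in>Pow R. \<Sum>Bs\<in>ordered_parts (R - A) k.
        pure_tensor (map ?h Bs) u * (?h (sorted_list_of_set A @ [M]) \<bullet> c))"
      using sum_ordered_parts_Suc[OF R lt, where m = k and
          F = "\<lambda>Bs B. pure_tensor (map ?h Bs) u * (?h B \<bullet> c)"]
      by (simp only: S k(1))
    also have "\<dots> = (\<Sum>A\<in>Pow R. osh h u (map f (sorted_list_of_set (R - A))) *
        (h (map f (sorted_list_of_set A) @ [f M]) \<bullet> c))"
      using snoc.IH[OF _ k(2)] R by (simp add: sum_distrib_right[symmetric])
    also have "\<dots> = split_sum (\<lambda>a b. osh h u a * (h (b @ [f M]) \<bullet> c)) (map f (sorted_list_of_set R))"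
    proof (subst split_sum_subsets)
      show "(\<Sum>A\<in>Pow R. osh h u (map f (sorted_list_of_set (R - A))) *
        (h (map f (sorted_list_of_set A) @ [f M]) \<bullet> c)) =
       (\<Sum>A\<in>Pow (set (sorted_list_of_set R)).
         osh h u (map f (filter (\<lambda>i. i \<notin> A) (sorted_list_of_set R))) *
         (h (map f (filter (\<lambda>i. i \<in> A) (sorted_list_of_set R)) @ [f M]) \<bullet> c))"
      proof (rule sum.cong)
        fix A assume "A \<in> Pow (set (sorted_list_of_set R))"
        then have "R \<inter> A = A" "R \<inter> - A = R - A" using R by auto
        then show "osh h u (map f (sorted_list_of_set (R - A))) *
         (h (map f (sorted_list_of_set A) @ [f M]) \<bullet> c) =
         osh h u (map f (filter (\<lambda>i. i \<notin> A) (sorted_list_of_set R))) *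
         (h (map f (filter (\<lambda>i. i \<in> A) (sorted_list_of_set R)) @ [f M]) \<bullet> c)"
          using fil[of A] fil[of "- A"] by simp
      qed (use R in simp)
    qed simp
    finally show ?thesis by (simp add: sl)
  qed
qed

text \<open>The sizes are recovered from the blocks as \<open>map length Bs\<close>. Pairs of sizes
  and ordered shuffles therefore correspond to the ordered set partitions of all positions of
  \<open>w\<close>.\<close>

lemma sum_OSh_eq_osh:
  fixes h :: "'v::euclidean_space list \<Rightarrow> 'u::euclidean_space"
  assumes "u \<in> words m"
  shows "(\<Sum>ns | length ns = m \<and> (\<forall>k\<in>set ns. 1 \<le> k) \<and> sum_list ns = length w.
      \<Sum>\<sigma>\<in>OSh ns. pure_tensor (map h (split_blocks ns (permute_word \<sigma> w))) u) = osh h u w"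
proof -
  let ?n = "length w"
  let ?I = "{ns. length ns = m \<and> (\<forall>k\<in>set ns. 1 \<le> k) \<and> sum_list ns = ?n}"
  let ?F = "\<lambda>Bs. pure_tensor (map (\<lambda>B. h (map ((!) w) B)) Bs) u"
  let ?J = "\<lambda>ns. {Bs \<in> shuffle_blocks ns. sorted_wrt (<) (map last Bs)}"
  have finI: "finite ?I"
  proof (rule finite_subset)
    show "?I \<subseteq> {ns. set ns \<subseteq> {..?n} \<and> length ns = m}"
      by (auto dest: member_le_sum_list)
  qed (simp add: finite_lists_length_eq)
  have finJ: "finite (?J ns)" for ns
  proof (rule finite_subset)
    show "?J ns \<subseteq> shuffle_blocks ns" by auto
    have "finite (Sh ns)"
      by (rule finite_subset[OF _ finite_permutations[of "{..<sum_list ns}"]]) (auto simp: Sh_def)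
    then show "finite (shuffle_blocks ns)"
      using bij_betw_finite[OF bij_betw_perm_blocks] by blast
  qed
  have 1: "(\<Sum>\<sigma>\<in>OSh ns. pure_tensor (map h (split_blocks ns (permute_word \<sigma> w))) u)
      = (\<Sum>Bs\<in>?J ns. ?F Bs)" if ns: "ns \<in> ?I" for ns
  proof -
    have O: "OSh ns = {\<sigma> \<in> Sh ns. sorted_wrt (<) (map last (perm_blocks ns \<sigma>))}"
      using OSh_iff_perm_blocks ns by blast
    have "bij_betw (perm_blocks ns) (OSh ns) (?J ns)"
      unfolding O using bij_betw_perm_blocks[of ns] by (auto simp: bij_betw_def inj_on_def)
    then have "(\<Sum>Bs\<in>?J ns. ?F Bs) = (\<Sum>\<sigma>\<in>OSh ns. ?F (perm_blocks ns \<sigma>))"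
      by (rule sum.reindex_bij_betw[symmetric])
    also have "\<dots> = (\<Sum>\<sigma>\<in>OSh ns. pure_tensor (map h (split_blocks ns (permute_word \<sigma> w))) u)"
      using ns by (simp add: split_blocks_permute_word o_def)
    finally show ?thesis ..
  qed
  have "(\<Sum>ns\<in>?I. \<Sum>\<sigma>\<in>OSh ns. pure_tensor (map h (split_blocks ns (permute_word \<sigma> w))) u)
      = (\<Sum>ns\<in>?I. \<Sum>Bs\<in>?J ns. ?F Bs)"
    by (rule sum.cong) (use 1 in auto)
  also have "\<dots> = (\<Sum>(ns, Bs)\<in>(SIGMA ns:?I. ?J ns). ?F Bs)"
    using finI finJ by (intro sum.Sigma) auto
  also have "\<dots> = (\<Sum>Bs\<in>ordered_parts {..<?n} m. ?F Bs)"
  proof (rule sum.reindex_bij_witness[where i = "\<lambda>Bs. (map length Bs, Bs)" and j = snd])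
    fix Bs assume B: "Bs \<in> ordered_parts {..<?n} m"
    then have "sum_list (map length Bs) = ?n"
      using distinct_card[of "concat Bs"] by (simp add: ordered_parts_def length_concat)
    then show "(map length Bs, Bs) \<in> (SIGMA ns:?I. ?J ns)"
      using B by (simp add: ordered_parts_def shuffle_blocks_def Suc_le_eq)
  next
    fix z assume "z \<in> (SIGMA ns:?I. ?J ns)"
    then obtain ns Bs where z: "z = (ns, Bs)" "ns \<in> ?I" "Bs \<in> ?J ns" by blast
    then have "map length Bs = ns" by (simp add: shuffle_blocks_def)
    moreover have "B \<noteq> []" if "B \<in> set Bs" for B
      using that z \<open>map length Bs = ns\<close> by force
    ultimately show "snd z \<in> ordered_parts {..<?n} m" "(map length (snd z), snd z) = z"
      "?F (snd z) = (case z of (ns, Bs) \<Rightarrow> ?F Bs)"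
      using z by (auto simp: ordered_parts_def shuffle_blocks_def)
  qed simp
  also have "\<dots> = osh h u (map ((!) w) (sorted_list_of_set {..<?n}))"
    by (rule sum_ordered_parts_eq_osh) (use assms in auto)
  also have "map ((!) w) (sorted_list_of_set {..<?n}) = w"
    by (simp add: lessThan_atLeast0 map_nth)
  finally show ?thesis .
qed

section \<open>The lift as a sum over words\<close>

lemma ext_pairing_unshuffle:
  fixes x :: "'v::euclidean_space tensor"
  assumes S: "\<And>\<sigma>. \<sigma> \<in> S \<Longrightarrow> \<sigma> permutes {..<sum_list ns}"
  shows "ext_pairing ns h (unshuffle S ns x) u
    = (\<Sum>w\<in>words (sum_list ns). x w * (\<Sum>\<sigma>\<in>S. pure_tensor (map h (split_blocks ns (permute_word \<sigma> w)))
        u))"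
proof -
  let ?L = "listset (map words ns)"
  have "ext_pairing ns h (unshuffle S ns x) u = (\<Sum>w\<in>words (sum_list ns). x w * (\<Sum>\<sigma>\<in>S.
      \<Sum>ws\<in>?L. of_bool (split_blocks ns (permute_word \<sigma> w) = ws) * pure_tensor (map h ws) u))"
    unfolding ext_pairing_def unshuffle_def sum_distrib_left sum_distrib_right mult.assoc
    by (subst sum.swap, rule sum.cong[OF refl], subst sum.swap, rule refl)
  also have "\<dots> = (\<Sum>w\<in>words (sum_list ns). x w * (\<Sum>\<sigma>\<in>S. pure_tensor (map h (split_blocks ns
      (permute_word \<sigma> w))) u))"
  proof (intro sum.cong refl arg_cong2[where f = "(*)"])
    fix w :: "'v list" and \<sigma> assume "w \<in> words (sum_list ns)" "\<sigma> \<in> S"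
    then have "split_blocks ns (permute_word \<sigma> w) \<in> ?L"
      using S permute_word_words split_blocks_in_listset_words by blast
    then show "(\<Sum>ws\<in>?L. of_bool (split_blocks ns (permute_word \<sigma> w) = ws) * pure_tensor (map h ws)
        u)
      = pure_tensor (map h (split_blocks ns (permute_word \<sigma> w))) u"
      by (simp only: sum_of_bool_mult finite_listset_words if_True)
  qed
  finally show ?thesis .
qed

text \<open>Unlike \<open>almost_lift\<close>, in degree \<open>1\<close> this is the Taylor expansion of the increment of the
    trace.\<close>

definition osh_lift :: "nat \<Rightarrow> 'v tensor \<Rightarrow> ('v::euclidean_space list \<Rightarrow> 'u::euclidean_space) \<Rightarrow> 'u
    tensor" where
  "osh_lift N a h u = (\<Sum>w\<in>words_upto N. a w * osh h u w)"

text \<open>Grouping the block sizes by their sum \<open>n\<close> leaves, for each word of length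
  \<open>n\<close>, all its ordered unshuffles into \<open>length u\<close> blocks, which
  \<open>sum_OSh_eq_osh\<close> evaluates. Below degree \<open>2\<close> the lift is given by
  separate formulas.\<close>

lemma almost_lift_eq_osh_lift:
  assumes "2 \<le> length u" "length u \<le> N" "set u \<subseteq> Basis"
  shows "almost_lift N X H s t u = osh_lift N (X s t) (H s) u"
proof -
  let ?m = "length u"
  let ?P = "\<lambda>ns. length ns = ?m \<and> (\<forall>k\<in>set ns. 1 \<le> k)"
  let ?I = "{ns. ?P ns \<and> sum_list ns \<le> N}"
  let ?G = "\<lambda>n ns. \<Sum>w\<in>words n. X s t w *
      (\<Sum>\<sigma>\<in>OSh ns. pure_tensor (map (H s) (split_blocks ns (permute_word \<sigma> w))) u)"
  have u: "u \<in> words ?m" using assms by (simp add: words_iff)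
  have finI: "finite ?I"
  proof (rule finite_subset)
    show "?I \<subseteq> {ns. set ns \<subseteq> {..N} \<and> length ns = ?m}"
      using member_le_sum_list order_trans by (fastforce)
  qed (simp add: finite_lists_length_eq)
  have "almost_lift N X H s t u
      = (\<Sum>ns\<in>?I. ext_pairing ns (H s) (Delta_osh ns (tcomp (sum_list ns) (X s t))) u)"
    using assms by (cases "u = []") (simp_all add: almost_lift_def lift_comp_def conj_assoc)
  also have "\<dots> = (\<Sum>ns\<in>?I. ?G (sum_list ns) ns)"
    unfolding Delta_osh_def
    by (intro sum.cong refl, subst ext_pairing_unshuffle)
      (auto simp: OSh_def Sh_def tcomp_def words_iff)
  also have "\<dots> = (\<Sum>n\<le>N. \<Sum>ns | ns \<in> ?I \<and> sum_list ns = n. ?G (sum_list ns) ns)"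
    by (rule sum.group[symmetric]) (use finI in auto)
  also have "\<dots> = (\<Sum>n\<le>N. \<Sum>w\<in>words n. X s t w * osh (H s) u w)"
  proof (rule sum.cong[OF refl])
    fix n assume "n \<in> {..N}"
    then have I: "{ns. ns \<in> ?I \<and> sum_list ns = n}
        = {ns. length ns = ?m \<and> (\<forall>k\<in>set ns. 1 \<le> k) \<and> sum_list ns = n}"
      by auto
    have "(\<Sum>ns | ns \<in> ?I \<and> sum_list ns = n. ?G (sum_list ns) ns)
       = (\<Sum>ns | length ns = ?m \<and> (\<forall>k\<in>set ns. 1 \<le> k) \<and> sum_list ns = n. ?G n ns)"
      unfolding I by (rule sum.cong) auto
    also have "\<dots> = (\<Sum>w\<in>words n. X s t w * (\<Sum>ns | length ns = ?m \<and> (\<forall>k\<in>set ns. 1 \<le> k) \<and> sum_list ns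
        = n.
        \<Sum>\<sigma>\<in>OSh ns. pure_tensor (map (H s) (split_blocks ns (permute_word \<sigma> w))) u))"
      unfolding sum_distrib_left by (rule sum.swap)
    also have "\<dots> = (\<Sum>w\<in>words n. X s t w * osh (H s) u w)"
      using sum_OSh_eq_osh[OF u] by (intro sum.cong) (auto simp: words_iff)
    finally show "(\<Sum>ns | ns \<in> ?I \<and> sum_list ns = n. ?G (sum_list ns) ns)
      = (\<Sum>w\<in>words n. X s t w * osh (H s) u w)" .
  qed
  finally show ?thesis
    by (simp add: osh_lift_def sum_words_upto_levels)
qed

section \<open>Orders of vanishing with respect to a control\<close>

locale control_setting =
  fixes p T :: real and \<omega> :: "real \<Rightarrow> real \<Rightarrow> real"
  assumes p_ge_1: "1 \<le> p" and control: "control T \<omega>"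
begin

lemma level_ge_1: "1 \<le> level p"
  using p_ge_1 by (simp add: level_def le_nat_iff)

lemma control_nonneg: "\<lbrakk>0 \<le> s; s \<le> t; t \<le> T\<rbrakk> \<Longrightarrow> 0 \<le> \<omega> s t"
  using control by (auto simp: control_def simplex2_def)

lemma control_diag: "0 \<le> t \<Longrightarrow> t \<le> T \<Longrightarrow> \<omega> t t = 0"
  using control by (auto simp: control_def)

lemma control_superadditive:
  "\<lbrakk>0 \<le> s; s \<le> u; u \<le> t; t \<le> T\<rbrakk> \<Longrightarrow> \<omega> s u + \<omega> u t \<le> \<omega> s t"
  using control by (auto simp: control_def)

lemma control_mono:
  assumes "0 \<le> s" "s \<le> s'" "s' \<le> t'" "t' \<le> t" "t \<le> T"
  shows "\<omega> s' t' \<le> \<omega> s t"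
  using control_superadditive[of s s' t] control_superadditive[of s' t' t]
    control_nonneg[of s s'] control_nonneg[of t' t] assms by simp

text \<open>In this unit a component of degree \<open>k\<close> has order \<open>k\<close>, so
  orders are natural numbers that add under products.\<close>

definition scale :: "real \<Rightarrow> real \<Rightarrow> real" where
  "scale s t = \<omega> s t powr (1 / p)"

lemma scale_nonneg [simp]: "0 \<le> scale s t"
  by (simp add: scale_def)

lemma scale_mono:
  assumes "0 \<le> s" "s \<le> s'" "s' \<le> t'" "t' \<le> t" "t \<le> T"
  shows "scale s' t' \<le> scale s t"
  using control_mono[OF assms] control_nonneg[of s' t'] p_ge_1 assms
  by (auto simp: scale_def intro!: powr_mono2)

lemma scale_power: "0 < k \<Longrightarrow> scale s t ^ k = \<omega> s t powr (real k / p)"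
  by (cases "\<omega> s t = 0") (simp_all add: scale_def powr_power mult.commute)

text \<open>\<open>err k f\<close> is \<open>f\<^sub>s\<^sub>u\<^sub>t = O(\<omega>(s,t)\<^bsup>k/p\<^esup>)\<close>, with a power of \<open>scale\<close> so that \<open>0 ^ 0 = 1\<close>
  whereas \<open>0 powr 0 = 0\<close>.\<close>

definition err :: "nat \<Rightarrow> (real \<Rightarrow> real \<Rightarrow> real \<Rightarrow> real) \<Rightarrow> bool" where
  "err k f \<longleftrightarrow> (\<exists>C. \<forall>s u t. 0 \<le> s \<longrightarrow> s \<le> u \<longrightarrow> u \<le> t \<longrightarrow> t \<le> T \<longrightarrow> \<bar>f s u t\<bar> \<le> C * scale s t ^ k)"

lemma errI:
  assumes "\<And>s u t. \<lbrakk>0 \<le> s; s \<le> u; u \<le> t; t \<le> T\<rbrakk> \<Longrightarrow> \<bar>f s u t\<bar> \<le> C * scale s t ^ k"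
  shows "err k f"
  using assms unfolding err_def by blast

lemma errE:
  assumes "err k f"
  obtains C where "0 \<le> C"
    "\<And>s u t. \<lbrakk>0 \<le> s; s \<le> u; u \<le> t; t \<le> T\<rbrakk> \<Longrightarrow> \<bar>f s u t\<bar> \<le> C * scale s t ^ k"
proof -
  obtain C where C: "\<And>s u t. \<lbrakk>0 \<le> s; s \<le> u; u \<le> t; t \<le> T\<rbrakk> \<Longrightarrow> \<bar>f s u t\<bar> \<le> C * scale s t ^ k"
    using assms unfolding err_def by blast
  have "\<bar>f s u t\<bar> \<le> \<bar>C\<bar> * scale s t ^ k" if "0 \<le> s" "s \<le> u" "u \<le> t" "t \<le> T" for s u t
    using C[OF that] by (rule order_trans) (simp add: mult_right_mono)
  then show thesis using that[of "\<bar>C\<bar>"] by simp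
qed

lemma err_cong:
  assumes "err k f" "\<And>s u t. \<lbrakk>0 \<le> s; s \<le> u; u \<le> t; t \<le> T\<rbrakk> \<Longrightarrow> g s u t = f s u t"
  shows "err k g"
  using assms(1) by (rule errE) (rule errI, simp add: assms(2))

lemma err_zero: "err k (\<lambda>s u t. 0)"
  by (rule errI[where C = 0]) simp

lemma err_add:
  assumes "err k f" "err k g"
  shows "err k (\<lambda>s u t. f s u t + g s u t)"
proof -
  obtain C where C: "\<And>s u t. \<lbrakk>0 \<le> s; s \<le> u; u \<le> t; t \<le> T\<rbrakk> \<Longrightarrow> \<bar>f s u t\<bar> \<le> C * scale s t ^ k"
    using assms(1) by (rule errE) (rule that; assumption)
  obtain D where D: "\<And>s u t. \<lbrakk>0 \<le> s; s \<le> u; u \<le> t; t \<le> T\<rbrakk> \<Longrightarrow> \<bar>g s u t\<bar> \<le> D * scale s t ^ k"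
    using assms(2) by (rule errE) (rule that; assumption)
  show ?thesis
  proof (rule errI[where C = "C + D"])
    fix s u t assume "0 \<le> s" "s \<le> u" "u \<le> t" "t \<le> T"
    then show "\<bar>f s u t + g s u t\<bar> \<le> (C + D) * scale s t ^ k"
      using C[of s u t] D[of s u t] by (simp add: distrib_right)
  qed
qed

lemma err_minus: "err k f \<Longrightarrow> err k (\<lambda>s u t. - f s u t)"
  by (simp add: err_def)

lemma err_diff: "err k f \<Longrightarrow> err k g \<Longrightarrow> err k (\<lambda>s u t. f s u t - g s u t)"
  using err_add[of k f "\<lambda>s u t. - g s u t"] err_minus[of k g] by simp

lemma err_abs: "err k f \<Longrightarrow> err k (\<lambda>s u t. \<bar>f s u t\<bar>)"
  by (simp add: err_def)

lemma err_sum: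
  "(\<And>i. i \<in> I \<Longrightarrow> err k (f i)) \<Longrightarrow> err k (\<lambda>s u t. \<Sum>i\<in>I. f i s u t)"
  by (induction I rule: infinite_finite_induct) (auto intro: err_zero err_add)

lemma err_mult:
  assumes "err j f" "err k g"
  shows "err (j + k) (\<lambda>s u t. f s u t * g s u t)"
proof -
  obtain C where C: "0 \<le> C" "\<And>s u t. \<lbrakk>0 \<le> s; s \<le> u; u \<le> t; t \<le> T\<rbrakk> \<Longrightarrow> \<bar>f s u t\<bar> \<le> C * scale s t ^ j"
    using assms(1) by (rule errE) (rule that; assumption)
  obtain D where D: "\<And>s u t. \<lbrakk>0 \<le> s; s \<le> u; u \<le> t; t \<le> T\<rbrakk> \<Longrightarrow> \<bar>g s u t\<bar> \<le> D * scale s t ^ k"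
    using assms(2) by (rule errE) (rule that; assumption)
  show ?thesis
  proof (rule errI[where C = "C * D"])
    fix s u t assume *: "0 \<le> s" "s \<le> u" "u \<le> t" "t \<le> T"
    have "\<bar>f s u t * g s u t\<bar> \<le> (C * scale s t ^ j) * (D * scale s t ^ k)"
      unfolding abs_mult by (rule mult_mono) (use C D * in auto)
    then show "\<bar>f s u t * g s u t\<bar> \<le> C * D * scale s t ^ (j + k)"
      by (simp add: power_add mult_ac)
  qed
qed

text \<open>Surplus powers of \<open>scale s t\<close> are absorbed into the constant, since
  \<open>scale 0 T\<close> bounds them.\<close>

lemma err_mono:
  assumes "err k f" "j \<le> k"
  shows "err j f"
proof -
  obtain C where C: "0 \<le> C" "\<And>s u t. \<lbrakk>0 \<le> s; s \<le> u; u \<le> t; t \<le> T\<rbrakk> \<Longrightarrow> \<bar>f s u t\<bar> \<le> C * scale s t ^ k"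
    using assms(1) by (rule errE) (rule that; assumption)
  show ?thesis
  proof (rule errI[where C = "C * scale 0 T ^ (k - j)"])
    fix s u t assume *: "0 \<le> s" "s \<le> u" "u \<le> t" "t \<le> T"
    have "scale s t ^ k = scale s t ^ (k - j) * scale s t ^ j"
      using assms(2) by (simp flip: power_add)
    also have "\<dots> \<le> scale 0 T ^ (k - j) * scale s t ^ j"
      using scale_mono[of 0 s t T] * by (intro mult_right_mono power_mono) auto
    finally have "C * scale s t ^ k \<le> C * (scale 0 T ^ (k - j) * scale s t ^ j)"
      using C(1) by (rule mult_left_mono)
    then show "\<bar>f s u t\<bar> \<le> C * scale 0 T ^ (k - j) * scale s t ^ j"
      using C(2)[OF *] by (simp add: mult.assoc)
  qed
qed

lemma err_mult': "err j f \<Longrightarrow> err k g \<Longrightarrow> l \<le> j + k \<Longrightarrow> err l (\<lambda>s u t. f s u t * g s u t)"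
  using err_mult err_mono by blast

lemma err_const: "err 0 (\<lambda>s u t. c)"
  by (rule errI[where C = "\<bar>c\<bar>"]) simp

lemma err_cmult: "err k f \<Longrightarrow> err k (\<lambda>s u t. c * f s u t)" "err k f \<Longrightarrow> err k (\<lambda>s u t. f s u t * c)"
  using err_mult'[OF err_const, of k f] err_mult'[OF _ err_const, of k f] by auto

text \<open>By monotonicity of \<open>scale\<close>, an order with respect to a subinterval is also
  one with respect to the whole interval.\<close>

lemma err_sub:
  assumes "err k (\<lambda>s u t. g s t)"
  shows "err k (\<lambda>s u t. g s u)" "err k (\<lambda>s u t. g u t)"
proof -
  obtain C where C: "0 \<le> C" "\<And>s u t. \<lbrakk>0 \<le> s; s \<le> u; u \<le> t; t \<le> T\<rbrakk> \<Longrightarrow> \<bar>g s t\<bar> \<le> C * scale s t ^ k"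
    using assms(1) by (rule errE) (rule that; assumption)
  have *: "\<bar>g s' t'\<bar> \<le> C * scale s t ^ k" if "0 \<le> s" "s \<le> s'" "s' \<le> t'" "t' \<le> t" "t \<le> T"
      for s s' t' t
  proof -
    have "scale s' t' ^ k \<le> scale s t ^ k"
      using scale_mono[OF that] by (intro power_mono) auto
    with C(1) have "C * scale s' t' ^ k \<le> C * scale s t ^ k" by (rule mult_left_mono[rotated])
    then show ?thesis using C(2)[of s' s' t'] that by linarith
  qed
  show "err k (\<lambda>s u t. g s u)" "err k (\<lambda>s u t. g u t)"
    by (rule errI[where C = C], rule *, auto)+
qed

lemma err_split_sum:
  assumes "\<And>a b. length a + length b = length w \<Longrightarrow> err k (\<lambda>s u t. F s u t a b)"
  shows "err k (\<lambda>s u t. split_sum (F s u t) w)"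
  using assms
proof (induction w arbitrary: F)
  case (Cons x w)
  show ?case unfolding split_sum.simps
    by (intro err_add Cons.IH Cons.prems) auto
qed simp

lemma err_iff_bigO_ctrl:
  assumes "0 < k"
  shows "err k (\<lambda>s u t. g s t) \<longleftrightarrow> bigO_ctrl p T \<omega> k (\<lambda>s t. \<bar>g s t\<bar>)"
proof -
  have "(\<forall>s u t. 0 \<le> s \<longrightarrow> s \<le> u \<longrightarrow> u \<le> t \<longrightarrow> t \<le> T \<longrightarrow> \<bar>g s t\<bar> \<le> C * scale s t ^ k)
    \<longleftrightarrow> (\<forall>(s, t)\<in>simplex2 T. \<bar>g s t\<bar> \<le> C * \<omega> s t powr (real k / p))" for C
    using assms by (auto simp: simplex2_def scale_power)
  then show ?thesis unfolding err_def bigO_ctrl_def by presburger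
qed

lemma bigO_ctrl_mono:
  assumes "bigO_ctrl p T \<omega> k g" "\<And>s t. \<lbrakk>0 \<le> s; s \<le> t; t \<le> T\<rbrakk> \<Longrightarrow> f s t \<le> g s t"
  shows "bigO_ctrl p T \<omega> k f"
proof -
  obtain C where C: "\<forall>(s, t)\<in>simplex2 T. g s t \<le> C * \<omega> s t powr (real k / p)"
    using assms(1) unfolding bigO_ctrl_def by (elim exE)
  have "\<forall>(s, t)\<in>simplex2 T. f s t \<le> C * \<omega> s t powr (real k / p)"
  proof clarify
    fix s t assume st: "(s, t) \<in> simplex2 T"
    with C have "g s t \<le> C * \<omega> s t powr (real k / p)" by auto
    with assms(2)[of s t] st show "f s t \<le> C * \<omega> s t powr (real k / p)"
      by (simp add: simplex2_def)
  qed
  then show ?thesis unfolding bigO_ctrl_def by (rule exI)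
qed

text \<open>Each excluded pair has total length at least \<open>Suc N\<close>, hence that order, and
  there are finitely many. Multiplicativity and integration by parts of the truncated
  \<open>X\<close> are only ever applied up to this error.\<close>

lemma err_truncate:
  fixes G :: "real \<Rightarrow> real \<Rightarrow> real \<Rightarrow> 'v::euclidean_space list \<Rightarrow> 'v list \<Rightarrow> real"
  assumes "\<And>x y. err (length x + length y) (\<lambda>s u t. G s u t x y)"
  shows "err (Suc N) (\<lambda>s u t. (\<Sum>x\<in>words_upto N. \<Sum>y\<in>words_upto N. G s u t x y)
     - (\<Sum>(x, y) | x \<in> words_upto N \<and> y \<in> words_upto N \<and> length x + length y \<le> N. G s u t x y))"
    (is "err _ (\<lambda>s u t. ?A s u t - ?B s u t)")
proof -
  let ?W = "words_upto N \<times> words_upto N"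
  let ?S = "{(x, y). x \<in> words_upto N \<and> y \<in> words_upto N \<and> length x + length y \<le> N}"
  have "?A s u t - ?B s u t = (\<Sum>z\<in>?W - ?S. G s u t (fst z) (snd z))" for s u t
  proof -
    have "?A s u t = (\<Sum>z\<in>?W. G s u t (fst z) (snd z))"
      by (simp add: sum.cartesian_product case_prod_unfold)
    also have "\<dots> = (\<Sum>z\<in>?W - ?S. G s u t (fst z) (snd z)) + ?B s u t"
      by (subst sum.subset_diff[of ?S]) (auto simp: case_prod_unfold)
    finally show ?thesis by simp
  qed
  moreover have "err (Suc N) (\<lambda>s u t. \<Sum>z\<in>?W - ?S. G s u t (fst z) (snd z))"
  proof (rule err_sum)
    fix z :: "'v list \<times> 'v list" assume "z \<in> ?W - ?S"
    then have "Suc N \<le> length (fst z) + length (snd z)" by (cases z) auto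
    then show "err (Suc N) (\<lambda>s u t. G s u t (fst z) (snd z))"
      by (rule err_mono[OF assms])
  qed
  ultimately show ?thesis by simp
qed

section \<open>Rough paths in coefficients\<close>

lemma tnorm_le_sum: "tnorm n a \<le> (\<Sum>w\<in>words n. \<bar>a w\<bar>)"
  by (simp add: tnorm_def L2_set_le_sum_abs)

lemma abs_le_tnorm: "w \<in> words n \<Longrightarrow> \<bar>a w\<bar> \<le> tnorm n a"
  using member_le_L2_set[of "words n" w "\<lambda>w. \<bar>a w\<bar>"] by (simp add: tnorm_def L2_set_def)

lemma tcomp_0_eq_tone: "tcomp 0 a = tone \<longleftrightarrow> a [] = 1"
  by (auto simp: tcomp_def tone_def fun_eq_iff)

text \<open>Valid for every list, which spares side conditions later: outside
  \<open>words_upto (level p)\<close> the coefficients vanish, and at \<open>[]\<close> the order is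
  \<open>0\<close>.\<close>

lemma regular_tensor_map_err:
  assumes "regular_tensor_map p T \<omega> X"
  shows "err (length w) (\<lambda>s u t. X s t w)"
proof (cases "w \<in> words_upto (level p)")
  case False
  then have "err (length w) (\<lambda>s u t. X s t w)"
    using assms by (intro err_cong[OF err_zero]) (auto simp: regular_tensor_map_def simplex2_def
        trunc_space_def)
  then show ?thesis .
next
  case True
  show ?thesis
  proof (cases "w = []")
    case True
    have "err 0 (\<lambda>s u t. X s t [])"
      using assms by (intro err_cong[OF err_const[of 1]])
        (auto simp: regular_tensor_map_def simplex2_def tcomp_0_eq_tone)
    with True show ?thesis by simp
  next
    case False
    have w: "w \<in> words (length w)" "0 < length w" "length w \<le> level p"
      using True False by (auto simp: words_upto_iff words_iff)
    then have "bigO_ctrl p T \<omega> (length w) (\<lambda>s t. tnorm (length w) (X s t))"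
      using assms by (auto simp: regular_tensor_map_def Suc_le_eq)
    then have "bigO_ctrl p T \<omega> (length w) (\<lambda>s t. \<bar>X s t w\<bar>)"
      by (rule bigO_ctrl_mono) (use abs_le_tnorm w in blast)
    then show ?thesis
      using err_iff_bigO_ctrl w by simp
  qed
qed

lemma regular_tensor_mapI:
  assumes "\<And>s t. (s, t) \<in> simplex2 T \<Longrightarrow> X s t \<in> trunc_space (level p)"
    and "continuous_on (simplex2 T) (\<lambda>(s, t). X s t)"
    and "\<And>s t. (s, t) \<in> simplex2 T \<Longrightarrow> X s t [] = 1"
    and E: "\<And>w. w \<noteq> [] \<Longrightarrow> w \<in> words_upto (level p) \<Longrightarrow> err (length w) (\<lambda>s u t. X s t w)"
  shows "regular_tensor_map p T \<omega> X"
proof -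
  have "bigO_ctrl p T \<omega> n (\<lambda>s t. tnorm n (X s t))" if n: "1 \<le> n" "n \<le> level p" for n
  proof -
    have "err n (\<lambda>s u t. \<Sum>w\<in>words n. \<bar>X s t w\<bar>)"
    proof (rule err_sum)
      fix w :: "'a list" assume "w \<in> words n"
      then have "w \<noteq> []" "w \<in> words_upto (level p)" "length w = n"
        using n by (auto simp: words_iff words_upto_iff)
      then show "err n (\<lambda>s u t. \<bar>X s t w\<bar>)"
        using err_abs[OF E[of w]] by simp
    qed
    then have "bigO_ctrl p T \<omega> n (\<lambda>s t. \<bar>\<Sum>w\<in>words n. \<bar>X s t w\<bar>\<bar>)"
      using err_iff_bigO_ctrl n by simp
    then show ?thesis
      by (rule bigO_ctrl_mono) (simp add: tnorm_le_sum sum_nonneg)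
  qed
  then show ?thesis
    using assms(1-3) by (auto simp: regular_tensor_map_def tcomp_0_eq_tone)
qed

lemma rough_path_err: "rough_path p T \<omega> X \<Longrightarrow> err (length w) (\<lambda>s u t. X s t w)"
  by (simp add: rough_path_def regular_tensor_map_err)

lemma rough_path_mult:
  assumes "rough_path p T \<omega> X" "0 \<le> s" "s \<le> u" "u \<le> t" "t \<le> T" "length w \<le> level p"
  shows "X s t w = (\<Sum>i\<le>length w. X s u (take i w) * X u t (drop i w))"
proof -
  have "X s t = ttrunc (level p) (tprod (X s u) (X u t))"
    using assms by (auto simp: rough_path_def)
  then have "X s t w = ttrunc (level p) (tprod (X s u) (X u t)) w" by simp
  then show ?thesis using assms(6) by (simp add: ttrunc_def tprod_def)
qed

lemma rough_path_shuffle: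
  assumes "rough_path p T \<omega> X" "0 \<le> s" "s \<le> t" "t \<le> T" "x \<in> words a" "y \<in> words b" "a + b \<le> level p"
  shows "X s t x * X s t y = (\<Sum>w\<in>words (a + b). X s t w * shuffle_count x y w)"
proof -
  have "ext_prod [tcomp a (X s t), tcomp b (X s t)] = Delta_sh a b (tcomp (a + b) (X s t))"
    using assms by (auto simp: rough_path_def simplex2_def)
  then have "ext_prod [tcomp a (X s t), tcomp b (X s t)] [x, y] = Delta_sh a b (tcomp (a
      + b) (X s t)) [x, y]"
    by simp
  then show ?thesis
    using assms(5,6) by (simp add: Delta_sh_eq tcomp_def words_iff)
qed

text \<open>Group-likeness in the form in which it is applied: against an unshuffle coproduct,
  \<open>X s t\<close> separates into two copies of itself. The identity is exact because only pairs
  of total length at most \<open>level p\<close> occur.\<close>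

lemma sum_rough_path_split:
  fixes X :: "real \<Rightarrow> real \<Rightarrow> 'v::euclidean_space tensor"
  assumes X: "rough_path p T \<omega> X" and st: "0 \<le> s" "s \<le> t" "t \<le> T"
  shows "(\<Sum>v\<in>words_upto (level p). X s t v * split_sum f v)
    = (\<Sum>(x, y) | x \<in> words_upto (level p) \<and> y \<in> words_upto (level p) \<and> length x + length y
        \<le> level p.
        X s t x * X s t y * f x y)"
proof -
  let ?N = "level p"
  have "(\<Sum>v\<in>words_upto ?N. X s t v * split_sum f v)
      = (\<Sum>n\<le>?N. \<Sum>v\<in>words n. \<Sum>k\<le>n. \<Sum>x\<in>words k. \<Sum>y\<in>words (n - k). X s t v * shuffle_count x y v
          * f x y)"
    by (simp add: sum_words_upto_levels split_sum_shuffle_count sum_distrib_left mult.assoc)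
  also have "\<dots> = (\<Sum>n\<le>?N. \<Sum>k\<le>n. \<Sum>x\<in>words k. \<Sum>y\<in>words (n - k). X s t x * X s t y * f x y)"
  proof (rule sum.cong[OF refl])
    fix n :: nat assume n: "n \<in> {..?N}"
    have "(\<Sum>v\<in>words n. \<Sum>k\<le>n. \<Sum>x\<in>words k. \<Sum>y\<in>words (n - k).
        X s t v * shuffle_count x y v * f x y)
      = (\<Sum>k\<le>n. \<Sum>x\<in>words k. \<Sum>y\<in>words (n - k). \<Sum>v\<in>words n. X s t v * shuffle_count x y v * f x y)"
      by (subst sum.swap, rule sum.cong[OF refl], subst sum.swap, rule sum.cong[OF refl], rule
          sum.swap)
    also have "\<dots> = (\<Sum>k\<le>n. \<Sum>x\<in>words k. \<Sum>y\<in>words (n - k). X s t x * X s t y * f x y)"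
    proof (intro sum.cong refl)
      fix k and x y :: "'v list" assume "k \<in> {..n}" "x \<in> words k" "y \<in> words (n - k)"
      then show "(\<Sum>v\<in>words n. X s t v * shuffle_count x y v * f x y) = X s t x * X s t y * f x y"
        using rough_path_shuffle[OF X st, of x k y "n - k"] n by (simp add: sum_distrib_right)
    qed
    finally show "(\<Sum>v\<in>words n. \<Sum>k\<le>n. \<Sum>x\<in>words k. \<Sum>y\<in>words (n - k).
        X s t v * shuffle_count x y v * f x y)
      = (\<Sum>k\<le>n. \<Sum>x\<in>words k. \<Sum>y\<in>words (n - k). X s t x * X s t y * f x y)" .
  qed
  also have "\<dots> = (\<Sum>n\<le>?N. \<Sum>k\<le>n. \<Sum>w\<in>words n. X s t (take k w) * X s t (drop k w) * f (take k w) (drop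
      k w))"
    by (rule sum.cong[OF refl], rule sum.cong[OF refl],
        rule sum_words_cut[symmetric, where f = "\<lambda>x y. X s t x * X s t y * f x y"]) simp
  also have "\<dots> = (\<Sum>n\<le>?N. \<Sum>w\<in>words n. \<Sum>k\<le>length w. X s t (take k w) * X s t (drop k w)
      * f (take k w) (drop k w))"
    by (intro sum.cong refl, subst sum.swap, intro sum.cong) (auto simp: words_iff)
  also have "\<dots> = (\<Sum>(x, y) | x \<in> words_upto (level p) \<and> y \<in> words_upto (level p) \<and> length x
      + length y \<le> level p.
        X s t x * X s t y * f x y)"
    unfolding sum_words_upto_levels[symmetric]
    by (rule sum_words_upto_cut[where f = "\<lambda>x y. X s t x * X s t y * f x y"])
  finally show ?thesis .
qed

end

section \<open>The expanded lift of a controlled path\<close>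

lemma sum_snoc_cut:
  "(\<Sum>i\<le>length (z @ [c]). f i) = (\<Sum>i\<le>length z. f i) + f (Suc (length z))"
  for f :: "nat \<Rightarrow> real"
  by simp

lemma sum_words_drop_eq:
  fixes f :: "'v::euclidean_space list \<Rightarrow> real"
  assumes "w \<in> words n" "n \<le> N"
  shows "(\<Sum>z\<in>words (k + n). of_bool (drop k z = w) * f z) = (\<Sum>v\<in>words k. f (v @ w))"
proof -
  have "(\<Sum>v\<in>words k. f (v @ w)) = (\<Sum>z\<in>(\<lambda>v. v @ w) ` words k. f z)"
    by (simp add: sum.reindex inj_on_def)
  also have "\<dots> = (\<Sum>z\<in>(\<lambda>v. v @ w) ` words k. of_bool (drop k z = w) * f z)"
    by (rule sum.cong) (auto simp: words_iff)
  also have "\<dots> = (\<Sum>z\<in>words (k + n). of_bool (drop k z = w) * f z)"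
  proof (rule sum.mono_neutral_left)
    show "(\<lambda>v. v @ w) ` words k \<subseteq> words (k + n)"
      using assms by (auto simp: words_iff)
    show "\<forall>z\<in>words (k + n) - (\<lambda>v. v @ w) ` words k. of_bool (drop k z = w) * f z = 0"
    proof
      fix z :: "'v list" assume z: "z \<in> words (k + n) - (\<lambda>v. v @ w) ` words k"
      have "drop k z \<noteq> w"
      proof
        assume "drop k z = w"
        then have "z = take k z @ w" using append_take_drop_id[of k z] by simp
        moreover have "take k z \<in> words k" using z by (auto simp: words_iff dest!: in_set_takeD)
        ultimately show False using z by blast
      qed
      then show "of_bool (drop k z = w) * f z = 0" by simp
    qed
  qed simp
  finally show ?thesis ..
qed

locale lift_setting = control_setting +
  fixes X :: "real \<Rightarrow> real \<Rightarrow> 'v::euclidean_space tensor"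
    and H :: "real \<Rightarrow> 'v list \<Rightarrow> 'u::euclidean_space"
  assumes X: "rough_path p T \<omega> X" and H: "controlled_path p T \<omega> X H"
begin

section \<open>Order estimates for the controlled path\<close>

abbreviation N where "N \<equiv> level p"

lemma X_err: "err (length w) (\<lambda>s u t. X s t w)" "err (length w) (\<lambda>s u t. X s u w)"
    "err (length w) (\<lambda>s u t. X u t w)"
  using rough_path_err[OF X, of w] err_sub(1)[OF rough_path_err[OF X, of w]]
    err_sub(2)[OF rough_path_err[OF X, of w]] by simp_all

lemma X_Nil: "\<lbrakk>0 \<le> s; s \<le> t; t \<le> T\<rbrakk> \<Longrightarrow> X s t [] = 1"
  using X by (auto simp: rough_path_def regular_tensor_map_def simplex2_def tcomp_0_eq_tone)

lemma H_eq_0: "0 \<le> t \<Longrightarrow> t \<le> T \<Longrightarrow> w \<notin> words_upto (N - 1) \<Longrightarrow> H t w = 0"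
  using H by (auto simp: controlled_path_def trunc_space_def)

lemma H_increment_err: "err 1 (\<lambda>s u t. H t w \<bullet> c - H s w \<bullet> c)"
proof (cases "w \<in> words_upto (N - 1)")
  case False
  then show ?thesis by (intro err_cong[OF err_zero]) (auto simp: H_eq_0)
next
  case True
  let ?g = "\<lambda>s t. L2_set (\<lambda>w. norm (H t w - H s w)) (words_upto (N - 1))"
  have "bigO_ctrl p T \<omega> 1 ?g"
    using H by (simp add: controlled_path_def)
  then have "bigO_ctrl p T \<omega> 1 (\<lambda>s t. \<bar>norm (H t w - H s w)\<bar>)"
    by (rule bigO_ctrl_mono) (use True in \<open>auto intro!: member_le_L2_set\<close>)
  then have "err 1 (\<lambda>s u t. norm (H t w - H s w))"
    using err_iff_bigO_ctrl[of 1] by simp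
  then have "err 1 (\<lambda>s u t. norm (H t w - H s w) * norm c)"
    by (rule err_cmult)
  then obtain C where C: "\<And>s u t. \<lbrakk>0 \<le> s; s \<le> u; u \<le> t; t \<le> T\<rbrakk> \<Longrightarrow>
      \<bar>norm (H t w - H s w) * norm c\<bar> \<le> C * scale s t ^ 1"
    by (rule errE) (rule that; assumption)
  show ?thesis
  proof (rule errI)
    fix s u t assume *: "0 \<le> s" "s \<le> u" "u \<le> t" "t \<le> T"
    have "\<bar>H t w \<bullet> c - H s w \<bullet> c\<bar> \<le> norm (H t w - H s w) * norm c"
      unfolding inner_diff_left[symmetric] by (rule Cauchy_Schwarz_ineq2)
    then show "\<bar>H t w \<bullet> c - H s w \<bullet> c\<bar> \<le> C * scale s t ^ 1"
      using C[OF *] by linarith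
  qed
qed

lemma H_err: "err 0 (\<lambda>s u t. H s w \<bullet> c)" "err 0 (\<lambda>s u t. H u w \<bullet> c)"
proof -
  obtain C where C: "0 \<le> C" "\<And>s u t. \<lbrakk>0 \<le> s; s \<le> u; u \<le> t; t \<le> T\<rbrakk> \<Longrightarrow>
      \<bar>H t w \<bullet> c - H s w \<bullet> c\<bar> \<le> C * scale s t ^ 1"
    using H_increment_err[of w c] by (rule errE) (rule that; assumption)
  have *: "\<bar>H t w \<bullet> c\<bar> \<le> \<bar>H 0 w \<bullet> c\<bar> + C * scale 0 T" if "0 \<le> t" "t \<le> T" for t
  proof -
    have "C * scale 0 t \<le> C * scale 0 T"
      using C(1) scale_mono[of 0 0 t T] that by (intro mult_left_mono) auto
    then show ?thesis using C(2)[of 0 t t] that by simp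
  qed
  show "err 0 (\<lambda>s u t. H s w \<bullet> c)" "err 0 (\<lambda>s u t. H u w \<bullet> c)"
    by (rule errI[where C = "\<bar>H 0 w \<bullet> c\<bar> + C * scale 0 T"], use * in force)+
qed

text \<open>One Taylor estimate for all words. The defining condition covers lengths up to
  \<open>N - 2\<close>. At length \<open>N - 1\<close> only the empty word \<open>v\<close>
  contributes, and Hoelder regularity gives order \<open>1\<close>. For all other \<open>w\<close>
  both terms vanish, as \<open>H\<close> does off \<open>words_upto (N - 1)\<close>.\<close>

lemma controlled_err:
  "err (N - length w) (\<lambda>s u t. H u w \<bullet> c - (\<Sum>v\<in>words_upto N. X s u v * (H s (v @ w) \<bullet> c)))"
proof -
  have vanish: "H s (v @ w) \<bullet> c = 0" if "0 \<le> s" "s \<le> T" "N - 1 < length v + length w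
      \<or> \<not> set w \<subseteq> Basis" for s v
    using H_eq_0[OF that(1,2), of "v @ w"] that(3)
    by (cases "set w \<subseteq> Basis") (auto simp: words_upto_iff)
  consider "w \<notin> words_upto (N - 1)" | "w \<in> words (N - 1)" | n where "n + 2 \<le> N" "w \<in> words n"
  proof -
    have "w \<in> words_upto (N - 1) \<Longrightarrow> w \<notin> words (N - 1) \<Longrightarrow> length w + 2 \<le> N \<and> w \<in> words (length w)"
      by (auto simp: words_upto_iff words_iff)
    then show thesis using that by blast
  qed
  then show ?thesis
  proof cases
    case 1
    then have "N - 1 < length v + length w \<or> \<not> set w \<subseteq> Basis" for v :: "'v list"
      by (auto simp: words_upto_iff)
    with 1 show ?thesis
      by (intro err_cong[OF err_zero]) (simp add: vanish H_eq_0)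
  next
    case 2
    have len: "length w = N - 1" using 2 by (simp add: words_iff)
    have e: "N - length w = 1" using level_ge_1 len by simp
    have "(\<Sum>v\<in>words_upto N. X s u v * (H s (v @ w) \<bullet> c)) = H s w \<bullet> c"
      if "0 \<le> s" "s \<le> u" "u \<le> T" for s u
    proof -
      have "(\<Sum>v\<in>words_upto N. X s u v * (H s (v @ w) \<bullet> c))
          = (\<Sum>v\<in>(words_upto N :: 'v list set). of_bool (v = []) * (H s w \<bullet> c))"
      proof (rule sum.cong[OF refl])
        fix v :: "'v list"
        show "X s u v * (H s (v @ w) \<bullet> c) = of_bool (v = []) * (H s w \<bullet> c)"
          using vanish[of s v] X_Nil[of s u] that len by (cases v) auto
      qed
      also have "\<dots> = H s w \<bullet> c"
        by (simp add: sum_of_bool_mult words_upto_iff)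
      finally show ?thesis .
    qed
    then have "err 1 (\<lambda>s u t. H u w \<bullet> c - (\<Sum>v\<in>words_upto N. X s u v * (H s (v @ w) \<bullet> c)))"
      by (intro err_cong[OF err_sub(1)[OF H_increment_err, of w c]]) auto
    then show ?thesis by (simp only: e)
  next
    case (3 n)
    define a :: "'v tensor" where "a = (\<lambda>z. of_bool (z = w))"
    have a: "a \<in> tensor_power n" using 3 by (auto simp: a_def tensor_power_def)
    let ?D = "\<lambda>s t. pairing n (H t) a
          - (\<Sum>k\<le>N - 1 - n. pairing (n + k) (H s) (tprod (tcomp k (X s t)) a))"
    have bO: "bigO_ctrl p T \<omega> (N - n) (\<lambda>s t. norm (?D s t))"
      using H 3 a by (simp add: controlled_path_def)
    have D: "?D s t \<bullet> c = H t w \<bullet> c - (\<Sum>v\<in>words_upto N. X s t v * (H s (v @ w) \<bullet> c))"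
      if st: "0 \<le> s" "s \<le> t" "t \<le> T" for s t
    proof -
      have "pairing n (H t) a \<bullet> c = (\<Sum>z\<in>words n. of_bool (z = w) * (H t z \<bullet> c))"
        by (simp add: pairing_def a_def inner_sum_left)
      then have p1: "pairing n (H t) a \<bullet> c = H t w \<bullet> c"
        using 3 by (simp add: sum_of_bool_mult)
      have p2: "pairing (n + k) (H s) (tprod (tcomp k (X s t)) a) \<bullet> c
          = (\<Sum>v\<in>words k. X s t v * (H s (v @ w) \<bullet> c))" for k
      proof -
        have tp: "tprod (tcomp k (X s t)) a z = of_bool (drop k z = w) * X s t (take k z)"
          if z: "z \<in> words (k + n)" for z
        proof -
          have "tprod (tcomp k (X s t)) a z
              = (\<Sum>i\<le>length z. of_bool (i = k) * (X s t (take i z) * of_bool (drop i z = w)))"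
            unfolding tprod_def a_def
            by (rule sum.cong[OF refl]) (auto simp: tcomp_def)
          also have "\<dots> = of_bool (drop k z = w) * X s t (take k z)"
            using z by (simp add: sum_of_bool_mult words_iff)
          finally show ?thesis .
        qed
        have "pairing (n + k) (H s) (tprod (tcomp k (X s t)) a) \<bullet> c
            = (\<Sum>z\<in>words (k + n). of_bool (drop k z = w) * (X s t (take k z) * (H s z \<bullet> c)))"
          unfolding pairing_def inner_sum_left inner_scaleR_left add.commute[of n k]
          by (rule sum.cong[OF refl]) (simp add: tp)
        also have "\<dots> = (\<Sum>v\<in>words k. X s t (take k (v @ w)) * (H s (v @ w) \<bullet> c))"
          using 3 sum_words_drop_eq[of w n n k "\<lambda>z. X s t (take k z) * (H s z \<bullet> c)"] by simp
        also have "\<dots> = (\<Sum>v\<in>words k. X s t v * (H s (v @ w) \<bullet> c))"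
          by (rule sum.cong) (auto simp: words_iff)
        finally show ?thesis .
      qed
      have "(\<Sum>k\<le>N - 1 - n. pairing (n + k) (H s) (tprod (tcomp k (X s t)) a)) \<bullet> c
        = (\<Sum>v\<in>words_upto (N - 1 - n). X s t v * (H s (v @ w) \<bullet> c))"
        by (simp add: inner_sum_left p2 sum_words_upto_levels)
      also have "\<dots> = (\<Sum>v\<in>words_upto N. X s t v * (H s (v @ w) \<bullet> c))"
      proof (rule sum.mono_neutral_left)
        show "\<forall>v\<in>words_upto N - words_upto (N - 1 - n). X s t v * (H s (v @ w) \<bullet> c) = 0"
        proof
          fix v :: "'v list" assume "v \<in> words_upto N - words_upto (N - 1 - n)"
          then have "N - 1 < length v + length w" using 3 by (auto simp: words_upto_iff words_iff)
          then show "X s t v * (H s (v @ w) \<bullet> c) = 0" using vanish st by simp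
        qed
      qed (auto simp: words_upto_iff)
      finally show ?thesis by (simp add: inner_diff_left p1)
    qed
    have "0 < N - n" using 3 by simp
    then have "err (N - n) (\<lambda>s u t. norm (?D s t))"
      by (rule iffD2[OF err_iff_bigO_ctrl]) (use bO in simp)
    then have "err (N - n) (\<lambda>s u t. norm (?D s t) * norm c)"
      by (rule err_cmult)
    then obtain C where C: "\<And>s u t. \<lbrakk>0 \<le> s; s \<le> u; u \<le> t; t \<le> T\<rbrakk> \<Longrightarrow>
        \<bar>norm (?D s t) * norm c\<bar> \<le> C * scale s t ^ (N - n)"
      by (rule errE) (rule that; assumption)
    have "err (N - n) (\<lambda>s u t. H t w \<bullet> c - (\<Sum>v\<in>words_upto N. X s t v * (H s (v @ w) \<bullet> c)))"
    proof (rule errI)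
      fix s u t assume *: "0 \<le> s" "s \<le> u" "u \<le> t" "t \<le> T"
      have "\<bar>?D s t \<bullet> c\<bar> \<le> norm (?D s t) * norm c"
        by (rule Cauchy_Schwarz_ineq2)
      then show "\<bar>H t w \<bullet> c - (\<Sum>v\<in>words_upto N. X s t v * (H s (v @ w) \<bullet> c))\<bar> \<le> C * scale s t ^ (N
          - n)"
        using C[OF *] D[of s t] * by simp
    qed
    then have "err (N - n) (\<lambda>s u t. H u w \<bullet> c - (\<Sum>v\<in>words_upto N. X s u v * (H s (v @ w) \<bullet> c)))"
      by (rule err_sub(1))
    then show ?thesis using 3 by (simp add: words_iff)
  qed
qed

lemma osh_err: "err 0 (\<lambda>s u t. osh (H s) z w)" "err 0 (\<lambda>s u t. osh (H u) z w)"
proof -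
  show "err 0 (\<lambda>s u t. osh (H s) z w)"
  proof (induction z arbitrary: w rule: rev_induct)
    case (snoc c z)
    show ?case
      by (cases w rule: rev_cases)
        (auto intro!: err_zero err_split_sum err_mult'[OF snoc H_err(1)])
  qed (simp add: err_const)
  show "err 0 (\<lambda>s u t. osh (H u) z w)"
  proof (induction z arbitrary: w rule: rev_induct)
    case (snoc c z)
    show ?case
      by (cases w rule: rev_cases)
        (auto intro!: err_zero err_split_sum err_mult'[OF snoc H_err(2)])
  qed (simp add: err_const)
qed

section \<open>The expanded lift and the change of its base point\<close>

abbreviation lifted :: "real \<Rightarrow> real \<Rightarrow> 'u tensor" where
  "lifted s t \<equiv> osh_lift N (X s t) (H s)"

text \<open>Words shorter than \<open>z\<close> contribute nothing by \<open>osh_eq_0\<close>, and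
  every other term has at least the order of its word.\<close>

lemma lifted_err: "err (length z) (\<lambda>s u t. lifted s t z)"
  unfolding osh_lift_def
proof (rule err_sum)
  fix w :: "'v list"
  show "err (length z) (\<lambda>s u t. X s t w * osh (H s) z w)"
  proof (cases "length w < length z")
    case True
    then show ?thesis by (simp add: osh_eq_0 err_zero)
  next
    case False
    then show ?thesis using err_mult'[OF X_err(1) osh_err(1)] by simp
  qed
qed

lemma lifted_err': "err (length z) (\<lambda>s u t. lifted s u z)" "err (length z) (\<lambda>s u t. lifted u t z)"
  using err_sub(1)[OF lifted_err, of z] err_sub(2)[OF lifted_err, of z] by simp_all

text \<open>This is \<Psi> at base point \<open>s\<close> applied to \<open>X s u\<close> followed
  by \<open>w\<close>. In its counterpart \<open>product_lift\<close>, the letters of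
  \<open>w\<close> are processed by \<Psi> at base point \<open>u\<close>.\<close>

definition shifted_lift :: "real \<Rightarrow> real \<Rightarrow> 'v list \<Rightarrow> 'u list \<Rightarrow> real" where
  "shifted_lift s u w z = (\<Sum>v\<in>words_upto N. X s u v * osh (H s) z (v @ w))"

lemma shifted_lift_Nil: "shifted_lift s u [] z = lifted s u z"
  by (simp add: shifted_lift_def osh_lift_def)

lemma shifted_lift_empty:
  "\<lbrakk>0 \<le> s; s \<le> u; u \<le> T\<rbrakk> \<Longrightarrow> shifted_lift s u w [] = of_bool (w = [])"
  by (auto simp: shifted_lift_def of_bool_conj sum_of_bool_mult mult.commute[of "X s u _"]
      words_upto_iff X_Nil)

lemma lifted_empty: "\<lbrakk>0 \<le> s; s \<le> u; u \<le> T\<rbrakk> \<Longrightarrow> lifted s u [] = 1"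
  using shifted_lift_empty[of s u "[]"] by (simp add: shifted_lift_Nil)

lemma shifted_lift_err: "err 0 (\<lambda>s u t. shifted_lift s u w z)"
  unfolding shifted_lift_def by (intro err_sum err_mult'[OF X_err(2) osh_err(1)]) simp

definition product_lift :: "real \<Rightarrow> real \<Rightarrow> 'v list \<Rightarrow> 'u list \<Rightarrow> real" where
  "product_lift s u w z = (\<Sum>i\<le>length z. lifted s u (take i z) * osh (H u) (drop i z) w)"

text \<open>The letter \<open>x\<close> ends the final block, which thus belongs to the right-hand
  factor. The cut that leaves this factor empty drops out, because a nonempty word has no unshuffle
  into zero blocks.\<close>

lemma product_lift_snoc:
  "product_lift s u (w @ [x]) (z @ [c])
    = split_sum (\<lambda>a b. product_lift s u a z * (H u (b @ [x]) \<bullet> c)) w"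
proof -
  have "product_lift s u (w @ [x]) (z @ [c])
      = (\<Sum>i\<le>length z. lifted s u (take i (z @ [c])) * osh (H u) (drop i (z @ [c])) (w @ [x]))"
    unfolding product_lift_def sum_snoc_cut by simp
  also have "\<dots> = (\<Sum>i\<le>length z. split_sum (\<lambda>a b. lifted s u (take i z) *
      osh (H u) (drop i z) a * (H u (b @ [x]) \<bullet> c)) w)"
    by (intro sum.cong refl) (simp add: split_sum_mult_left mult.assoc)
  finally show ?thesis
    by (simp add: split_sum_sum[symmetric] product_lift_def sum_distrib_right)
qed

text \<open>The letters of \<open>X s u\<close> are distributed between the final block, which ends
  in \<open>x\<close>, and the earlier blocks. Group-likeness turns this into two independent sums
  over words, one of which is the Taylor expansion of \<open>H u (b @ [x])\<close>.\<close>

lemma shifted_lift_snoc: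
  "err (Suc N) (\<lambda>s u t. split_sum (\<lambda>a b. shifted_lift s u a z *
       (\<Sum>v\<in>words_upto N. X s u v * (H s (v @ b @ [x]) \<bullet> c))) w - shifted_lift s u (w @ [x]) (z @
           [c]))"
proof -
  let ?f = "\<lambda>s v v'. split_sum (\<lambda>a b. osh (H s) z (v @ a) * (H s (v' @ b @ [x]) \<bullet> c)) w"
  let ?G = "\<lambda>s u t v v'. X s u v * X s u v' * ?f s v v'"
  have "err (length v + length v') (\<lambda>s u t. ?G s u t v v')" for v v'
  proof -
    have "err 0 (\<lambda>s u t. ?f s v v')"
      by (intro err_split_sum err_mult'[OF osh_err(1) H_err(1)]) simp
    then show ?thesis using err_mult'[OF err_mult[OF X_err(2) X_err(2)]] by simp
  qed
  from err_truncate[where G = ?G, OF this, of N]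
  show ?thesis
  proof (rule err_cong)
    fix s u t assume *: "0 \<le> s" "s \<le> u" "u \<le> t" "t \<le> T"
    have "(\<Sum>v\<in>words_upto N. \<Sum>v'\<in>words_upto N. ?G s u t v v')
        = split_sum (\<lambda>a b. \<Sum>v\<in>words_upto N. \<Sum>v'\<in>words_upto N.
            (X s u v * osh (H s) z (v @ a)) * (X s u v' * (H s (v' @ b @ [x]) \<bullet> c))) w"
      by (simp add: split_sum_sum split_sum_mult_left[symmetric] mult_ac)
    also have "\<dots> = split_sum (\<lambda>a b. shifted_lift s u a z *
       (\<Sum>v\<in>words_upto N. X s u v * (H s (v @ b @ [x]) \<bullet> c))) w"
      by (simp add: sum_product shifted_lift_def)
    finally have 1: "(\<Sum>v\<in>words_upto N. \<Sum>v'\<in>words_upto N. ?G s u t v v')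
        = split_sum (\<lambda>a b. shifted_lift s u a z *
       (\<Sum>v\<in>words_upto N. X s u v * (H s (v @ b @ [x]) \<bullet> c))) w" .
    have "shifted_lift s u (w @ [x]) (z @ [c]) = (\<Sum>v\<in>words_upto N. X s u v *
        osh (H s) (z @ [c]) ((v @ w) @ [x]))"
      by (simp add: shifted_lift_def)
    also have "\<dots> = (\<Sum>v\<in>words_upto N. X s u v * split_sum (?f s) v)"
      by (simp only: osh_simps split_sum_append) (simp only: append_assoc)
    also have "\<dots> = (\<Sum>(v, v') | v \<in> words_upto N \<and> v' \<in> words_upto N \<and> length v + length v' \<le> N.
        ?G s u t v v')"
      using sum_rough_path_split[OF X, of s u "?f s"] * by simp
    finally show "split_sum (\<lambda>a b. shifted_lift s u a z *
       (\<Sum>v\<in>words_upto N. X s u v * (H s (v @ b @ [x]) \<bullet> c))) w - shifted_lift s u (w @ [x]) (z @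
           [c])
      = (\<Sum>v\<in>words_upto N. \<Sum>v'\<in>words_upto N. ?G s u t v v') -
        (\<Sum>(v, v') | v \<in> words_upto N \<and> v' \<in> words_upto N \<and> length v + length v' \<le> N. ?G s u t v v')"
      by (simp only: 1)
  qed
qed

text \<open>In degree \<open>1\<close> the expansion of \<open>H\<close> is one order worse; every other factor of a longer
  product makes up for it.\<close>

lemma shifted_lift_product_lift:
  assumes "z \<noteq> []"
  shows "err (N + of_bool (2 \<le> length z) - length w) (\<lambda>s u t. shifted_lift s u w z - product_lift s
      u w z)"
  using assms
proof (induction z arbitrary: w rule: rev_induct)
  case Nil
  then show ?case by simp
next
  case (snoc c z)
  show ?case
  proof (cases w rule: rev_cases)
    case Nil
    have "product_lift s u [] (z @ [c]) = lifted s u (z @ [c])" for s u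
      unfolding product_lift_def sum_snoc_cut by (simp add: osh_Nil)
    then show ?thesis by (simp add: Nil shifted_lift_Nil err_zero)
  next
    case w: (snoc w' x)
    let ?K = "N + of_bool (2 \<le> length (z @ [c])) - length w"
    let ?S = "\<lambda>s u b. \<Sum>v\<in>words_upto N. X s u v * (H s (v @ b @ [x]) \<bullet> c)"
    let ?h = "\<lambda>u b. H u (b @ [x]) \<bullet> c"
    \<comment> \<open>Telescoping of \<open>shifted_lift s u a z * ?S s u b - product_lift s u a z *
      ?h u b\<close>: the first term is covered by the induction hypothesis, the second by the
      expansion of \<open>H\<close>.\<close>
    have "err ?K (\<lambda>s u t. split_sum (\<lambda>a b. (shifted_lift s u a z - product_lift s u a z) * ?h u b
        - shifted_lift s u a z * (?h u b - ?S s u b)) w')"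
    proof (rule err_split_sum)
      fix a b :: "'v list" assume l: "length a + length b = length w'"
      have 1: "err ?K (\<lambda>s u t. (shifted_lift s u a z - product_lift s u a z) * ?h u b)"
      proof (cases "z = []")
        case True
        show ?thesis
          by (rule err_cong[OF err_zero])
            (simp add: True shifted_lift_empty product_lift_def lifted_empty)
      next
        case False
        \<comment> \<open>The subword \<open>a\<close> lacks the letter \<open>x\<close>. The order
          gained in this way pays for the additional order demanded of \<open>z @ [c]\<close> when
          \<open>z\<close> is a single letter.\<close>
        have "?K \<le> (N + of_bool (2 \<le> length z) - length a) + 0"
          using l False by (cases z) (auto simp: w)
        then show ?thesis by (rule err_mult'[OF snoc.IH[OF False] H_err(2)])
      qed
      have c: "err (N - length (b @ [x])) (\<lambda>s u t. ?h u b - ?S s u b)"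
        using controlled_err[of "b @ [x]" c] by simp
      \<comment> \<open>For \<open>a = []\<close> the final block contains all of \<open>w\<close>,
        and the Taylor error alone is one order short; the factor \<open>lifted s u z\<close>
        supplies it. Otherwise either \<open>a\<close> is nonempty and the final block is shorter,
        or \<open>z = []\<close> and the additional order is not demanded.\<close>
      have 2: "err ?K (\<lambda>s u t. shifted_lift s u a z * (?h u b - ?S s u b))"
      proof (cases "z \<noteq> [] \<and> a = []")
        case True
        have "err 1 (\<lambda>s u t. shifted_lift s u a z)"
          using True err_mono[OF lifted_err'(1), of 1 z] by (cases z) (auto simp: shifted_lift_Nil)
        from this c show ?thesis
          by (rule err_mult') (use l True in \<open>cases z; auto simp: w\<close>)
      next
        case False
        have "?K \<le> 0 + (N - length (b @ [x]))"
          using l False by (cases z; cases a) (auto simp: w)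
        then show ?thesis by (rule err_mult'[OF shifted_lift_err c])
      qed
      show "err ?K (\<lambda>s u t. (shifted_lift s u a z - product_lift s u a z) * ?h u b
        - shifted_lift s u a z * (?h u b - ?S s u b))"
        using 1 2 by (rule err_diff)
    qed
    moreover have "err ?K (\<lambda>s u t. split_sum (\<lambda>a b. shifted_lift s u a z * ?S s u b) w'
        - shifted_lift s u w (z @ [c]))"
      unfolding w by (rule err_mono[OF shifted_lift_snoc]) (simp, arith)
    ultimately have "err ?K (\<lambda>s u t. split_sum (\<lambda>a b. (shifted_lift s u a z - product_lift s u a z)
        * ?h u b
        - shifted_lift s u a z * (?h u b - ?S s u b)) w'
        - (split_sum (\<lambda>a b. shifted_lift s u a z * ?S s u b) w' - shifted_lift s u w (z @ [c])))"
      by (rule err_diff)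
    then show ?thesis
      by (simp add: w product_lift_snoc split_sum_diff algebra_simps)
  qed
qed

text \<open>Multiplicativity of \<open>X\<close> rewrites \<open>lifted s t z\<close>, up to
  truncation, as the sum of \<open>X u t w * shifted_lift s u w z\<close>. Passing to
  \<open>product_lift\<close> loses \<open>length w\<close> orders, which is exactly the order of
  \<open>X u t w\<close>.\<close>

lemma lifted_mult_err:
  assumes "2 \<le> length z"
  shows "err (Suc N) (\<lambda>s u t. lifted s t z - (\<Sum>i\<le>length z. lifted s u (take i z) * lifted u t (drop
      i z)))"
proof -
  let ?G = "\<lambda>s u t v w. X s u v * X u t w * osh (H s) z (v @ w)"
  let ?A = "\<lambda>s u t. \<Sum>v\<in>words_upto N. \<Sum>w\<in>words_upto N. ?G s u t v w"
  have "err (length v + length w) (\<lambda>s u t. ?G s u t v w)" for v w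
    using err_mult'[OF err_mult[OF X_err(2) X_err(3)] osh_err(1)] by simp
  from err_truncate[where G = ?G, OF this, of N]
  have "err (Suc N) (\<lambda>s u t. ?A s u t - lifted s t z)"
  proof (rule err_cong)
    fix s u t assume *: "0 \<le> s" "s \<le> u" "u \<le> t" "t \<le> T"
    have "lifted s t z = (\<Sum>w\<in>words_upto N. \<Sum>i\<le>length w. ?G s u t (take i w) (drop i w))"
      unfolding osh_lift_def
      by (rule sum.cong[OF refl])
        (simp add: rough_path_mult[OF X *] words_upto_iff sum_distrib_right)
    also have "\<dots> = (\<Sum>(v, w) | v \<in> words_upto N \<and> w \<in> words_upto N \<and> length v + length w
        \<le> N. ?G s u t v w)"
      by (rule sum_words_upto_cut)
    finally show "?A s u t - lifted s t z = ?A s u t -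
        (\<Sum>(v, w) | v \<in> words_upto N \<and> w \<in> words_upto N \<and> length v + length w \<le> N. ?G s u t v w)"
      by simp
  qed
  moreover have "err (Suc N) (\<lambda>s u t. \<Sum>w\<in>words_upto N. X u t w * (shifted_lift s u w z
      - product_lift s u w z))"
  proof (rule err_sum)
    fix w :: "'v list"
    have z: "z \<noteq> []" using assms by auto
    have "Suc N \<le> length w + (N + of_bool (2 \<le> length z) - length w)" using assms by simp
    then show "err (Suc N) (\<lambda>s u t. X u t w * (shifted_lift s u w z - product_lift s u w z))"
      by (rule err_mult'[OF X_err(3) shifted_lift_product_lift[OF z]])
  qed
  ultimately have "err (Suc N) (\<lambda>s u t. (\<Sum>w\<in>words_upto N. X u t w * (shifted_lift s u w z
      - product_lift s u w z))
      - (?A s u t - lifted s t z))"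
    by (rule err_diff[rotated])
  moreover have "(\<Sum>w\<in>words_upto N. X u t w * (shifted_lift s u w z - product_lift s u w z))
      - (?A s u t - lifted s t z) = lifted s t z - (\<Sum>i\<le>length z. lifted s u (take i z)
          * lifted u t (drop i z))"
    for s u t
  proof -
    have "(\<Sum>w\<in>words_upto N. X u t w * shifted_lift s u w z) = ?A s u t"
      unfolding shifted_lift_def sum_distrib_left
      by (subst sum.swap) (simp add: mult_ac)
    moreover have "(\<Sum>w\<in>words_upto N. X u t w * product_lift s u w z)
        = (\<Sum>i\<le>length z. lifted s u (take i z) * lifted u t (drop i z))"
      unfolding product_lift_def sum_distrib_left
      by (subst sum.swap) (simp add: osh_lift_def sum_distrib_left mult_ac)
    ultimately show ?thesis
      by (simp add: right_diff_distrib sum_subtractf)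
  qed
  ultimately show ?thesis by simp
qed

text \<open>By \<open>osh_shuffle\<close> the shuffle sum over words in \<open>U\<close> becomes a
  \<open>split_sum\<close> over words in \<open>V\<close>, where group-likeness of
  \<open>X s t\<close> applies. The whole error consists of truncated pairs.\<close>

lemma lifted_shuffle_err:
  assumes "x \<in> words a" "y \<in> words b"
  shows "err (Suc N) (\<lambda>s u t. lifted s t x * lifted s t y - (\<Sum>w\<in>words (a + b). lifted s t w
      * shuffle_count x y w))"
proof -
  let ?G = "\<lambda>s (u::real) t v w. X s t v * X s t w * (osh (H s) x v * osh (H s) y w)"
  have "err (length v + length w) (\<lambda>s u t. ?G s u t v w)" for v w
    using err_mult'[OF err_mult[OF X_err(1) X_err(1)] err_mult[OF osh_err(1) osh_err(1)]] by simp
  from err_truncate[where G = ?G, OF this, of N]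
  show ?thesis
  proof (rule err_cong)
    fix s u t assume *: "0 \<le> s" "s \<le> u" "u \<le> t" "t \<le> T"
    have "(\<Sum>w\<in>words (a + b). lifted s t w * shuffle_count x y w)
        = (\<Sum>w\<in>words (a + b). \<Sum>v\<in>words_upto N. X s t v * (shuffle_count x y w * osh (H s) w v))"
      unfolding osh_lift_def sum_distrib_right by (simp add: mult_ac)
    also have "\<dots> = (\<Sum>v\<in>words_upto N. X s t v * split_sum (\<lambda>p q. osh (H s) x p * osh (H s) y q) v)"
      by (subst sum.swap) (simp add: sum_distrib_left[symmetric] osh_shuffle[OF assms])
    also have "\<dots> = (\<Sum>(v, w) | v \<in> words_upto N \<and> w \<in> words_upto N \<and> length v + length w
        \<le> N. ?G s u t v w)"
      by (rule sum_rough_path_split[OF X]) (use * in auto)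
    finally have "(\<Sum>w\<in>words (a + b). lifted s t w * shuffle_count x y w)
        = (\<Sum>(v, w) | v \<in> words_upto N \<and> w \<in> words_upto N \<and> length v + length w \<le> N. ?G s u t v w)" .
    moreover have "lifted s t x * lifted s t y = (\<Sum>v\<in>words_upto N. \<Sum>w\<in>words_upto N. ?G s u t v w)"
      by (simp add: osh_lift_def sum_product mult_ac)
    ultimately show "lifted s t x * lifted s t y - (\<Sum>w\<in>words (a + b). lifted s t w * shuffle_count x
        y w)
      = (\<Sum>v\<in>words_upto N. \<Sum>w\<in>words_upto N. ?G s u t v w) -
        (\<Sum>(v, w) | v \<in> words_upto N \<and> w \<in> words_upto N \<and> length v + length w \<le> N. ?G s u t v w)"
      by simp
  qed
qed

end

section \<open>The lift is an almost rough path\<close>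

lemma continuous_on_split_sum:
  assumes "\<And>a b. continuous_on S (\<lambda>x. F x a b)"
  shows "continuous_on S (\<lambda>x. split_sum (F x) w)"
  using assms by (induction w arbitrary: F) (auto intro: continuous_on_add)

lemma almost_lift_Nil [simp]: "almost_lift N X H s t [] = 1"
  by (simp add: almost_lift_def lift_comp_def tone_def)

lemma almost_lift_letter:
  "1 \<le> N \<Longrightarrow> c \<in> Basis \<Longrightarrow> almost_lift N X H s t [c] = H t [] \<bullet> c - H s [] \<bullet> c"
  by (simp add: almost_lift_def lift_comp_def pure_tensor_def words_iff ctrace_def inner_diff_left)

lemma almost_lift_eq_0: "z \<notin> words_upto N \<Longrightarrow> almost_lift N X H s t z = 0"
  by (auto simp: almost_lift_def lift_comp_def ext_pairing_def pure_tensor_def words_iff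
      words_upto_iff)

context control_setting
begin

lemma err_tnorm:
  assumes "\<And>w. w \<in> words n \<Longrightarrow> err k (f w)" "0 < k"
  shows "\<exists>C. \<forall>s u t. 0 \<le> s \<and> s \<le> u \<and> u \<le> t \<and> t \<le> T \<longrightarrow>
    tnorm n (\<lambda>w. f w s u t) \<le> C * \<omega> s t powr (real k / p)"
proof -
  have "err k (\<lambda>s u t. \<Sum>w\<in>words n. \<bar>f w s u t\<bar>)"
    by (intro err_sum err_abs assms)
  then obtain C where C: "\<And>s u t. \<lbrakk>0 \<le> s; s \<le> u; u \<le> t; t \<le> T\<rbrakk> \<Longrightarrow>
      \<bar>\<Sum>w\<in>words n. \<bar>f w s u t\<bar>\<bar> \<le> C * scale s t ^ k"
    by (rule errE) (rule that; assumption)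
  have "tnorm n (\<lambda>w. f w s u t) \<le> C * \<omega> s t powr (real k / p)"
    if "0 \<le> s" "s \<le> u" "u \<le> t" "t \<le> T" for s u t
    using C[OF that] tnorm_le_sum[of n "\<lambda>w. f w s u t"] assms(2) by (simp add: scale_power)
  then show ?thesis by blast
qed

lemma err_ext_norm:
  assumes "\<And>x y. x \<in> words a \<Longrightarrow> y \<in> words b \<Longrightarrow> err k (\<lambda>s u t. f s t [x, y])" "0 < k"
  shows "bigO_ctrl p T \<omega> k (\<lambda>s t. ext_norm [a, b] (f s t))"
proof -
  have "err k (\<lambda>s u t. \<Sum>ws\<in>listset (map words [a, b]). \<bar>f s t ws\<bar>)"
    by (rule err_sum, rule err_abs) (use assms(1) in \<open>auto simp: set_Cons_def\<close>)
  then have "bigO_ctrl p T \<omega> k (\<lambda>s t. \<bar>\<Sum>ws\<in>listset (map words [a, b]). \<bar>f s t ws\<bar>\<bar>)"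
    using err_iff_bigO_ctrl[OF assms(2), of "\<lambda>s t. \<Sum>ws\<in>listset (map words [a, b]). \<bar>f s t ws\<bar>"] by
        blast
  then show ?thesis
  proof (rule bigO_ctrl_mono)
    fix s t
    have "ext_norm [a, b] (f s t) \<le> (\<Sum>ws\<in>listset (map words [a, b]). \<bar>f s t ws\<bar>)"
      unfolding ext_norm_def by (rule L2_set_le_sum_abs)
    then show "ext_norm [a, b] (f s t) \<le> \<bar>\<Sum>ws\<in>listset (map words [a, b]). \<bar>f s t ws\<bar>\<bar>"
      by linarith
  qed
qed

end

context lift_setting
begin

abbreviation Y where "Y \<equiv> almost_lift N X H"

lemma Y_eq_lifted: "2 \<le> length z \<Longrightarrow> z \<in> words_upto N \<Longrightarrow> Y s t z = lifted s t z"
  by (simp add: almost_lift_eq_osh_lift words_upto_iff)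

lemma Y_err:
  assumes "z \<in> words_upto N"
  shows "err (length z) (\<lambda>s u t. Y s t z)"
proof -
  consider "z = []" | c where "z = [c]" "c \<in> Basis" | "2 \<le> length z"
    using assms by (cases z rule: remdups_adj.cases) (auto simp: words_upto_iff)
  then show ?thesis
  proof cases
    case 1
    then show ?thesis by (simp add: err_const)
  next
    case (2 c)
    then show ?thesis using H_increment_err[of "[]" c] level_ge_1 by (simp add: almost_lift_letter)
  next
    case 3
    then show ?thesis using lifted_err[of z] assms by (simp add: Y_eq_lifted)
  qed
qed

text \<open>The empty word is present in the expansion of the trace but not in degree
  \<open>1\<close> of the lift, where the single block is nonempty; hence the subtracted
  term.\<close>

lemma lifted_letter: "\<lbrakk>0 \<le> s; s \<le> t; t \<le> T\<rbrakk> \<Longrightarrow>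
  lifted s t [c] = (\<Sum>v\<in>words_upto N. X s t v * (H s v \<bullet> c)) - H s [] \<bullet> c"
proof -
  assume st: "0 \<le> s" "s \<le> t" "t \<le> T"
  have letter: "osh (H s) [c] v = H s v \<bullet> c - of_bool (v = []) * (H s [] \<bullet> c)" for v
  proof (cases v rule: rev_cases)
    case (snoc w x)
    then show ?thesis
      using osh_simps(3)[of "H s" "[]" c w x] split_sum_indicator_Nil(1)[of "\<lambda>b. H s (b @ [x]) \<bullet> c"
          w]
      by simp
  qed (simp add: osh_Nil)
  have "lifted s t [c] = (\<Sum>v\<in>words_upto N. X s t v * (H s v \<bullet> c)
      - of_bool (v = []) * (X s t v * (H s [] \<bullet> c)))"
    unfolding osh_lift_def by (intro sum.cong) (simp_all add: letter algebra_simps)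
  then show ?thesis
    using X_Nil[OF st] by (simp add: sum_subtractf sum_of_bool_mult words_upto_iff)
qed

text \<open>From degree \<open>2\<close> on the two coincide. In degree \<open>1\<close> the
  difference is the Taylor remainder of the trace, which has order \<open>N\<close> and in general
  not \<open>Suc N\<close>.\<close>

lemma Y_lifted_err:
  assumes "z \<in> words_upto N" "z \<noteq> []"
  shows "err N (\<lambda>s u t. Y s t z - lifted s t z)"
proof -
  consider c where "z = [c]" "c \<in> Basis" | "2 \<le> length z"
    using assms by (cases z rule: remdups_adj.cases) (auto simp: words_upto_iff)
  then show ?thesis
  proof cases
    case (1 c)
    have "err N (\<lambda>s u t. H u [] \<bullet> c - (\<Sum>v\<in>words_upto N. X s u v * (H s v \<bullet> c)))"
      using controlled_err[of "[]" c] by simp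
    then have "err N (\<lambda>s u t. Y s u z - lifted s u z)"
      by (rule err_cong) (use level_ge_1 1 in \<open>simp add: almost_lift_letter lifted_letter\<close>)
    then obtain C where C: "\<And>s u t. \<lbrakk>0 \<le> s; s \<le> u; u \<le> t; t \<le> T\<rbrakk> \<Longrightarrow>
      \<bar>Y s u z - lifted s u z\<bar> \<le> C * scale s t ^ N"
      by (rule errE) (rule that; assumption)
    show ?thesis
      by (rule errI[where C = C]) (use C in force)
  next
    case 2
    then show ?thesis using assms by (simp add: Y_eq_lifted err_zero)
  qed
qed

text \<open>Exchanging one factor costs order \<open>N\<close>, and the other factor, being a
  nonempty word, contributes at least the one order that is missing.\<close>

lemma Y_prod_lifted_err:
  assumes "x \<in> words_upto N" "y \<in> words_upto N" "x \<noteq> []" "y \<noteq> []"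
  shows "err (Suc N) (\<lambda>s u t. Y s u x * Y u t y - lifted s u x * lifted u t y)"
    and "err (Suc N) (\<lambda>s u t. Y s t x * Y s t y - lifted s t x * lifted s t y)"
proof -
  have x: "err 1 (\<lambda>s u t. lifted s t x)"
    using assms err_mono[OF lifted_err, of 1 x] by (cases x) auto
  have y: "err 1 (\<lambda>s u t. Y s t y)"
    using assms err_mono[OF Y_err, of y 1] by (cases y) auto
  note Lx = Y_lifted_err[OF assms(1,3)] and Ly = Y_lifted_err[OF assms(2,4)]
  have "err (Suc N) (\<lambda>s u t. (Y s u x - lifted s u x) * Y u t y + lifted s u x * (Y u t y
      - lifted u t y))"
    by (rule err_add; rule err_mult') (rule err_sub[OF Lx] err_sub[OF Ly] err_sub[OF x] err_sub[OF
        y] | simp)+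
  then show "err (Suc N) (\<lambda>s u t. Y s u x * Y u t y - lifted s u x * lifted u t y)"
    by (simp add: algebra_simps)
  have "err (Suc N) (\<lambda>s u t. (Y s t x - lifted s t x) * Y s t y + lifted s t x * (Y s t y
      - lifted s t y))"
    by (rule err_add; rule err_mult') (rule Lx Ly x y | simp)+
  then show "err (Suc N) (\<lambda>s u t. Y s t x * Y s t y - lifted s t x * lifted s t y)"
    by (simp add: algebra_simps)
qed

text \<open>In degree \<open>1\<close> increments of the trace are exactly additive. In higher
  degree the estimate is inherited from \<open>lifted\<close>; at the two extreme cuts the factors
  have degree \<open>0\<close> and \<open>length z\<close>, where \<open>Y\<close> and
  \<open>lifted\<close> agree.\<close>

lemma Y_mult_err:
  assumes "z \<in> words_upto N"
  shows "err (Suc N) (\<lambda>s u t. Y s t z - tprod (Y s u) (Y u t) z)"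
proof -
  consider "z = []" | c where "z = [c]" "c \<in> Basis" | "2 \<le> length z"
    using assms by (cases z rule: remdups_adj.cases) (auto simp: words_upto_iff)
  then show ?thesis
  proof cases
    case 1
    then show ?thesis by (simp add: tprod_def err_zero)
  next
    case (2 c)
    then have "Y s t z - tprod (Y s u) (Y u t) z = 0" for s u t
      using level_ge_1 by (simp add: tprod_def almost_lift_letter)
    then show ?thesis by (simp add: err_zero)
  next
    case 3
    have "err (Suc N) (\<lambda>s u t. \<Sum>i\<le>length z. Y s u (take i z) * Y u t (drop i z)
        - lifted s u (take i z) * lifted u t (drop i z))"
    proof (rule err_sum)
      fix i assume "i \<in> {..length z}"
      then consider "i = 0" | "i = length z" | "take i z \<noteq> []" "drop i z \<noteq> []" by fastforce
      then show "err (Suc N) (\<lambda>s u t. Y s u (take i z) * Y u t (drop i z)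
        - lifted s u (take i z) * lifted u t (drop i z))"
      proof cases
        case 3
        moreover have "take i z \<in> words_upto N" "drop i z \<in> words_upto N"
          using assms by (auto simp: words_upto_iff dest!: in_set_takeD in_set_dropD)
        ultimately show ?thesis by (intro Y_prod_lifted_err)
      qed (use \<open>2 \<le> length z\<close> assms in \<open>auto intro!: err_cong[OF err_zero] simp: lifted_empty
          Y_eq_lifted\<close>)
    qed
    with lifted_mult_err[OF 3]
    have "err (Suc N) (\<lambda>s u t. (lifted s t z - (\<Sum>i\<le>length z. lifted s u (take i z)
        * lifted u t (drop i z)))
      - (\<Sum>i\<le>length z. Y s u (take i z) * Y u t (drop i z)
        - lifted s u (take i z) * lifted u t (drop i z)))"
      by (rule err_diff)
    then show ?thesis using 3 assms by (simp add: sum_subtractf tprod_def Y_eq_lifted)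
  qed
qed

lemma Y_shuffle_err:
  assumes xy: "x \<in> words a" "y \<in> words b" and ab: "a + b \<le> N"
  shows "err (Suc N) (\<lambda>s u t. Y s t x * Y s t y - (\<Sum>w\<in>words (a + b). Y s t w * shuffle_count x y
      w))"
proof (cases "x = [] \<or> y = []")
  case True
  have "Y s t x * Y s t y - (\<Sum>w\<in>words (a + b). Y s t w * shuffle_count x y w) = 0" for s t
  proof -
    have "(\<Sum>w\<in>words (a + b). Y s t w * shuffle_count x y w)
        = (\<Sum>w\<in>words (a + b). of_bool (w = x @ y) * Y s t w)"
      using True by (intro sum.cong) auto
    then show ?thesis using True xy by (auto simp: sum_of_bool_mult words_iff)
  qed
  then show ?thesis by (simp add: err_zero)
next
  case False
  have "err (Suc N) (\<lambda>s u t. (Y s t x * Y s t y - lifted s t x * lifted s t y) +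
      (lifted s t x * lifted s t y - (\<Sum>w\<in>words (a + b). lifted s t w * shuffle_count x y w)))"
    using xy ab False by (intro err_add Y_prod_lifted_err lifted_shuffle_err) (auto simp:
        words_upto_iff words_iff)
  moreover have "(\<Sum>w\<in>words (a + b). lifted s t w * shuffle_count x y w)
      = (\<Sum>w\<in>words (a + b). Y s t w * shuffle_count x y w)" for s t
  proof (rule sum.cong[OF refl])
    fix w :: "'u list" assume "w \<in> words (a + b)"
    moreover have "1 \<le> a" "1 \<le> b" using False xy by (auto simp: words_iff Suc_le_eq)
    ultimately have "2 \<le> length w" "w \<in> words_upto N"
        using ab by (auto simp: words_iff words_upto_iff)
    then show "lifted s t w * shuffle_count x y w = Y s t w * shuffle_count x y w"
      by (simp add: Y_eq_lifted)
  qed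
  ultimately show ?thesis by simp
qed

lemma continuous_H: "continuous_on (simplex2 T) (\<lambda>z. H (fst z) w)" "continuous_on (simplex2 T) (\<lambda>z.
    H (snd z) w)"
proof -
  have "continuous_on {0..T} H" using H by (simp add: controlled_path_def)
  then have c: "continuous_on {0..T} (\<lambda>t. H t w)"
    by (rule continuous_on_product_then_coordinatewise)
  show "continuous_on (simplex2 T) (\<lambda>z. H (fst z) w)" "continuous_on (simplex2 T) (\<lambda>z. H (snd z) w)"
    by (rule continuous_on_compose2[OF c]; force simp: simplex2_def intro!: continuous_intros)+
qed

lemma continuous_osh: "continuous_on (simplex2 T) (\<lambda>z. osh (H (fst z)) u w)"
proof (induction u arbitrary: w rule: rev_induct)
  case (snoc c u)
  show ?case
    by (cases w rule: rev_cases)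
      (auto intro!: continuous_on_split_sum continuous_on_mult snoc continuous_on_inner continuous_H
        continuous_on_const)
qed simp

lemma continuous_Y: "continuous_on (simplex2 T) (\<lambda>(s, t). Y s t)"
proof (rule continuous_on_coordinatewise_then_product)
  fix z :: "'u list"
  have X_cont: "continuous_on (simplex2 T) (\<lambda>x. X (fst x) (snd x) w)" for w
  proof -
    have "continuous_on (simplex2 T) (\<lambda>x. X (fst x) (snd x))"
      using X by (simp add: rough_path_def regular_tensor_map_def case_prod_unfold)
    then show ?thesis by (rule continuous_on_product_then_coordinatewise)
  qed
  consider "z \<notin> words_upto N" | "z = []" | c where "z = [c]" "c \<in> Basis" | "2 \<le> length z"
      "z \<in> words_upto N"
    by (cases z rule: remdups_adj.cases) (auto simp: words_upto_iff)
  then show "continuous_on (simplex2 T) (\<lambda>x. (case x of (s, t) \<Rightarrow> Y s t) z)"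
    unfolding case_prod_unfold
  proof cases
    case 1
    then show "continuous_on (simplex2 T) (\<lambda>x. Y (fst x) (snd x) z)"
      by (simp add: almost_lift_eq_0)
  next
    case 2
    then show "continuous_on (simplex2 T) (\<lambda>x. Y (fst x) (snd x) z)" by simp
  next
    case (3 c)
    then show "continuous_on (simplex2 T) (\<lambda>x. Y (fst x) (snd x) z)"
      using level_ge_1 by (auto simp: almost_lift_letter intro!: continuous_on_diff
          continuous_on_inner
          continuous_H continuous_on_const)
  next
    case 4
    then show "continuous_on (simplex2 T) (\<lambda>x. Y (fst x) (snd x) z)"
      by (auto simp: Y_eq_lifted osh_lift_def intro!: continuous_on_sum continuous_on_mult X_cont
          continuous_osh)
  qed
qed

theorem almost_rough_path_almost_lift: "almost_rough_path p T \<omega> Y"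
  unfolding almost_rough_path_def
proof (intro conjI allI impI)
  show "regular_tensor_map p T \<omega> Y"
    by (rule regular_tensor_mapI)
      (auto simp: trunc_space_def almost_lift_eq_0 continuous_Y[simplified] Y_err)
next
  fix n assume n: "n \<le> N"
  have "err (Suc N) (\<lambda>s u t. Y s t w - tprod (Y s u) (Y u t) w)" if "w \<in> words n" for w
    using that n by (intro Y_mult_err) (auto simp: words_iff words_upto_iff)
  from err_tnorm[where f = "\<lambda>w s u t. Y s t w - tprod (Y s u) (Y u t) w", OF this]
  show "\<exists>C. \<forall>s u t. 0 \<le> s \<and> s \<le> u \<and> u \<le> t \<and> t \<le> T \<longrightarrow>
        tnorm n (\<lambda>w. Y s t w - tprod (Y s u) (Y u t) w) \<le> C * \<omega> s t powr (real (N + 1) / p)"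
    by simp
next
  fix a b assume ab: "a + b \<le> N"
  show "bigO_ctrl p T \<omega> (N + 1) (\<lambda>s t. ext_norm [a, b]
          (\<lambda>ws. ext_prod [tcomp a (Y s t), tcomp b (Y s t)] ws
               - Delta_sh a b (tcomp (a + b) (Y s t)) ws))"
  proof (rule err_ext_norm)
    fix x y :: "'u list" assume xy: "x \<in> words a" "y \<in> words b"
    have "ext_prod [tcomp a (Y s t), tcomp b (Y s t)] [x, y] - Delta_sh a b (tcomp (a
        + b) (Y s t)) [x, y]
        = Y s t x * Y s t y - (\<Sum>w\<in>words (a + b). Y s t w * shuffle_count x y w)" for s t
      using xy by (simp add: Delta_sh_eq tcomp_def words_iff)
    then show "err (N + 1) (\<lambda>s u t. ext_prod [tcomp a (Y s t), tcomp b (Y s t)] [x, y]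
        - Delta_sh a b (tcomp (a + b) (Y s t)) [x, y])"
      using Y_shuffle_err[OF xy ab] by simp
  qed simp
qed

end

section \<open>The truncated tensor algebra and partitions\<close>

lemma tprod_assoc: "tprod (tprod a b) c = tprod a (tprod b c)"
proof
  fix w :: "'a list"
  let ?n = "length w"
  let ?f = "\<lambda>i j. a (take i w) * b (take j (drop i w)) * c (drop (i + j) w)"
  have "tprod (tprod a b) c w = (\<Sum>k\<le>?n. \<Sum>i\<le>k. ?f i (k - i))"
    unfolding tprod_def sum_distrib_right
  proof (rule sum.cong[OF refl])
    fix k assume k: "k \<in> {..?n}"
    show "(\<Sum>i\<le>length (take k w). a (take i (take k w)) * b (drop i (take k w)) * c (drop k w))
      = (\<Sum>i\<le>k. ?f i (k - i))"
      by (rule sum.cong) (use k in \<open>auto simp: drop_take min_def\<close>)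
  qed
  also have "\<dots> = (\<Sum>(k, i)\<in>(SIGMA k:{..?n}. {..k}). ?f i (k - i))"
    by (rule sum.Sigma) auto
  also have "\<dots> = (\<Sum>(i, j)\<in>(SIGMA i:{..?n}. {..?n - i}). ?f i j)"
    by (rule sum.reindex_bij_witness[where i = "\<lambda>(i, j). (i + j, i)" and j = "\<lambda>(k, i). (i, k
        - i)"]) auto
  also have "\<dots> = (\<Sum>i\<le>?n. \<Sum>j\<le>?n - i. ?f i j)"
    by (rule sum.Sigma[symmetric]) auto
  also have "\<dots> = tprod a (tprod b c) w"
    unfolding tprod_def sum_distrib_left
    by (intro sum.cong refl) (auto simp: mult.assoc add.commute)
  finally show "tprod (tprod a b) c w = tprod a (tprod b c) w" .
qed

lemma tprod_tone [simp]: "tprod tone a = a" "tprod a tone = a"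
proof -
  have "tprod tone a w = (\<Sum>i\<le>length w. of_bool (i = 0) * a (drop i w))" for w
    unfolding tprod_def by (rule sum.cong) (auto simp: tone_def)
  then show "tprod tone a = a" by (simp add: sum_of_bool_mult fun_eq_iff)
  have "tprod a tone w = (\<Sum>i\<le>length w. of_bool (i = length w) * a (take i w))" for w
    unfolding tprod_def by (rule sum.cong) (auto simp: tone_def)
  then show "tprod a tone = a" by (simp add: sum_of_bool_mult fun_eq_iff)
qed

lemma tprod_Nil [simp]: "tprod a b [] = a [] * b []"
  by (simp add: tprod_def)

lemma tprod_diff_left: "tprod (\<lambda>w. a w - b w) c = (\<lambda>w. tprod a c w - tprod b c w)"
  by (simp add: tprod_def left_diff_distrib sum_subtractf)

lemma tprod_diff_right: "tprod a (\<lambda>w. b w - c w) = (\<lambda>w. tprod a b w - tprod a c w)"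
  by (simp add: tprod_def right_diff_distrib sum_subtractf)

text \<open>The sum norm is submultiplicative with constant 1, and it does not see coefficients
  above level \<open>n\<close>, so products may be formed without truncation.\<close>

definition coeff_norm :: "nat \<Rightarrow> 'v::euclidean_space tensor \<Rightarrow> real" where
  "coeff_norm n a = (\<Sum>w\<in>words_upto n. \<bar>a w\<bar>)"

lemma coeff_norm_nonneg [simp]: "0 \<le> coeff_norm n a"
  by (simp add: coeff_norm_def sum_nonneg)

lemma coeff_norm_add: "coeff_norm n (\<lambda>w. a w + b w) \<le> coeff_norm n a + coeff_norm n b"
  unfolding coeff_norm_def sum.distrib[symmetric] by (rule sum_mono) (rule abs_triangle_ineq)

lemma coeff_norm_diff_commute: "coeff_norm n (\<lambda>w. a w - b w) = coeff_norm n (\<lambda>w. b w - a w)"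
  by (simp add: coeff_norm_def abs_minus_commute)

lemma coeff_norm_triangle:
  "coeff_norm n (\<lambda>w. a w - c w) \<le> coeff_norm n (\<lambda>w. a w - b w) + coeff_norm n (\<lambda>w. b w - c w)"
  using coeff_norm_add[of n "\<lambda>w. a w - b w" "\<lambda>w. b w - c w"] by simp

lemma coeff_norm_le_add_diff: "coeff_norm n a \<le> coeff_norm n b + coeff_norm n (\<lambda>w. a w - b w)"
  using coeff_norm_add[of n b "\<lambda>w. a w - b w"] by simp

lemma abs_le_coeff_norm: "w \<in> words_upto n \<Longrightarrow> \<bar>a w\<bar> \<le> coeff_norm n a"
  unfolding coeff_norm_def by (rule member_le_sum) auto

lemma coeff_norm_0: "coeff_norm 0 a = \<bar>a []\<bar>"
proof -
  have "words_upto 0 = {[] :: 'a list}" by (auto simp: words_upto_iff)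
  then show ?thesis by (simp add: coeff_norm_def)
qed

text \<open>Only words of length at most \<open>k\<close> and \<open>l\<close> can contribute. The
  levels may be below \<open>n\<close>: if one factor has no part of degree \<open>0\<close>, the
  other enters only below the top degree.\<close>

lemma coeff_norm_tprod_le:
  assumes "\<And>x y. x \<in> words_upto n \<Longrightarrow> y \<in> words_upto n \<Longrightarrow> length x + length y \<le> n \<Longrightarrow>
    a x \<noteq> 0 \<Longrightarrow> b y \<noteq> 0 \<Longrightarrow> length x \<le> k \<and> length y \<le> l"
  shows "coeff_norm n (tprod a b) \<le> coeff_norm k a * coeff_norm l b"
proof -
  let ?S = "{(x, y). x \<in> words_upto n \<and> y \<in> words_upto n \<and> length x + length y \<le> n}"
  let ?f = "\<lambda>(x, y). \<bar>a x\<bar> * \<bar>b y\<bar>"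
  have "finite ?S"
    by (rule finite_subset[of _ "words_upto n \<times> words_upto n"]) auto
  have "coeff_norm n (tprod a b) \<le> (\<Sum>w\<in>words_upto n. \<Sum>i\<le>length w. \<bar>a (take i w)\<bar> * \<bar>b (drop i w)\<bar>)"
    unfolding coeff_norm_def tprod_def abs_mult[symmetric]
    by (intro sum_mono sum_abs)
  also have "\<dots> = sum ?f ?S"
    using sum_words_upto_cut[of "\<lambda>x y. \<bar>a x\<bar> * \<bar>b y\<bar>"] by simp
  also have "\<dots> = sum ?f {z \<in> ?S. ?f z \<noteq> 0}"
    by (rule sum.mono_neutral_right) (use \<open>finite ?S\<close> in auto)
  also have "\<dots> \<le> sum ?f (words_upto k \<times> words_upto l)"
  proof (rule sum_mono2)
    show "{z \<in> ?S. ?f z \<noteq> 0} \<subseteq> words_upto k \<times> words_upto l"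
      using assms by (auto simp: words_upto_iff)
  qed auto
  also have "\<dots> = coeff_norm k a * coeff_norm l b"
    unfolding coeff_norm_def sum_product by (simp add: sum.cartesian_product)
  finally show ?thesis .
qed

lemma coeff_norm_tprod: "coeff_norm n (tprod a b) \<le> coeff_norm n a * coeff_norm n b"
  by (rule coeff_norm_tprod_le) (auto simp: words_upto_iff)

lemma coeff_norm_tprod_left:
  "a [] = 0 \<Longrightarrow> coeff_norm (Suc n) (tprod a b) \<le> coeff_norm (Suc n) a * coeff_norm n b"
proof (rule coeff_norm_tprod_le)
  fix x y assume "a [] = 0" "x \<in> words_upto (Suc n)" "y \<in> words_upto (Suc n)"
    "length x + length y \<le> Suc n" "a x \<noteq> 0" "b y \<noteq> 0"
  moreover from this have "x \<noteq> []" by auto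
  ultimately show "length x \<le> Suc n \<and> length y \<le> n"
    by (cases x) (auto simp: words_upto_iff)
qed

lemma coeff_norm_tprod_right:
  "b [] = 0 \<Longrightarrow> coeff_norm (Suc n) (tprod a b) \<le> coeff_norm n a * coeff_norm (Suc n) b"
proof (rule coeff_norm_tprod_le)
  fix x y assume "b [] = 0" "x \<in> words_upto (Suc n)" "y \<in> words_upto (Suc n)"
    "length x + length y \<le> Suc n" "a x \<noteq> 0" "b y \<noteq> 0"
  moreover from this have "y \<noteq> []" by auto
  ultimately show "length x \<le> n \<and> length y \<le> Suc n"
    by (cases y) (auto simp: words_upto_iff)
qed

text \<open>Without truncation, associativity and the factorization at a point of the partition are
  plain identities; one truncation of the result gives \<open>partition_prod\<close>.\<close>

fun path_prod :: "(real \<Rightarrow> real \<Rightarrow> 'v tensor) \<Rightarrow> real list \<Rightarrow> 'v tensor" where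
  "path_prod F (u # v # ts) = tprod (F u v) (path_prod F (v # ts))"
| "path_prod F _ = tone"

lemma path_prod_append: "path_prod F (xs @ u # ys) = tprod (path_prod F (xs @ [u])) (path_prod F (u
    # ys))"
proof (induction xs)
  case (Cons a xs)
  then show ?case by (cases xs) (auto simp: tprod_assoc)
qed simp

lemma ttrunc_tprod_ttrunc: "ttrunc N (tprod a (ttrunc N b)) = ttrunc N (tprod a b)"
  by (auto simp: ttrunc_def tprod_def fun_eq_iff intro!: sum.cong)

lemma partition_prod_eq_path_prod: "partition_prod N F ts = ttrunc N (path_prod F ts)"
proof (induction ts rule: induct_list012)
  case (3 x y zs)
  then show ?case by (simp add: ttrunc_tprod_ttrunc)
qed (auto simp: ttrunc_def tone_def fun_eq_iff)

section \<open>Partitions, refinements and mesh\<close>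

lemma partition_of_bounds: "partition_of s t ts \<Longrightarrow> x \<in> set ts \<Longrightarrow> s \<le> x \<and> x \<le> t"
proof
  assume *: "partition_of s t ts" "x \<in> set ts"
  then show "s \<le> x" by (cases ts) (auto simp: partition_of_def)
  show "x \<le> t" using * by (cases ts rule: rev_cases) (auto simp: partition_of_def sorted_wrt_append)
qed

lemma partition_of_Cons: "partition_of s t (x # y # ts) \<longleftrightarrow> x = s \<and> s < y \<and> partition_of y t (y # ts)"
  by (auto simp: partition_of_def)

lemma partition_of_single: "partition_of s t [x] \<longleftrightarrow> x = s \<and> x = t"
  by (auto simp: partition_of_def)

lemma partition_of_append:
  "partition_of s t (xs @ u # ys) \<longleftrightarrow> partition_of s u (xs @ [u]) \<and> partition_of u t (u # ys)"
  by (cases xs) (auto simp: partition_of_def sorted_wrt_append, meson less_trans)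

lemma partition_of_remove:
  "partition_of s t (xs @ a # b # c # ys) \<Longrightarrow> partition_of s t (xs @ a # c # ys)"
  by (cases xs) (auto simp: partition_of_def sorted_wrt_append)

lemma partition_ofI:
  assumes "sorted_wrt (<) ts" "s \<in> set ts" "t \<in> set ts" "\<And>x. x \<in> set ts \<Longrightarrow> s \<le> x \<and> x \<le> t"
  shows "partition_of s t ts"
proof -
  have "ts \<noteq> []" using assms(2) by auto
  moreover from this have "hd ts = s"
    using assms by (cases ts) force+
  moreover have "last ts = t"
    using assms \<open>ts \<noteq> []\<close> by (cases ts rule: rev_cases) (force simp: sorted_wrt_append)+
  ultimately show ?thesis using assms(1) by (simp add: partition_of_def)
qed

text \<open>A condition on consecutive points rather than on a maximum, so that concatenated
  partitions inherit it directly.\<close>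

definition mesh_below :: "real \<Rightarrow> real list \<Rightarrow> bool" where
  "mesh_below \<delta> ts \<longleftrightarrow> successively (\<lambda>a b. b - a < \<delta>) ts"

lemma mesh_below_append: "mesh_below \<delta> (xs @ [u]) \<Longrightarrow> mesh_below \<delta> (u # ys) \<Longrightarrow>
    mesh_below \<delta> (xs @ u # ys)"
  by (auto simp: mesh_below_def successively_append_iff)

lemma mesh_below_mono: "mesh_below \<delta> ts \<Longrightarrow> \<delta> \<le> \<delta>' \<Longrightarrow> mesh_below \<delta>' ts"
  unfolding mesh_below_def by (erule successively_mono) auto

lemma mesh_belowI: "mesh ts < \<delta> \<Longrightarrow> mesh_below \<delta> ts"
  unfolding mesh_below_def successively_conv_nth
proof (intro allI impI)
  fix i assume m: "mesh ts < \<delta>" and i: "Suc i < length ts"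
  have "{ts ! Suc i - ts ! i |i. Suc i < length ts} = (\<lambda>i. ts ! Suc i - ts ! i) ` {i. Suc i < length
      ts}"
    by auto
  moreover have "finite {i. Suc i < length ts}"
    by (rule finite_subset[of _ "{..length ts}"]) auto
  ultimately have "finite (insert 0 {ts ! Suc i - ts ! i |i. Suc i < length ts})" by simp
  moreover have "ts ! Suc i - ts ! i \<in> insert 0 {ts ! Suc i - ts ! i |i. Suc i < length ts}"
    using i by auto
  ultimately have "ts ! Suc i - ts ! i \<le> mesh ts"
    unfolding mesh_def by (rule Max_ge)
  with m show "ts ! Suc i - ts ! i < \<delta>" by simp
qed

lemma mesh_below_partition_exists:
  assumes "s \<le> t" "0 < \<delta>"
  obtains ts where "partition_of s t ts" "mesh_below \<delta> ts"
proof -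
  \<comment> \<open>Induction on the number of steps of length \<open>\<delta> / 2\<close>. The half
    leaves room for the strict inequality, and a remainder below \<open>\<delta>\<close> is taken as
    one interval.\<close>
  have "\<exists>ts. partition_of s t ts \<and> mesh_below \<delta> ts" if "s \<le> t" "t - s \<le> real n * (\<delta> / 2)" for n s
    using that
  proof (induction n arbitrary: s)
    case 0
    then have "partition_of s t [s] \<and> mesh_below \<delta> [s]"
      by (simp add: partition_of_single mesh_below_def)
    then show ?case ..
  next
    case (Suc n)
    consider "s = t" | "s < t" "t - s < \<delta>" | "\<delta> \<le> t - s" using Suc.prems by linarith
    then show ?case
    proof cases
      case 1
      then have "partition_of s t [s] \<and> mesh_below \<delta> [s]"
        by (simp add: partition_of_single mesh_below_def)
      then show ?thesis ..
    next
      case 2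
      then have "partition_of s t [s, t] \<and> mesh_below \<delta> [s, t]"
        by (simp add: partition_of_def mesh_below_def)
      then show ?thesis ..
    next
      case 3
      have "s + \<delta> / 2 \<le> t" "t - (s + \<delta> / 2) \<le> real n * (\<delta> / 2)"
        using 3 Suc.prems assms by (auto simp: algebra_simps)
      from Suc.IH[OF this] obtain ts where ts: "partition_of (s + \<delta> / 2) t ts" "mesh_below \<delta> ts"
          by blast
      then obtain ts' where "ts = (s + \<delta> / 2) # ts'"
        by (cases ts) (auto simp: partition_of_def)
      with ts have "partition_of s t (s # ts) \<and> mesh_below \<delta> (s # ts)"
        using assms by (auto simp: partition_of_Cons mesh_below_def)
      then show ?thesis ..
    qed
  qed
  moreover obtain n where "(t - s) / (\<delta> / 2) \<le> real n" using real_arch_simple by blast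
  then have "t - s \<le> real n * (\<delta> / 2)" using assms by (simp add: field_simps)
  ultimately show thesis using assms that by blast
qed

section \<open>The maximal inequality\<close>

locale sewing = control_setting +
  fixes Y :: "real \<Rightarrow> real \<Rightarrow> 'u::euclidean_space tensor"
  assumes Y: "almost_rough_path p T \<omega> Y"
begin

abbreviation N where "N \<equiv> level p"

text \<open>This is the exponent \<theta>; it exceeds 1 because \<open>N\<close> is the integer part
  of \<open>p\<close>.\<close>

definition expo :: real where "expo = real (Suc N) / p"

lemma expo_gt_1: "1 < expo"
proof -
  have "p < real (Suc N)" using p_ge_1 by (simp add: level_def) linarith
  then show ?thesis using p_ge_1 by (simp add: expo_def)
qed

definition W :: "real \<Rightarrow> real \<Rightarrow> real" where "W s t = \<omega> s t powr expo"

lemma W_eq: "scale s t ^ Suc N = W s t"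
  unfolding W_def expo_def by (rule scale_power) simp

lemma W_nonneg [simp]: "0 \<le> W s t"
  by (simp add: W_def)

lemma W_mono: "\<lbrakk>0 \<le> s; s \<le> s'; s' \<le> t'; t' \<le> t; t \<le> T\<rbrakk> \<Longrightarrow> W s' t' \<le> W s t"
  unfolding W_eq[symmetric] by (intro power_mono scale_mono) auto

text \<open>A partition of some subinterval of \<open>[0, T]\<close>, with the endpoints read off as
  \<open>hd\<close> and \<open>last\<close>, so that lists can be cut without renaming
  endpoints.\<close>

definition admissible :: "real list \<Rightarrow> bool" where
  "admissible ts \<longleftrightarrow> ts \<noteq> [] \<and> sorted_wrt (<) ts \<and> set ts \<subseteq> {0..T}"

lemma partition_of_admissible: "partition_of s t ts \<Longrightarrow> 0 \<le> s \<Longrightarrow> t \<le> T \<Longrightarrow> admissible ts"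
  using partition_of_bounds[of s t ts] by (force simp: admissible_def partition_of_def)

lemma admissible_partition_of: "admissible ts \<Longrightarrow> partition_of (hd ts) (last ts) ts"
  by (simp add: admissible_def partition_of_def)

lemma admissible_bounds:
  assumes "admissible ts"
  shows "0 \<le> hd ts" "hd ts \<le> last ts" "last ts \<le> T"
proof -
  have "ts \<noteq> []" "set ts \<subseteq> {0..T}" using assms by (simp_all add: admissible_def)
  then have "hd ts \<in> {0..T}" "last ts \<in> {0..T}" by (meson hd_in_set last_in_set subsetD)+
  then show "0 \<le> hd ts" "last ts \<le> T" by auto
  show "hd ts \<le> last ts"
    using partition_of_bounds[OF admissible_partition_of[OF assms], of "last ts"] \<open>ts \<noteq> []\<close> by simp
qed

lemma admissible_append1: "admissible (xs @ u # ys) \<Longrightarrow> admissible (xs @ [u])"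
  by (auto simp: admissible_def sorted_wrt_append)

lemma admissible_append2: "admissible (xs @ u # ys) \<Longrightarrow> admissible (u # ys)"
  by (auto simp: admissible_def sorted_wrt_append)

section \<open>Uniform bounds for the almost rough path\<close>

lemma err_coeff_norm:
  assumes "\<And>w. w \<in> words_upto n \<Longrightarrow> err k (f w)"
  obtains C where "0 \<le> C" "\<And>s u t. \<lbrakk>0 \<le> s; s \<le> u; u \<le> t; t \<le> T\<rbrakk> \<Longrightarrow>
    coeff_norm n (\<lambda>w. f w s u t) \<le> C * scale s t ^ k"
proof -
  have "err k (\<lambda>s u t. coeff_norm n (\<lambda>w. f w s u t))"
    unfolding coeff_norm_def by (intro err_sum err_abs assms)
  then obtain C where "0 \<le> C" "\<And>s u t. \<lbrakk>0 \<le> s; s \<le> u; u \<le> t; t \<le> T\<rbrakk> \<Longrightarrow>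
      \<bar>coeff_norm n (\<lambda>w. f w s u t)\<bar> \<le> C * scale s t ^ k"
    by (rule errE) (rule that; assumption)
  then show thesis using that by auto
qed

lemma Y_regular: "regular_tensor_map p T \<omega> Y"
  using Y by (simp add: almost_rough_path_def)

lemma Y_Nil: "\<lbrakk>0 \<le> s; s \<le> t; t \<le> T\<rbrakk> \<Longrightarrow> Y s t [] = 1"
  using Y_regular by (auto simp: regular_tensor_map_def simplex2_def tcomp_0_eq_tone)

lemma Y_eq_0: "\<lbrakk>0 \<le> s; s \<le> t; t \<le> T\<rbrakk> \<Longrightarrow> w \<notin> words_upto N \<Longrightarrow> Y s t w = 0"
  using Y_regular by (auto simp: regular_tensor_map_def simplex2_def trunc_space_def)

text \<open>The control vanishes on the diagonal, so regularity leaves only the part of degree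
  \<open>0\<close>.\<close>

lemma Y_diag:
  assumes "0 \<le> t" "t \<le> T"
  shows "Y t t = tone"
proof
  fix w
  obtain C where C: "\<And>s u t. \<lbrakk>0 \<le> s; s \<le> u; u \<le> t; t \<le> T\<rbrakk> \<Longrightarrow> \<bar>Y s t w\<bar> \<le> C * scale s t ^ length w"
    using regular_tensor_map_err[OF Y_regular] by (rule errE) (rule that; assumption)
  show "Y t t w = tone w"
    using C[of t t t] assms by (cases w) (auto simp: Y_Nil tone_def scale_def control_diag)
qed

lemma Y_bound:
  obtains B where "0 \<le> B" "\<And>s t. \<lbrakk>0 \<le> s; s \<le> t; t \<le> T\<rbrakk> \<Longrightarrow> coeff_norm n (Y s t) \<le> B"
proof -
  have "err 0 (\<lambda>s u t. Y s t w)" for w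
    using regular_tensor_map_err[OF Y_regular] by (rule err_mono) simp
  then obtain C where C: "0 \<le> C" "\<And>s u t. \<lbrakk>0 \<le> s; s \<le> u; u \<le> t; t \<le> T\<rbrakk> \<Longrightarrow>
    coeff_norm n (\<lambda>w. Y s t w) \<le> C * scale s t ^ 0"
    by (rule err_coeff_norm) (rule that; assumption)
  show thesis
    by (rule that[OF C(1)]) (use C(2) in auto)
qed

lemma Y_mult_bound:
  assumes "n \<le> N"
  obtains C where "0 \<le> C" "\<And>s u t. \<lbrakk>0 \<le> s; s \<le> u; u \<le> t; t \<le> T\<rbrakk> \<Longrightarrow>
    coeff_norm n (\<lambda>w. tprod (Y s u) (Y u t) w - Y s t w) \<le> C * W s t"
proof -
  have "err (Suc N) (\<lambda>s u t. tprod (Y s u) (Y u t) w - Y s t w)" if w: "w \<in> words_upto n" for w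
  proof -
    have "length w \<le> N" using w assms by (simp add: words_upto_iff)
    moreover have "\<forall>n\<le>N. \<exists>C. \<forall>s u t. 0 \<le> s \<and> s \<le> u \<and> u \<le> t \<and> t \<le> T \<longrightarrow>
        tnorm n (\<lambda>w. Y s t w - tprod (Y s u) (Y u t) w) \<le> C * \<omega> s t powr (real (N + 1) / p)"
      using Y unfolding almost_rough_path_def by (elim conjE)
    ultimately obtain C where C: "\<forall>s u t. 0 \<le> s \<and> s \<le> u \<and> u \<le> t \<and> t \<le> T \<longrightarrow>
        tnorm (length w) (\<lambda>w. Y s t w - tprod (Y s u) (Y u t) w) \<le> C * \<omega> s t powr (real (N
            + 1) / p)"
      by blast
    show ?thesis
    proof (rule errI)
      fix s u t assume *: "0 \<le> s" "s \<le> u" "u \<le> t" "t \<le> T"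
      have "\<bar>Y s t w - tprod (Y s u) (Y u t) w\<bar> \<le> C * W s t"
        using C[rule_format, of s u t] * abs_le_tnorm[of w "length w"
            "\<lambda>w. Y s t w - tprod (Y s u) (Y u t) w"] w
        by (simp add: W_def expo_def words_upto_iff words_iff)
      then show "\<bar>tprod (Y s u) (Y u t) w - Y s t w\<bar> \<le> C * scale s t ^ Suc N"
        by (simp add: W_eq abs_minus_commute del: power_Suc)
    qed
  qed
  then obtain C where C: "0 \<le> C" "\<And>s u t. \<lbrakk>0 \<le> s; s \<le> u; u \<le> t; t \<le> T\<rbrakk> \<Longrightarrow>
      coeff_norm n (\<lambda>w. tprod (Y s u) (Y u t) w - Y s t w) \<le> C * scale s t ^ Suc N"
    by (rule err_coeff_norm[where f = "\<lambda>w s u t. tprod (Y s u) (Y u t) w - Y s t w"])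
      (assumption | rule that)+
  show thesis
    by (rule that[OF C(1)]) (use C(2) in \<open>simp only: W_eq\<close>)
qed

text \<open>The intervals \<open>[a, c]\<close> around interior points fall into two non-overlapping
  families, starting at the first and at the second point. Superadditivity bounds their totals by
  the two terms on the right; each induction step exchanges the families.\<close>

lemma long_partition_has_short_gap_aux:
  assumes "admissible ts" "3 \<le> length ts" "\<And>xs a b c ys. ts = xs @ a # b # c # ys \<Longrightarrow> \<kappa> < \<omega> a c"
  shows "\<kappa> * real (length ts - 2) < \<omega> (hd ts) (last ts) + \<omega> (ts ! 1) (last ts)"
  using assms
proof (induction ts rule: induct_list012)
  case (3 a b ys')
  obtain c ys where ys': "ys' = c # ys" using "3.prems"(2) by (cases ys') auto
  have ac: "\<kappa> < \<omega> a c" using "3.prems"(3)[of "[]"] ys' by simp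
  have ord: "0 \<le> a" "a < b" "b < c" "c \<le> last (c # ys)" "last (c # ys) \<le> T"
    using "3.prems"(1) admissible_bounds[OF admissible_append2[of "[a, b]" c ys]]
    by (auto simp: admissible_def ys')
  have ad: "admissible (b # c # ys)"
    using "3.prems"(1) admissible_append2[of "[a]"] by (simp add: ys')
  show ?case
  proof (cases ys)
    case Nil
    then show ?thesis using ac ord control_nonneg[of b c] by (simp add: ys')
  next
    case (Cons d zs)
    have "\<kappa> * real (length (b # c # ys) - 2) < \<omega> b (last (c # ys)) + \<omega> c (last (c # ys))"
    proof -
      have "\<kappa> < \<omega> x z" if "b # ys' = xs @ x # y # z # zs" for xs x y z zs
        using "3.prems"(3)[of "a # xs" x y z zs] that by simp
      then show ?thesis
        using "3.IH"(2) ad by (simp add: ys' Cons)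
    qed
    moreover have "\<omega> a c + \<omega> c (last (c # ys)) \<le> \<omega> a (last (c # ys))"
      using ord by (intro control_superadditive) auto
    ultimately show ?thesis
      using ac by (simp add: ys' Cons algebra_simps)
  qed
qed auto

text \<open>Young's pigeonhole argument: there are \<open>length ts - 2\<close> interior points, and
  the intervals around them have total control at most twice that of the whole interval.\<close>

lemma long_partition_has_short_gap:
  assumes "admissible ts" "3 \<le> length ts"
  obtains xs a b c ys where "ts = xs @ a # b # c # ys"
    "\<omega> a c \<le> 2 * \<omega> (hd ts) (last ts) / real (length ts - 2)"
proof (rule ccontr)
  let ?\<kappa> = "2 * \<omega> (hd ts) (last ts) / real (length ts - 2)"
  note short = that
  assume no: "\<not> thesis"
  have "?\<kappa> < \<omega> a c" if ts: "ts = xs @ a # b # c # ys" for xs a b c ys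
  proof (rule ccontr)
    assume "\<not> ?\<kappa> < \<omega> a c"
    then have thesis by (intro short[OF ts]) simp
    with no show False by blast
  qed
  then have "?\<kappa> * real (length ts - 2) < \<omega> (hd ts) (last ts) + \<omega> (ts ! 1) (last ts)"
    by (rule long_partition_has_short_gap_aux[OF assms])
  moreover have "\<omega> (ts ! 1) (last ts) \<le> \<omega> (hd ts) (last ts)"
  proof -
    have "ts ! 1 \<in> set ts" using assms(2) by (intro nth_mem) simp
    then have "hd ts \<le> ts ! 1 \<and> ts ! 1 \<le> last ts"
      using partition_of_bounds[OF admissible_partition_of[OF assms(1)]] by blast
    then show ?thesis using admissible_bounds[OF assms(1)] by (intro control_mono) auto
  qed
  ultimately show False using assms(2) by simp
qed

lemma path_prod_Nil: "admissible ts \<Longrightarrow> path_prod Y ts [] = 1"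
proof (induction ts rule: induct_list012)
  case (3 x y zs)
  then show ?case
    using admissible_append2[of "[x]" y zs] by (auto simp: Y_Nil admissible_def)
qed (auto simp: tone_def)

lemma path_prod_remove:
  "path_prod F (xs @ a # b # c # ys) w - path_prod F (xs @ a # c # ys) w
    = tprod (path_prod F (xs @ [a])) (tprod (\<lambda>w. tprod (F a b) (F b c) w - F a c w) (path_prod F (c
        # ys))) w"
  unfolding path_prod_append[of F xs a "b # c # ys"] path_prod_append[of F xs a "c # ys"]
    tprod_diff_left tprod_diff_right by (simp add: tprod_assoc)

text \<open>The defect \<open>Y\<^sub>a\<^sub>b \<otimes> Y\<^sub>b\<^sub>c - Y\<^sub>a\<^sub>c\<close> has no component of degree
  \<open>0\<close>, so at level \<open>Suc n\<close> the remaining factors only enter through levels \<open>\<le> n\<close>, which are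
  bounded by induction.\<close>

lemma path_prod_bound:
  assumes "n \<le> N"
  shows "\<exists>K\<ge>0. \<forall>ts. admissible ts \<longrightarrow>
    coeff_norm n (\<lambda>w. path_prod Y ts w - Y (hd ts) (last ts) w) \<le> K * W (hd ts) (last ts)"
  using assms
proof (induction n)
  case 0
  have "coeff_norm 0 (\<lambda>w. path_prod Y ts w - Y (hd ts) (last ts) w) = 0" if "admissible ts" for ts
    using that admissible_bounds[OF that] by (simp add: coeff_norm_0 path_prod_Nil Y_Nil)
  then show ?case by (intro exI[of _ 0]) auto
next
  case (Suc n)
  then obtain K where K: "0 \<le> K" "\<And>ts. admissible ts \<Longrightarrow>
    coeff_norm n (\<lambda>w. path_prod Y ts w - Y (hd ts) (last ts) w) \<le> K * W (hd ts) (last ts)"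
    by auto
  obtain B where B: "0 \<le> B" "\<And>s t. \<lbrakk>0 \<le> s; s \<le> t; t \<le> T\<rbrakk> \<Longrightarrow> coeff_norm n (Y s t) \<le> B"
    using Y_bound[of n] by metis
  obtain C where C: "0 \<le> C" "\<And>s u t. \<lbrakk>0 \<le> s; s \<le> u; u \<le> t; t \<le> T\<rbrakk> \<Longrightarrow>
    coeff_norm (Suc n) (\<lambda>w. tprod (Y s u) (Y u t) w - Y s t w) \<le> C * W s t"
    using Y_mult_bound[OF Suc.prems] by metis
  \<comment> \<open>By the induction hypothesis, products over arbitrary partitions are bounded at
    level \<open>n\<close>, independently of the partition.\<close>
  define M where "M = B + K * W 0 T"
  have M: "0 \<le> M" "coeff_norm n (path_prod Y ts) \<le> M" if ts: "admissible ts" for ts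
  proof -
    have "coeff_norm n (path_prod Y ts) \<le> coeff_norm n (Y (hd ts) (last ts))
        + coeff_norm n (\<lambda>w. path_prod Y ts w - Y (hd ts) (last ts) w)"
      by (rule coeff_norm_le_add_diff)
    also have "\<dots> \<le> B + K * W (hd ts) (last ts)"
      using B(2) K(2)[OF ts] admissible_bounds[OF ts] by (intro add_mono) auto
    also have "\<dots> \<le> M"
      unfolding M_def using K(1) admissible_bounds[OF ts] by (intro add_left_mono mult_left_mono
          W_mono) auto
    finally show "coeff_norm n (path_prod Y ts) \<le> M" .
    then show "0 \<le> M" using coeff_norm_nonneg order_trans by blast
  qed
  \<comment> \<open>Removing a point from a partition with \<open>k\<close> interior points costs a
    multiple of \<open>real k powr - expo\<close>, by the choice of the point. The costs add up to a
    partial sum of a series that converges because \<open>expo\<close> exceeds 1.\<close>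
  define S where "S = (\<lambda>m. \<Sum>k<m. real (Suc k) powr - expo)"
  have sm: "summable (\<lambda>k. real (Suc k) powr - expo)"
    using summable_Suc_iff[of "\<lambda>k. real k powr - expo"] summable_real_powr_iff[of "- expo"]
        expo_gt_1 by simp
  let ?A = "\<lambda>ts. M * (C * 2 powr expo) * M * W (hd ts) (last ts)"
  have claim: "coeff_norm (Suc n) (\<lambda>w. path_prod Y ts w - Y (hd ts) (last ts) w)
      \<le> ?A ts * S (length ts - 2)"
    if "admissible ts" for ts
    using that
  proof (induction "length ts" arbitrary: ts rule: less_induct)
    case (less ts)
    consider s where "ts = [s]" | s t where "ts = [s, t]" | "3 \<le> length ts"
      using less.prems by (cases ts rule: remdups_adj.cases; cases "tl (tl ts)") (auto simp:
          admissible_def)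
    then show ?case
    proof cases
      case (1 s)
      then show ?thesis using less.prems
        by (simp add: Y_diag admissible_def S_def) (simp add: coeff_norm_def)
    next
      case (2 s t)
      then show ?thesis by (simp add: S_def) (simp add: coeff_norm_def)
    next
      case 3
      obtain xs a b c ys where ts: "ts = xs @ a # b # c # ys"
        and short: "\<omega> a c \<le> 2 * \<omega> (hd ts) (last ts) / real (length ts - 2)"
        using long_partition_has_short_gap[OF less.prems 3] by metis
      define ts' where "ts' = xs @ a # c # ys"
      have ends: "hd ts' = hd ts" "last ts' = last ts"
        by (cases xs; simp add: ts ts'_def)+
      have ad': "admissible ts'"
        using partition_of_remove[of "hd ts" "last ts" xs a b c ys] less.prems
          admissible_partition_of[OF less.prems] admissible_bounds[OF less.prems]
        by (auto intro: partition_of_admissible simp: ts ts'_def)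
      have abc: "0 \<le> a" "a \<le> b" "b \<le> c" "c \<le> T"
        using less.prems by (auto simp: ts admissible_def sorted_wrt_append)
      have ad: "admissible (xs @ [a])" "admissible (c # ys)"
        using less.prems admissible_append1[of xs a] admissible_append2[of "xs @ [a, b]" c]
        by (auto simp: ts)
      let ?D = "\<lambda>w. tprod (Y a b) (Y b c) w - Y a c w"
      let ?L = "length ts - 2"
      have D0: "?D [] = 0" using abc by (simp add: Y_Nil)
      have "W a c \<le> (2 * \<omega> (hd ts) (last ts) / real ?L) powr expo"
        unfolding W_def using short abc expo_gt_1 control_nonneg[of a c] by (intro powr_mono2) auto
      also have "\<dots> = 2 powr expo * W (hd ts) (last ts) * real ?L powr - expo"
        using 3 admissible_bounds[OF less.prems] control_nonneg[of "hd ts" "last ts"]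
        by (simp add: powr_divide powr_mult powr_minus_divide W_def)
      finally have Wac: "W a c \<le> 2 powr expo * W (hd ts) (last ts) * real ?L powr - expo" .
      have "coeff_norm (Suc n) (\<lambda>w. path_prod Y ts w - path_prod Y ts' w)
          \<le> coeff_norm n (path_prod Y (xs @ [a])) * coeff_norm (Suc n) (tprod ?D (path_prod Y (c #
              ys)))"
        unfolding ts ts'_def path_prod_remove by (rule coeff_norm_tprod_right) (use abc in \<open>simp
            add: Y_Nil\<close>)
      also have "\<dots> \<le> M * (coeff_norm (Suc n) ?D * coeff_norm n (path_prod Y (c # ys)))"
        using M ad by (intro mult_mono coeff_norm_tprod_left D0) auto
      also have "\<dots> \<le> M * ((C * W a c) * M)"
        using M ad C abc by (intro mult_left_mono mult_mono) auto
      also have "\<dots> \<le> M * ((C * (2 powr expo * W (hd ts) (last ts) * real ?L powr - expo)) * M)"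
        using M(1)[OF ad'] C(1) Wac by (intro mult_left_mono mult_right_mono) auto
      finally have 1: "coeff_norm (Suc n) (\<lambda>w. path_prod Y ts w - path_prod Y ts' w)
          \<le> ?A ts * real ?L powr - expo" by (simp add: mult_ac)
      have len: "length ts' - 2 = ?L - 1" "length ts' < length ts" by (simp_all add: ts ts'_def)
      have "coeff_norm (Suc n) (\<lambda>w. path_prod Y ts' w - Y (hd ts) (last ts) w) \<le> ?A ts * S (?L - 1)"
        using less.hyps[OF len(2) ad'] by (simp add: ends len)
      with 1 have "coeff_norm (Suc n) (\<lambda>w. path_prod Y ts w - Y (hd ts) (last ts) w)
          \<le> ?A ts * (real ?L powr - expo + S (?L - 1))"
        using coeff_norm_triangle[of "Suc n" "path_prod Y ts" "Y (hd ts) (last ts)"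
            "path_prod Y ts'"]
        unfolding distrib_left by linarith
      also have "real ?L powr - expo + S (?L - 1) = S ?L"
      proof -
        obtain m where "?L = Suc m" using 3 by (cases ?L) auto
        then show ?thesis by (simp add: S_def)
      qed
      finally show ?thesis .
    qed
  qed
  have "?A ts * S m \<le> M * (C * 2 powr expo) * M * (\<Sum>k. real (Suc k) powr - expo) * W (hd ts) (last
      ts)"
    if "admissible ts" for ts m
  proof -
    have "S m \<le> (\<Sum>k. real (Suc k) powr - expo)"
      unfolding S_def by (rule sum_le_suminf[OF sm]) auto
    then have "?A ts * S m \<le> ?A ts * (\<Sum>k. real (Suc k) powr - expo)"
      using M(1)[OF that] C(1) by (intro mult_left_mono) auto
    then show ?thesis by (simp add: mult_ac)
  qed
  \<comment> \<open>The absolute value makes the constant visibly nonnegative without reference to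
    \<open>ts\<close>, since \<open>M(1)\<close> is stated for an admissible list.\<close>
  with claim have "coeff_norm (Suc n) (\<lambda>w. path_prod Y ts w - Y (hd ts) (last ts) w)
      \<le> \<bar>M * (C * 2 powr expo) * M * (\<Sum>k. real (Suc k) powr - expo)\<bar> * W (hd ts) (last ts)"
    if "admissible ts" for ts
    using that by (meson W_nonneg abs_ge_self mult_right_mono order_trans)
  then show ?case using abs_ge_zero by blast
qed

section \<open>Convergence as the mesh vanishes\<close>

fun Wsum :: "real list \<Rightarrow> real" where
  "Wsum (u # v # ts) = W u v + Wsum (v # ts)"
| "Wsum _ = 0"

text \<open>One factor of \<open>\<omega>\<close> is kept for superadditivity; the remaining power
  \<open>expo - 1\<close> is positive and is made small through the gaps.\<close>

lemma Wsum_le: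
  assumes "admissible ts" "successively (\<lambda>a b. \<omega> a b \<le> \<eta>) ts"
  shows "Wsum ts \<le> \<eta> powr (expo - 1) * \<omega> (hd ts) (last ts)"
  using assms
proof (induction ts rule: Wsum.induct)
  case (1 u v ts)
  have ad: "admissible (v # ts)"
    using "1.prems"(1) admissible_append2[of "[u]"] by simp
  have uv: "0 \<le> u" "u \<le> v" "v \<le> last (v # ts)" "last (v # ts) \<le> T"
    using "1.prems"(1) admissible_bounds[OF ad] by (auto simp: admissible_def)
  have nn: "0 \<le> \<omega> u v" using uv by (intro control_nonneg) auto
  have "W u v \<le> \<eta> powr (expo - 1) * \<omega> u v"
  proof (cases "\<omega> u v = 0")
    case False
    then have pos: "0 < \<omega> u v" using nn by simp
    have "W u v = \<omega> u v powr (expo - 1) * \<omega> u v"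
      using pos powr_add[of "\<omega> u v" "expo - 1" 1] by (simp add: W_def)
    also have "\<dots> \<le> \<eta> powr (expo - 1) * \<omega> u v"
      using "1.prems"(2) expo_gt_1 nn by (intro mult_right_mono powr_mono2) auto
    finally show ?thesis .
  qed (simp add: W_def)
  moreover have "Wsum (v # ts) \<le> \<eta> powr (expo - 1) * \<omega> v (last (v # ts))"
    using "1.IH" ad "1.prems"(2) by simp
  moreover have "\<eta> powr (expo - 1) * (\<omega> u v + \<omega> v (last (v # ts))) \<le> \<eta> powr (expo - 1)
      * \<omega> u (last (v # ts))"
    using uv by (intro mult_left_mono control_superadditive) auto
  ultimately show ?case by (simp add: distrib_left)
next
  case "2_2"
  then show ?case by (simp add: admissible_def control_diag)
qed (simp add: admissible_def)

text \<open>The simplex is compact, so \<open>\<omega>\<close> is uniformly continuous on it; each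
  value is compared with the value \<open>0\<close> on the diagonal.\<close>

lemma control_small:
  assumes "0 < \<eta>"
  obtains \<delta> where "0 < \<delta>"
    "\<And>s t. \<lbrakk>0 \<le> s; s \<le> t; t \<le> T; t - s < \<delta>\<rbrakk> \<Longrightarrow> \<omega> s t < \<eta>"
proof -
  have "simplex2 T = ({0..T} \<times> {0..T}) \<inter> {z. fst z \<le> snd z}"
    by (auto simp: simplex2_def)
  moreover have "closed {z :: real \<times> real. fst z \<le> snd z}"
    by (intro closed_Collect_le continuous_intros)
  ultimately have "compact (simplex2 T)"
    by (simp add: compact_Int_closed compact_Times)
  then have "uniformly_continuous_on (simplex2 T) (\<lambda>(s, t). \<omega> s t)"
    using control by (intro compact_uniformly_continuous) (auto simp: control_def)
  then obtain \<delta> where \<delta>: "0 < \<delta>" "\<And>x x'. x \<in> simplex2 T \<Longrightarrow> x' \<in> simplex2 T \<Longrightarrow> dist x' x < \<delta> \<Longrightarrow>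
      dist ((\<lambda>(s, t). \<omega> s t) x') ((\<lambda>(s, t). \<omega> s t) x) < \<eta>"
    using assms unfolding uniformly_continuous_on_def by metis
  show thesis
  proof (rule that[OF \<delta>(1)])
    fix s t assume st: "0 \<le> s" "s \<le> t" "t \<le> T" "t - s < \<delta>"
    then have "dist (s, t) (s, s) < \<delta>" by (simp add: dist_Pair_Pair dist_real_def)
    then have "dist (\<omega> s t) (\<omega> s s) < \<eta>"
      using \<delta>(2)[of "(s, s)" "(s, t)"] st by (simp add: simplex2_def)
    then show "\<omega> s t < \<eta>" using st control_diag[of s] by (simp add: dist_real_def)
  qed
qed

lemma Wsum_small:
  assumes "0 < \<epsilon>"
  obtains \<delta> where "0 < \<delta>" "\<And>ts. admissible ts \<Longrightarrow> mesh_below \<delta> ts \<Longrightarrow> Wsum ts \<le> \<epsilon>"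
proof (cases "0 \<le> T")
  case False
  then have "\<not> admissible ts" for ts by (cases ts) (auto simp: admissible_def)
  then show thesis using that[of 1] by simp
next
  case True
  let ?R = "\<omega> 0 T + 1"
  have R: "0 < ?R" using control_nonneg[of 0 T] True by simp
  \<comment> \<open>Solves \<open>\<eta> powr (expo - 1) = \<epsilon> / ?R\<close>; the summand
    \<open>1\<close> in \<open>?R\<close> keeps the denominator positive.\<close>
  define \<eta> where "\<eta> = (\<epsilon> / ?R) powr (1 / (expo - 1))"
  have "0 < \<eta>" using assms R by (simp add: \<eta>_def)
  then obtain \<delta> where \<delta>: "0 < \<delta>"
    "\<And>s t. \<lbrakk>0 \<le> s; s \<le> t; t \<le> T; t - s < \<delta>\<rbrakk> \<Longrightarrow> \<omega> s t < \<eta>"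
    by (rule control_small) (rule that; assumption)
  show thesis
  proof (rule that[OF \<delta>(1)])
    fix ts assume ts: "admissible ts" "mesh_below \<delta> ts"
    have "successively (\<lambda>a b. \<omega> a b \<le> \<eta>) ts"
      unfolding successively_conv_nth
    proof (intro allI impI)
      fix i assume i: "Suc i < length ts"
      have "ts ! Suc i - ts ! i < \<delta>"
        using successively_nth[OF ts(2)[unfolded mesh_below_def] i] .
      moreover have "ts ! i < ts ! Suc i"
        using ts(1) i by (auto simp: admissible_def intro: sorted_wrt_nth_less)
      moreover have "ts ! i \<in> {0..T}" "ts ! Suc i \<in> {0..T}"
        using ts(1) i unfolding admissible_def by (meson Suc_lessD nth_mem subsetD)+
      ultimately show "\<omega> (ts ! i) (ts ! Suc i) \<le> \<eta>"
        using \<delta>(2)[of "ts ! i" "ts ! Suc i"] by simp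
    qed
    then have "Wsum ts \<le> \<eta> powr (expo - 1) * \<omega> (hd ts) (last ts)"
      by (rule Wsum_le[OF ts(1)])
    also have "\<eta> powr (expo - 1) = \<epsilon> / ?R"
      using assms R expo_gt_1 by (simp add: \<eta>_def powr_powr)
    also have "\<epsilon> / ?R * \<omega> (hd ts) (last ts) \<le> \<epsilon> / ?R * ?R"
      using assms R control_mono[of 0 "hd ts" "last ts" T] admissible_bounds[OF ts(1)]
      by (intro mult_left_mono) auto
    finally show "Wsum ts \<le> \<epsilon>" using R by simp
  qed
qed

lemma path_prod_bounded:
  obtains M where "0 \<le> M" "\<And>ts. admissible ts \<Longrightarrow> coeff_norm N (path_prod Y ts) \<le> M"
proof -
  obtain K where K: "0 \<le> K" "\<And>ts. admissible ts \<Longrightarrow>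
    coeff_norm N (\<lambda>w. path_prod Y ts w - Y (hd ts) (last ts) w) \<le> K * W (hd ts) (last ts)"
    using path_prod_bound[of N] by auto
  obtain B where B: "0 \<le> B" "\<And>s t. \<lbrakk>0 \<le> s; s \<le> t; t \<le> T\<rbrakk> \<Longrightarrow> coeff_norm N (Y s t) \<le> B"
    using Y_bound[of N] by metis
  show thesis
  proof (rule that[of "B + K * W 0 T"])
    fix ts assume ts: "admissible ts"
    have "coeff_norm N (path_prod Y ts) \<le> coeff_norm N (Y (hd ts) (last ts))
        + coeff_norm N (\<lambda>w. path_prod Y ts w - Y (hd ts) (last ts) w)"
      by (rule coeff_norm_le_add_diff)
    also have "\<dots> \<le> B + K * W (hd ts) (last ts)"
      using B(2) K(2)[OF ts] admissible_bounds[OF ts] by (intro add_mono) auto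
    also have "\<dots> \<le> B + K * W 0 T"
      using K(1) admissible_bounds[OF ts] by (intro add_left_mono mult_left_mono W_mono) auto
    finally show "coeff_norm N (path_prod Y ts) \<le> B + K * W 0 T" .
  qed (use B(1) K(1) in simp)
qed

text \<open>The factors of the coarse product are replaced one after the other by products over the
  points of \<open>G\<close> between them. Each replacement costs \<open>K * W\<close> by the
  maximal inequality, with a bounded product on either side, which gives the constant
  \<open>M * K * M\<close>.\<close>

lemma path_prod_refinement:
  obtains C where "0 \<le> C" "\<And>s t F G. 0 \<le> s \<Longrightarrow> t \<le> T \<Longrightarrow> partition_of s t F \<Longrightarrow> partition_of s t G \<Longrightarrow>
    set F \<subseteq> set G \<Longrightarrow> coeff_norm N (\<lambda>w. path_prod Y F w - path_prod Y G w) \<le> C * Wsum F"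
proof -
  obtain K where K: "0 \<le> K" "\<And>ts. admissible ts \<Longrightarrow>
    coeff_norm N (\<lambda>w. path_prod Y ts w - Y (hd ts) (last ts) w) \<le> K * W (hd ts) (last ts)"
    using path_prod_bound[of N] by auto
  obtain M where M: "0 \<le> M" "\<And>ts. admissible ts \<Longrightarrow> coeff_norm N (path_prod Y ts) \<le> M"
    using path_prod_bounded by blast
  let ?C = "M * K * M"
  \<comment> \<open>The prefix \<open>R\<close> carries the part that is already refined. The left
    factor is then always one product over a partition and bounded by \<open>M\<close>, whereas
    multiplying bounds at each step would accumulate powers of \<open>M\<close>.\<close>
  have main: "coeff_norm N (tprod (path_prod Y (R @ [s])) (\<lambda>w. path_prod Y F w - path_prod Y G w))
      \<le> ?C * Wsum F"
    if "partition_of s t F" "partition_of s t G" "set F \<subseteq> set G" "admissible (R @ G)" for s t F G R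
    using that
  proof (induction F arbitrary: s G R rule: induct_list012)
    case (2 x)
    then have "s = t" by (simp add: partition_of_single)
    have "G = [s]"
    proof (cases G rule: remdups_adj.cases)
      case (3 x y zs)
      then have "s < y \<and> y \<le> t"
        using \<open>partition_of s t G\<close> partition_of_bounds[of y t "y # zs" t]
        by (auto simp: partition_of_Cons partition_of_def dest: last_in_set)
      then have False using \<open>s = t\<close> by linarith
      then show ?thesis ..
    qed (use \<open>partition_of s t G\<close> in \<open>auto simp: partition_of_def\<close>)
    then show ?case by (simp add: tprod_def coeff_norm_def)
  next
    case (3 x u F)
    have F: "x = s" "s < u" "partition_of u t (u # F)"
      using "3.prems"(1) by (auto simp: partition_of_Cons)
    have "u \<in> set G" using "3.prems"(3) by auto
    then obtain g1 g2 where "G = g1 @ u # g2" by (meson split_list)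
    moreover have "hd G = s" using "3.prems"(2) by (simp add: partition_of_def)
    ultimately obtain g where G: "G = s # g @ u # g2"
      using F(2) by (cases g1) auto
    have G12: "partition_of s u (s # g @ [u])" "partition_of u t (u # g2)"
      using "3.prems"(2) partition_of_append[of s t "s # g" u g2] by (auto simp: G)
    have lt: "y < u" if "y \<in> set (s # g)" for y
      using that G12(1) by (auto simp: partition_of_def sorted_wrt_append)
    have sub: "set (u # F) \<subseteq> set (u # g2)"
    proof
      fix y assume y: "y \<in> set (u # F)"
      then have "u \<le> y" using partition_of_bounds[OF F(3)] by blast
      moreover have "y \<in> set (s # g) \<union> set (u # g2)" using "3.prems"(3) y by (auto simp: G)
      ultimately show "y \<in> set (u # g2)" using lt[of y] by auto
    qed
    have ad: "admissible ((R @ s # g) @ u # g2)" using "3.prems"(4) by (simp add: G)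
    have ad1: "admissible (R @ [s])" "admissible (s # g @ [u])" "admissible (u # F)" "0 \<le> s" "u \<le> T"
    proof -
      show "admissible (R @ [s])" using "3.prems"(4) admissible_append1[of R s "g @ u # g2"] by
          (simp add: G)
      show "admissible (s # g @ [u])"
        using "3.prems"(4) admissible_append2[of R s "g @ u # g2"] admissible_append1[of "s # g" u
            g2] by (simp add: G)
      have "0 \<le> u" "t \<le> T" "0 \<le> s" "u \<le> T"
        using ad admissible_bounds[OF ad] partition_of_bounds[OF G12(2), of u]
          \<open>partition_of u t (u # g2)\<close>
        by (auto simp: admissible_def partition_of_def split: if_splits)
      then show "admissible (u # F)" "0 \<le> s" "u \<le> T"
        using F(3) partition_of_admissible by auto
    qed
    have IH: "coeff_norm N (tprod (path_prod Y ((R @ s # g) @ [u])) (\<lambda>w. path_prod Y (u # F) w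
        - path_prod Y (u # g2) w))
        \<le> ?C * Wsum (u # F)"
      using "3.IH"(2)[OF F(3) G12(2) sub ad] .
    let ?P = "path_prod Y (R @ [s])" and ?g = "path_prod Y (s # g @ [u])"
    have "path_prod Y G = tprod ?g (path_prod Y (u # g2))"
      using path_prod_append[of Y "s # g" u g2] by (simp add: G)
    moreover have "path_prod Y ((R @ s # g) @ [u]) = tprod ?P ?g"
      using path_prod_append[of Y R s "g @ [u]"] by simp
    ultimately have eq: "tprod ?P (\<lambda>w. path_prod Y (x # u # F) w - path_prod Y G w)
      = (\<lambda>w. tprod ?P (tprod (\<lambda>w. Y s u w - ?g w) (path_prod Y (u # F))) w
        + tprod (path_prod Y ((R @ s # g) @ [u])) (\<lambda>w. path_prod Y (u # F) w - path_prod Y (u # g2)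
            w) w)"
      by (simp add: F(1) tprod_diff_left tprod_diff_right tprod_assoc)
    have "coeff_norm N (tprod ?P (tprod (\<lambda>w. Y s u w - ?g w) (path_prod Y (u # F))))
        \<le> coeff_norm N ?P * (coeff_norm N (\<lambda>w. Y s u w - ?g w) * coeff_norm N (path_prod Y (u #
            F)))"
      by (intro order_trans[OF coeff_norm_tprod] mult_left_mono coeff_norm_tprod) simp
    also have "\<dots> \<le> M * ((K * W s u) * M)"
      using M ad1 K(1) K(2)[OF ad1(2)]
      by (intro mult_mono) (auto simp: coeff_norm_diff_commute[of N "Y s u"])
    finally have "coeff_norm N (tprod ?P (tprod (\<lambda>w. Y s u w - ?g w) (path_prod Y (u # F))))
        \<le> ?C * W s u"
      by (simp add: mult_ac)
    with IH show ?case
      unfolding eq using coeff_norm_add[of N "tprod ?P (tprod (\<lambda>w. Y s u w - ?g w) (path_prod Y (u #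
          F)))"
        "tprod (path_prod Y ((R @ s # g) @ [u])) (\<lambda>w. path_prod Y (u # F) w - path_prod Y (u # g2)
            w)"]
      by (simp add: F(1) distrib_left)
  qed (simp add: partition_of_def)
  show thesis
  proof (rule that[of ?C])
    fix s t F G assume *: "0 \<le> s" "t \<le> T" "partition_of s t F" "partition_of s t G" "set F \<subseteq> set G"
    then have "admissible ([] @ G)" by (auto intro: partition_of_admissible)
    from main[OF *(3-5) this] show "coeff_norm N (\<lambda>w. path_prod Y F w - path_prod Y G w)
        \<le> ?C * Wsum F"
      by simp
  qed (use K M in simp)
qed

text \<open>Both partitions are compared with their common refinement \<open>J\<close>. The cost of
  refining depends only on the coarser partition, so it is small as soon as \<open>F\<close> and
  \<open>G\<close> are fine, uniformly in \<open>s\<close> and \<open>t\<close>.\<close>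

lemma path_prod_Cauchy:
  assumes "0 < \<epsilon>"
  obtains \<delta> where "0 < \<delta>" "\<And>s t F G. 0 \<le> s \<Longrightarrow> t \<le> T \<Longrightarrow> partition_of s t F \<Longrightarrow> partition_of s t G \<Longrightarrow>
    mesh_below \<delta> F \<Longrightarrow> mesh_below \<delta> G \<Longrightarrow> coeff_norm N (\<lambda>w. path_prod Y F w - path_prod Y G w) \<le> \<epsilon>"
proof -
  obtain C where C: "0 \<le> C" "\<And>s t F G. 0 \<le> s \<Longrightarrow> t \<le> T \<Longrightarrow> partition_of s t F \<Longrightarrow> partition_of s t G \<Longrightarrow>
    set F \<subseteq> set G \<Longrightarrow> coeff_norm N (\<lambda>w. path_prod Y F w - path_prod Y G w) \<le> C * Wsum F"
    using path_prod_refinement by blast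
  define e where "e = \<epsilon> / (2 * (C + 1))"
  have e: "0 < e" "C * e \<le> \<epsilon> / 2" using assms C(1) by (auto simp: e_def field_simps)
  from e(1) obtain \<delta> where \<delta>: "0 < \<delta>" "\<And>ts. admissible ts \<Longrightarrow> mesh_below \<delta> ts \<Longrightarrow> Wsum ts \<le> e"
    by (rule Wsum_small) (rule that; assumption)
  show thesis
  proof (rule that[OF \<delta>(1)])
    fix s t F G assume *: "0 \<le> s" "t \<le> T" and F: "partition_of s t F" "mesh_below \<delta> F"
      and G: "partition_of s t G" "mesh_below \<delta> G"
    define J where "J = sorted_list_of_set (set F \<union> set G)"
    have J: "set J = set F \<union> set G" "sorted_wrt (<) J" by (simp_all add: J_def)
    have st: "s \<in> set F" "t \<in> set F" using F by (auto simp: partition_of_def)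
    have pJ: "partition_of s t J"
    proof (rule partition_ofI)
      show "s \<le> x \<and> x \<le> t" if "x \<in> set J" for x
        using that J partition_of_bounds[OF F(1)] partition_of_bounds[OF G(1)] by auto
    qed (use J st in auto)
    have small: "coeff_norm N (\<lambda>w. path_prod Y H w - path_prod Y J w) \<le> \<epsilon> / 2"
      if H: "partition_of s t H" "mesh_below \<delta> H" "set H \<subseteq> set J" for H
    proof -
      have "coeff_norm N (\<lambda>w. path_prod Y H w - path_prod Y J w) \<le> C * Wsum H"
        by (rule C(2)[OF * H(1) pJ H(3)])
      also have "\<dots> \<le> C * e"
        using \<delta>(2) H partition_of_admissible[OF H(1) *] C(1) by (intro mult_left_mono) auto
      finally show ?thesis using e(2) by simp
    qed
    have "coeff_norm N (\<lambda>w. path_prod Y F w - path_prod Y J w) \<le> \<epsilon> / 2"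
      "coeff_norm N (\<lambda>w. path_prod Y G w - path_prod Y J w) \<le> \<epsilon> / 2"
      by (rule small[OF F], use J in simp, rule small[OF G], use J in simp)
    then show "coeff_norm N (\<lambda>w. path_prod Y F w - path_prod Y G w) \<le> \<epsilon>"
      using coeff_norm_triangle[of N "path_prod Y F" "path_prod Y G" "path_prod Y J"]
        coeff_norm_diff_commute[of N "path_prod Y J" "path_prod Y G"] by linarith
  qed
qed

end

section \<open>The limit rough path\<close>

lemma le_0_if_le_mult_eps:
  fixes x c :: real
  assumes "0 \<le> c" "\<And>e. 0 < e \<Longrightarrow> x \<le> c * e"
  shows "x \<le> 0"
proof (rule field_le_epsilon)
  fix e :: real assume "0 < e"
  then have "x \<le> c * (e / (c + 1))" using assms by (intro assms(2)) auto
  also have "\<dots> \<le> 0 + e" using assms(1) \<open>0 < e\<close> by (simp add: field_simps)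
  finally show "x \<le> 0 + e" .
qed

lemma LIMSEQ_coordinatewise:
  fixes f :: "nat \<Rightarrow> 'a \<Rightarrow> real"
  assumes "\<And>i. (\<lambda>n. f n i) \<longlonglongrightarrow> l i"
  shows "f \<longlonglongrightarrow> l"
proof -
  have "limitin (product_topology (\<lambda>i. euclidean) UNIV) f l sequentially"
    using assms by (simp add: limitin_componentwise)
  then show ?thesis by (simp add: euclidean_product_topology)
qed

context sewing
begin

text \<open>Convergence over all partitions of small mesh at once, so that a single limit serves
  every sequence of partitions.\<close>

definition is_limit :: "real \<Rightarrow> real \<Rightarrow> 'u tensor \<Rightarrow> bool" where
  "is_limit s t z \<longleftrightarrow> (\<forall>\<epsilon>>0. \<exists>\<delta>>0. \<forall>F. partition_of s t F \<longrightarrow> mesh_below \<delta> F \<longrightarrow>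
     coeff_norm N (\<lambda>w. path_prod Y F w - z w) \<le> \<epsilon>)"

text \<open>The Cauchy estimate is uniform over fine partitions, so the limit along one sequence
  with gaps below \<open>1 / Suc k\<close> is the limit along all of them.\<close>

lemma is_limit_exists:
  assumes st: "0 \<le> s" "s \<le> t" "t \<le> T"
  shows "\<exists>z. z \<in> trunc_space N \<and> is_limit s t z"
proof -
  have "\<exists>F. \<forall>k::nat. partition_of s t (F k) \<and> mesh_below (1 / real (Suc k)) (F k)"
    by (rule choice) (use mesh_below_partition_exists[OF st(2)] in \<open>metis of_nat_0_less_iff
        zero_less_Suc zero_less_divide_1_iff\<close>)
  then obtain F where F: "\<And>k. partition_of s t (F k)" "\<And>k. mesh_below (1 / real (Suc k)) (F k)"
    by blast
  have fine: "\<exists>K. \<forall>k\<ge>K. mesh_below \<delta> (F k)" if pos: "0 < \<delta>" for \<delta>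
  proof -
    obtain K where K: "1 / real (Suc K) < \<delta>" using nat_approx_posE[OF pos] by blast
    have "mesh_below \<delta> (F k)" if "K \<le> k" for k
    proof (rule mesh_below_mono[OF F(2)])
      have "1 / real (Suc k) \<le> 1 / real (Suc K)" using that by (intro divide_left_mono) auto
      then show "1 / real (Suc k) \<le> \<delta>" using K by simp
    qed
    then show ?thesis by blast
  qed
  \<comment> \<open>\<open>coeff_norm N\<close> does not determine the other coefficients; the value
    \<open>0\<close> places the limit in \<open>trunc_space N\<close>.\<close>
  define z where "z = (\<lambda>w. if w \<in> words_upto N then lim (\<lambda>k. path_prod Y (F k) w) else 0)"
  have conv: "(\<lambda>k. path_prod Y (F k) w) \<longlonglongrightarrow> z w" if w: "w \<in> words_upto N" for w
  proof -
    have "Cauchy (\<lambda>k. path_prod Y (F k) w)"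
    proof (rule CauchyI)
      fix e :: real assume "0 < e"
      then have "0 < e / 2" by simp
      then obtain \<delta> where \<delta>: "0 < \<delta>" "\<And>s t F G. 0 \<le> s \<Longrightarrow> t \<le> T \<Longrightarrow> partition_of s t F \<Longrightarrow>
          partition_of s t G \<Longrightarrow>
          mesh_below \<delta> F \<Longrightarrow> mesh_below \<delta> G \<Longrightarrow> coeff_norm N (\<lambda>w. path_prod Y F w - path_prod Y G w)
              \<le> e / 2"
        by (rule path_prod_Cauchy) (rule that; assumption)
      obtain K where K: "\<And>k. K \<le> k \<Longrightarrow> mesh_below \<delta> (F k)" using fine[OF \<delta>(1)] by blast
      have "\<bar>path_prod Y (F k) w - path_prod Y (F l) w\<bar> < e" if "K \<le> k" "K \<le> l" for k l
        using \<delta>(2)[OF st(1,3) F(1) F(1) K[OF that(1)] K[OF that(2)]] \<open>0 < e\<close>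
          abs_le_coeff_norm[OF w, of "\<lambda>w. path_prod Y (F k) w - path_prod Y (F l) w"] by linarith
      then show "\<exists>K. \<forall>k\<ge>K. \<forall>l\<ge>K. norm (path_prod Y (F k) w - path_prod Y (F l) w) < e"
        by auto
    qed
    then show ?thesis
      using w by (simp add: z_def Cauchy_convergent_iff convergent_LIMSEQ_iff)
  qed
  have "is_limit s t z"
    unfolding is_limit_def
  proof (intro allI impI)
    fix \<epsilon> :: real assume "0 < \<epsilon>"
    then obtain \<delta> where \<delta>: "0 < \<delta>" "\<And>s t F G. 0 \<le> s \<Longrightarrow> t \<le> T \<Longrightarrow> partition_of s t F \<Longrightarrow>
        partition_of s t G \<Longrightarrow>
        mesh_below \<delta> F \<Longrightarrow> mesh_below \<delta> G \<Longrightarrow> coeff_norm N (\<lambda>w. path_prod Y F w - path_prod Y G w) \<le> \<epsilon>"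
      by (rule path_prod_Cauchy) (rule that; assumption)
    obtain K where K: "\<And>k. K \<le> k \<Longrightarrow> mesh_below \<delta> (F k)" using fine[OF \<delta>(1)] by blast
    have "coeff_norm N (\<lambda>w. path_prod Y G w - z w) \<le> \<epsilon>" if G: "partition_of s t G" "mesh_below \<delta> G"
        for G
    proof (rule LIMSEQ_le_const2)
      show "(\<lambda>k. coeff_norm N (\<lambda>w. path_prod Y G w - path_prod Y (F k) w)) \<longlonglongrightarrow> coeff_norm N (\<lambda>w.
          path_prod Y G w - z w)"
        unfolding coeff_norm_def by (intro tendsto_sum tendsto_rabs tendsto_diff tendsto_const conv)
      show "\<exists>K. \<forall>k\<ge>K. coeff_norm N (\<lambda>w. path_prod Y G w - path_prod Y (F k) w) \<le> \<epsilon>"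
        using \<delta>(2)[OF st(1,3) G(1) F(1) G(2) K] by blast
    qed
    then show "\<exists>\<delta>>0. \<forall>G. partition_of s t G \<longrightarrow> mesh_below \<delta> G \<longrightarrow>
        coeff_norm N (\<lambda>w. path_prod Y G w - z w) \<le> \<epsilon>"
      using \<delta>(1) by blast
  qed
  moreover have "z \<in> trunc_space N" by (simp add: z_def trunc_space_def)
  ultimately show ?thesis by blast
qed

definition Z :: "real \<Rightarrow> real \<Rightarrow> 'u tensor" where
  "Z s t = (SOME z. z \<in> trunc_space N \<and> is_limit s t z)"

lemma Z_is_limit: "\<lbrakk>0 \<le> s; s \<le> t; t \<le> T\<rbrakk> \<Longrightarrow> is_limit s t (Z s t)"
  and Z_trunc: "\<lbrakk>0 \<le> s; s \<le> t; t \<le> T\<rbrakk> \<Longrightarrow> Z s t \<in> trunc_space N"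
  using someI_ex[OF is_limit_exists] unfolding Z_def by blast+

lemma Z_eq_0: "\<lbrakk>0 \<le> s; s \<le> t; t \<le> T\<rbrakk> \<Longrightarrow> w \<notin> words_upto N \<Longrightarrow> Z s t w = 0"
  using Z_trunc by (auto simp: trunc_space_def)

lemma Z_approx:
  assumes "0 \<le> s" "s \<le> t" "t \<le> T" "0 < \<epsilon>"
  obtains \<delta> where "0 < \<delta>" "\<And>F. partition_of s t F \<Longrightarrow> mesh_below \<delta> F \<Longrightarrow>
    coeff_norm N (\<lambda>w. path_prod Y F w - Z s t w) \<le> \<epsilon>"
  using Z_is_limit[OF assms(1-3)] assms(4) unfolding is_limit_def by blast

lemma Z_approx_partition:
  assumes "0 \<le> s" "s \<le> t" "t \<le> T" "0 < \<epsilon>"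
  obtains F where "partition_of s t F" "coeff_norm N (\<lambda>w. path_prod Y F w - Z s t w) \<le> \<epsilon>"
proof -
  obtain \<delta> where \<delta>: "0 < \<delta>" "\<And>F. partition_of s t F \<Longrightarrow> mesh_below \<delta> F \<Longrightarrow>
      coeff_norm N (\<lambda>w. path_prod Y F w - Z s t w) \<le> \<epsilon>"
    using Z_approx[OF assms] by blast
  obtain F where "partition_of s t F" "mesh_below \<delta> F"
    using mesh_below_partition_exists[OF assms(2) \<delta>(1)] by blast
  then show thesis using \<delta>(2) that by blast
qed

section \<open>Regularity and multiplicativity of the limit\<close>

lemma Z_bounded:
  obtains M where "0 \<le> M" "\<And>s t. \<lbrakk>0 \<le> s; s \<le> t; t \<le> T\<rbrakk> \<Longrightarrow> coeff_norm N (Z s t) \<le> M"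
    "\<And>ts. admissible ts \<Longrightarrow> coeff_norm N (path_prod Y ts) \<le> M"
proof -
  obtain M where M: "0 \<le> M" "\<And>ts. admissible ts \<Longrightarrow> coeff_norm N (path_prod Y ts) \<le> M"
    using path_prod_bounded by blast
  have "coeff_norm N (Z s t) \<le> M" if st: "0 \<le> s" "s \<le> t" "t \<le> T" for s t
  proof (rule field_le_epsilon)
    fix e :: real assume "0 < e"
    with st obtain F where F: "partition_of s t F" "coeff_norm N (\<lambda>w. path_prod Y F w - Z s t w)
        \<le> e"
      by (rule Z_approx_partition) (rule that; assumption)
    have "coeff_norm N (path_prod Y F) \<le> M"
      using M(2) partition_of_admissible[OF F(1)] st by simp
    then show "coeff_norm N (Z s t) \<le> M + e"
      using F(2) coeff_norm_le_add_diff[of N "Z s t" "path_prod Y F"]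
        coeff_norm_diff_commute[of N "Z s t" "path_prod Y F"] by linarith
  qed
  with M show thesis using that by blast
qed

text \<open>The maximal inequality has the same constant for every partition and therefore passes to
  the limit.\<close>

lemma Z_near:
  obtains K where "0 \<le> K" "\<And>s t. \<lbrakk>0 \<le> s; s \<le> t; t \<le> T\<rbrakk> \<Longrightarrow>
    coeff_norm N (\<lambda>w. Z s t w - Y s t w) \<le> K * W s t"
proof -
  obtain K where K: "0 \<le> K" "\<And>ts. admissible ts \<Longrightarrow>
    coeff_norm N (\<lambda>w. path_prod Y ts w - Y (hd ts) (last ts) w) \<le> K * W (hd ts) (last ts)"
    using path_prod_bound[of N] by auto
  have "coeff_norm N (\<lambda>w. Z s t w - Y s t w) \<le> K * W s t" if st: "0 \<le> s" "s \<le> t" "t \<le> T" for s t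
  proof (rule field_le_epsilon)
    fix e :: real assume "0 < e"
    with st obtain F where F: "partition_of s t F" "coeff_norm N (\<lambda>w. path_prod Y F w - Z s t w)
        \<le> e"
      by (rule Z_approx_partition) (rule that; assumption)
    have "hd F = s" "last F = t" using F(1) by (simp_all add: partition_of_def)
    then have "coeff_norm N (\<lambda>w. path_prod Y F w - Y s t w) \<le> K * W s t"
      using K(2)[of F] partition_of_admissible[OF F(1)] st by simp
    then show "coeff_norm N (\<lambda>w. Z s t w - Y s t w) \<le> K * W s t + e"
      using F(2) coeff_norm_triangle[of N "Z s t" "Y s t" "path_prod Y F"]
        coeff_norm_diff_commute[of N "Z s t" "path_prod Y F"] by linarith
  qed
  with K(1) show thesis using that by blast
qed

lemma Z_near_err:
  assumes "w \<in> words_upto N"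
  shows "err (Suc N) (\<lambda>s u t. Z s t w - Y s t w)"
proof -
  obtain K where K: "\<And>s t. \<lbrakk>0 \<le> s; s \<le> t; t \<le> T\<rbrakk> \<Longrightarrow>
      coeff_norm N (\<lambda>w. Z s t w - Y s t w) \<le> K * W s t"
    by (rule Z_near) (rule that; assumption)
  show ?thesis
  proof (rule errI)
    fix s u t assume *: "0 \<le> s" "s \<le> u" "u \<le> t" "t \<le> T"
    then have "coeff_norm N (\<lambda>w. Z s t w - Y s t w) \<le> K * W s t" by (intro K) auto
    then show "\<bar>Z s t w - Y s t w\<bar> \<le> K * scale s t ^ Suc N"
      using abs_le_coeff_norm[OF assms, of "\<lambda>w. Z s t w - Y s t w"] unfolding W_eq by linarith
  qed
qed

lemma Z_err:
  assumes "w \<in> words_upto N"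
  shows "err (length w) (\<lambda>s u t. Z s t w)"
proof -
  have "err (length w) (\<lambda>s u t. Z s t w - Y s t w)"
    using assms by (intro err_mono[OF Z_near_err]) (auto simp: words_upto_iff)
  then have "err (length w) (\<lambda>s u t. (Z s t w - Y s t w) + Y s t w)"
    using regular_tensor_map_err[OF Y_regular] by (rule err_add)
  then show ?thesis by simp
qed

text \<open>Fine partitions of \<open>[s, u]\<close> and \<open>[u, t]\<close> concatenate to a fine
  partition of \<open>[s, t]\<close>, whose product factors at \<open>u\<close>; the product is
  continuous on bounded sets.\<close>

lemma Z_mult:
  assumes sut: "0 \<le> s" "s \<le> u" "u \<le> t" "t \<le> T"
  shows "Z s t = ttrunc N (tprod (Z s u) (Z u t))"
proof -
  obtain M where M: "0 \<le> M" "\<And>s t. \<lbrakk>0 \<le> s; s \<le> t; t \<le> T\<rbrakk> \<Longrightarrow> coeff_norm N (Z s t) \<le> M"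
    "\<And>ts. admissible ts \<Longrightarrow> coeff_norm N (path_prod Y ts) \<le> M"
    using Z_bounded by metis
  let ?D = "\<lambda>w. Z s t w - tprod (Z s u) (Z u t) w"
  have st: "s \<le> t" "s \<le> T" "0 \<le> u" "0 \<le> t" "u \<le> T" using sut by auto
  have "coeff_norm N ?D \<le> (1 + 2 * M) * e" if e: "0 < e" for e
  proof -
    obtain d1 where d1: "0 < d1" "\<And>F. partition_of s t F \<Longrightarrow> mesh_below d1 F \<Longrightarrow>
        coeff_norm N (\<lambda>w. path_prod Y F w - Z s t w) \<le> e"
      using Z_approx[OF sut(1) st(1) sut(4) e] by blast
    obtain d2 where d2: "0 < d2" "\<And>F. partition_of s u F \<Longrightarrow> mesh_below d2 F \<Longrightarrow>
        coeff_norm N (\<lambda>w. path_prod Y F w - Z s u w) \<le> e"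
      using Z_approx[OF sut(1,2) st(5) e] by blast
    obtain d3 where d3: "0 < d3" "\<And>F. partition_of u t F \<Longrightarrow> mesh_below d3 F \<Longrightarrow>
        coeff_norm N (\<lambda>w. path_prod Y F w - Z u t w) \<le> e"
      using Z_approx[OF st(3) sut(3,4) e] by blast
    define d where "d = min d1 (min d2 d3)"
    have d: "0 < d" "d \<le> d1" "d \<le> d2" "d \<le> d3" using d1 d2 d3 by (auto simp: d_def)
    obtain F where F: "partition_of s u F" "mesh_below d F"
      using mesh_below_partition_exists[OF sut(2) d(1)] by blast
    obtain G where G: "partition_of u t G" "mesh_below d G"
      using mesh_below_partition_exists[OF sut(3) d(1)] by blast
    obtain xs where xs: "F = xs @ [u]"
      using F(1) by (cases F rule: rev_cases) (auto simp: partition_of_def)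
    obtain ys where ys: "G = u # ys"
      using G(1) by (cases G) (auto simp: partition_of_def)
    let ?F = "path_prod Y F" and ?G = "path_prod Y G" and ?J = "path_prod Y (xs @ u # ys)"
    have J: "partition_of s t (xs @ u # ys)" "mesh_below d (xs @ u # ys)"
      using F G by (simp_all add: xs ys partition_of_append[of s t xs u ys] mesh_below_append)
    have J_eq: "?J = tprod ?F ?G" unfolding xs ys by (rule path_prod_append)
    have 1: "coeff_norm N (\<lambda>w. Z s t w - ?J w) \<le> e"
      using d1(2)[OF J(1) mesh_below_mono[OF J(2) d(2)]] by (simp add: coeff_norm_diff_commute)
    have "coeff_norm N (tprod (\<lambda>w. ?F w - Z s u w) ?G) \<le> e * M"
      using d2(2)[OF F(1) mesh_below_mono[OF F(2) d(3)]] M(3) partition_of_admissible[OF G(1)] st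
          sut e
      by (intro order_trans[OF coeff_norm_tprod] mult_mono) auto
    moreover have "coeff_norm N (tprod (Z s u) (\<lambda>w. ?G w - Z u t w)) \<le> M * e"
      using d3(2)[OF G(1) mesh_below_mono[OF G(2) d(4)]] M(1) M(2)[OF sut(1,2) st(5)]
      by (intro order_trans[OF coeff_norm_tprod] mult_mono) auto
    moreover have "(\<lambda>w. ?J w - tprod (Z s u) (Z u t) w)
      = (\<lambda>w. tprod (\<lambda>w. ?F w - Z s u w) ?G w + tprod (Z s u) (\<lambda>w. ?G w - Z u t w) w)"
      unfolding J_eq tprod_diff_left tprod_diff_right by simp
    ultimately have "coeff_norm N (\<lambda>w. ?J w - tprod (Z s u) (Z u t) w) \<le> 2 * M * e"
      using coeff_norm_add[of N "tprod (\<lambda>w. ?F w - Z s u w) ?G"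
          "tprod (Z s u) (\<lambda>w. ?G w - Z u t w)"]
      by (simp add: mult.commute[of e M])
    with 1 show ?thesis
      using coeff_norm_triangle[of N "Z s t" "tprod (Z s u) (Z u t)" ?J] by (simp add:
          distrib_right)
  qed
  moreover have "0 \<le> 1 + 2 * M" using M(1) by simp
  ultimately have "coeff_norm N ?D \<le> 0"
    by (intro le_0_if_le_mult_eps)
  then have eq: "Z s t w = tprod (Z s u) (Z u t) w" if "w \<in> words_upto N" for w
    using abs_le_coeff_norm[OF that, of ?D] by simp
  show ?thesis
  proof
    fix w
    show "Z s t w = ttrunc N (tprod (Z s u) (Z u t)) w"
    proof (cases "w \<in> words_upto N")
      case True
      then show ?thesis using eq by (simp add: ttrunc_def words_upto_iff)
    next
      case False
      have "Z s u (take i w) * Z u t (drop i w) = 0" if "length w \<le> N" for i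
      proof -
        have "\<not> set (take i w @ drop i w) \<subseteq> Basis" using that False by (simp add: words_upto_iff)
        then have "take i w \<notin> words_upto N \<or> drop i w \<notin> words_upto N"
          unfolding words_upto_iff set_append by blast
        then show ?thesis using Z_eq_0 sut st by auto
      qed
      then have "ttrunc N (tprod (Z s u) (Z u t)) w = 0"
        unfolding ttrunc_def tprod_def by (auto intro: sum.neutral)
      then show ?thesis using Z_eq_0[OF sut(1) st(1) sut(4) False] by simp
    qed
  qed
qed

lemma Z_mult_coeff:
  assumes "0 \<le> s" "s \<le> u" "u \<le> t" "t \<le> T" "length w \<le> N"
  shows "Z s t w = tprod (Z s u) (Z u t) w"
  using fun_cong[OF Z_mult[OF assms(1-4)], of w] assms(5) by (simp add: ttrunc_def)

lemma Z_Nil: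
  assumes "0 \<le> s" "s \<le> t" "t \<le> T"
  shows "Z s t [] = 1"
proof -
  obtain C where C: "\<And>s u t. \<lbrakk>0 \<le> s; s \<le> u; u \<le> t; t \<le> T\<rbrakk> \<Longrightarrow> \<bar>Z s t [] - Y s t []\<bar>
      \<le> C * scale s t ^ Suc N"
    using Z_near_err[of "[]"] by (rule errE) (auto simp: words_upto_iff intro: that)
  have diag: "Z s s [] = 1" "Z t t [] = 1"
    using C[of s s s] C[of t t t] assms by (auto simp: scale_def control_diag Y_Nil)
  have "\<bar>Z s t [] - 1\<bar> \<le> 1 * e" if e: "0 < e" for e
  proof -
    obtain F where F: "partition_of s t F" "coeff_norm N (\<lambda>w. path_prod Y F w - Z s t w) \<le> e"
      using Z_approx_partition[OF assms e] by blast
    then show ?thesis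
      using abs_le_coeff_norm[of "[]" N "\<lambda>w. path_prod Y F w - Z s t w"]
        path_prod_Nil[OF partition_of_admissible[OF F(1)]] assms by (simp add: words_upto_iff)
  qed
  then have "\<bar>Z s t [] - 1\<bar> \<le> 0" by (rule le_0_if_le_mult_eps[OF zero_le_one])
  then show ?thesis by simp
qed

section \<open>Continuity of the limit\<close>

lemma Z_small:
  assumes "0 < e"
  obtains \<delta> where "0 < \<delta>" "\<And>s t. \<lbrakk>0 \<le> s; s \<le> t; t \<le> T; t - s < \<delta>\<rbrakk> \<Longrightarrow>
    coeff_norm N (\<lambda>w. Z s t w - tone w) \<le> e"
proof -
  have "err 1 (\<lambda>s u t. Z s t w - tone w)" if w: "w \<in> words_upto N" for w
  proof (cases w)
    case Nil
    then show ?thesis by (intro err_cong[OF err_zero]) (simp add: Z_Nil tone_def)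
  next
    case (Cons a v)
    then show ?thesis using err_mono[OF Z_err[OF w], of 1] by (simp add: tone_def)
  qed
  then obtain C where C: "0 \<le> C" "\<And>s u t. \<lbrakk>0 \<le> s; s \<le> u; u \<le> t; t \<le> T\<rbrakk> \<Longrightarrow>
      coeff_norm N (\<lambda>w. Z s t w - tone w) \<le> C * scale s t ^ 1"
    by (rule err_coeff_norm[where f = "\<lambda>w s u t. Z s t w - tone w"]) (assumption | rule that)+
  \<comment> \<open>The power \<open>p\<close> undoes the root in \<open>scale\<close>, so that
    \<open>C * scale s t\<close> is at most \<open>e\<close>.\<close>
  define \<eta> where "\<eta> = (e / (C + 1)) powr p"
  have "0 < \<eta>" using assms C(1) by (simp add: \<eta>_def)
  then obtain \<delta> where \<delta>: "0 < \<delta>"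
    "\<And>s t. \<lbrakk>0 \<le> s; s \<le> t; t \<le> T; t - s < \<delta>\<rbrakk> \<Longrightarrow> \<omega> s t < \<eta>"
    by (rule control_small) (rule that; assumption)
  show thesis
  proof (rule that[OF \<delta>(1)])
    fix s t assume st: "0 \<le> s" "s \<le> t" "t \<le> T" "t - s < \<delta>"
    have "scale s t \<le> \<eta> powr (1 / p)"
      unfolding scale_def using \<delta>(2)[OF st] control_nonneg[OF st(1-3)] p_ge_1 by (intro powr_mono2)
          auto
    also have "\<dots> = e / (C + 1)"
      using p_ge_1 assms C(1) by (simp add: \<eta>_def powr_powr)
    finally have "C * scale s t \<le> C * (e / (C + 1))" using C(1) by (rule mult_left_mono)
    also have "\<dots> \<le> e" using C(1) assms by (simp add: field_simps)
    finally show "coeff_norm N (\<lambda>w. Z s t w - tone w) \<le> e"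
      using C(2)[of s s t] st by simp
  qed
qed

text \<open>By multiplicativity, enlarging the interval multiplies \<open>Z s' t'\<close> on both
  sides by values of \<open>Z\<close> on the added pieces, which are close to \<open>tone\<close>
  when the pieces are short.\<close>

lemma Z_enlarge:
  obtains M where "0 \<le> M" "\<And>s s' t t'. \<lbrakk>0 \<le> s; s \<le> s'; s' \<le> t'; t' \<le> t; t \<le> T\<rbrakk> \<Longrightarrow>
    coeff_norm N (\<lambda>w. Z s t w - Z s' t' w)
      \<le> M * (coeff_norm N (\<lambda>w. Z s s' w - tone w) + coeff_norm N (\<lambda>w. Z t' t w - tone w))"
proof -
  obtain M where M: "0 \<le> M" "\<And>s t. \<lbrakk>0 \<le> s; s \<le> t; t \<le> T\<rbrakk> \<Longrightarrow> coeff_norm N (Z s t) \<le> M"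
    using Z_bounded by metis
  show thesis
  proof (rule that[OF M(1)])
    fix s s' t t' assume *: "0 \<le> s" "s \<le> s'" "s' \<le> t'" "t' \<le> t" "t \<le> T"
    have "coeff_norm N (\<lambda>w. Z s t w - Z s t' w) = coeff_norm N (tprod (Z s t') (\<lambda>w. Z t' t w
        - tone w))"
      unfolding coeff_norm_def tprod_diff_right
      using * by (intro sum.cong) (auto simp: Z_mult_coeff[of s t' t] words_upto_iff)
    also have "\<dots> \<le> M * coeff_norm N (\<lambda>w. Z t' t w - tone w)"
      using M(2)[of s t'] * by (intro order_trans[OF coeff_norm_tprod] mult_right_mono) auto
    finally have 1: "coeff_norm N (\<lambda>w. Z s t w - Z s t' w) \<le> M * coeff_norm N (\<lambda>w. Z t' t w
        - tone w)" .
    have "coeff_norm N (\<lambda>w. Z s t' w - Z s' t' w) = coeff_norm N (tprod (\<lambda>w. Z s s' w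
        - tone w) (Z s' t'))"
      unfolding coeff_norm_def tprod_diff_left
      using * by (intro sum.cong) (auto simp: Z_mult_coeff[of s s' t'] words_upto_iff)
    also have "\<dots> \<le> coeff_norm N (\<lambda>w. Z s s' w - tone w) * M"
      using M(2)[of s' t'] * by (intro order_trans[OF coeff_norm_tprod] mult_left_mono) auto
    finally show "coeff_norm N (\<lambda>w. Z s t w - Z s' t' w)
      \<le> M * (coeff_norm N (\<lambda>w. Z s s' w - tone w) + coeff_norm N (\<lambda>w. Z t' t w - tone w))"
      using 1 coeff_norm_triangle[of N "Z s t" "Z s' t'" "Z s t'"] by (simp add: algebra_simps)
  qed
qed

lemma continuous_Z: "continuous_on (simplex2 T) (\<lambda>(s, t). Z s t)"
proof (rule continuous_on_coordinatewise_then_product)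
  fix w
  show "continuous_on (simplex2 T) (\<lambda>x. (case x of (s, t) \<Rightarrow> Z s t) w)"
  proof (cases "w \<in> words_upto N")
    case False
    then show ?thesis
      by (intro continuous_on_eq[OF continuous_on_const[where c = 0]]) (auto simp: simplex2_def
          Z_eq_0)
  next
    case w: True
    obtain M where M: "0 \<le> M" "\<And>s s' t t'. \<lbrakk>0 \<le> s; s \<le> s'; s' \<le> t'; t' \<le> t; t \<le> T\<rbrakk> \<Longrightarrow>
      coeff_norm N (\<lambda>w. Z s t w - Z s' t' w)
        \<le> M * (coeff_norm N (\<lambda>w. Z s s' w - tone w) + coeff_norm N (\<lambda>w. Z t' t w - tone w))"
      using Z_enlarge by blast
    show ?thesis
      unfolding continuous_on_iff
    proof (intro ballI allI impI)
      fix x and e :: real assume x: "x \<in> simplex2 T" and e: "0 < e"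
      \<comment> \<open>There are two comparisons, each with factor \<open>M\<close> and two added
        pieces, hence \<open>4 * M\<close>; the summand \<open>1\<close> covers
        \<open>M = 0\<close>.\<close>
      define e' where "e' = e / (4 * M + 1)"
      have e': "0 < e'" "4 * M * e' < e" using e M(1) by (auto simp: e'_def field_simps)
      obtain d where d: "0 < d" "\<And>s t. \<lbrakk>0 \<le> s; s \<le> t; t \<le> T; t - s < d\<rbrakk> \<Longrightarrow>
          coeff_norm N (\<lambda>w. Z s t w - tone w) \<le> e'"
        using Z_small[OF e'(1)] by blast
      have "dist ((case y of (s, t) \<Rightarrow> Z s t) w) ((case x of (s, t) \<Rightarrow> Z s t) w) < e"
        if y: "y \<in> simplex2 T" "dist y x < d" for y
      proof -
        obtain s t s' t' where xy: "x = (s, t)" "y = (s', t')" by (cases x; cases y)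
        have st: "0 \<le> s" "s \<le> t" "t \<le> T" "0 \<le> s'" "s' \<le> t'" "t' \<le> T"
          using x y by (auto simp: xy simplex2_def)
        have near: "\<bar>s' - s\<bar> < d" "\<bar>t' - t\<bar> < d"
          using y(2) dist_fst_le[of y x] dist_snd_le[of y x] by (auto simp: xy dist_real_def)
        \<comment> \<open>In general neither interval contains the other, so both are compared with
          the smallest interval containing them.\<close>
        let ?s = "min s s'" and ?t = "max t t'"
        have close: "coeff_norm N (\<lambda>w. Z ?s ?t w - Z a b w) \<le> 2 * M * e'"
          if ab: "(a, b) = (s, t) \<or> (a, b) = (s', t')" for a b
        proof -
          have "coeff_norm N (\<lambda>w. Z ?s a w - tone w) \<le> e'" "coeff_norm N (\<lambda>w. Z b ?t w - tone w)
              \<le> e'"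
            using ab st near by (auto intro!: d(2))
          then have "M * (coeff_norm N (\<lambda>w. Z ?s a w - tone w) + coeff_norm N (\<lambda>w. Z b ?t w
              - tone w))
              \<le> M * (2 * e')"
            using M(1) by (intro mult_left_mono) auto
          moreover have "0 \<le> ?s" "?s \<le> a" "a \<le> b" "b \<le> ?t" "?t \<le> T" using ab st by auto
          ultimately show ?thesis using M(2)[of ?s a b ?t] by simp
        qed
        have "coeff_norm N (\<lambda>w. Z s' t' w - Z s t w) \<le> 4 * M * e'"
          using close[of s t] close[of s' t'] coeff_norm_triangle[of N "Z s' t'" "Z s t" "Z ?s ?t"]
            coeff_norm_diff_commute[of N "Z s' t'" "Z ?s ?t"] by simp
        then show ?thesis
          using abs_le_coeff_norm[OF w, of "\<lambda>w. Z s' t' w - Z s t w"] e'(2)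
              by (simp add: xy dist_real_def)
      qed
      then show "\<exists>d>0. \<forall>y\<in>simplex2 T. dist y x < d \<longrightarrow>
          dist ((case y of (s, t) \<Rightarrow> Z s t) w) ((case x of (s, t) \<Rightarrow> Z s t) w) < e"
        using d(1) by blast
    qed
  qed
qed

text \<open>Additivity spreads \<open>f s t\<close> over the intervals of an arbitrarily fine
  partition, and \<open>Wsum\<close> tends to zero there. This is the uniqueness argument of the
  sewing lemma.\<close>

lemma additive_eq_0:
  assumes add: "\<And>s u t. \<lbrakk>0 \<le> s; s \<le> u; u \<le> t; t \<le> T\<rbrakk> \<Longrightarrow> f s t = f s u + f u t"
    and small: "err (Suc N) (\<lambda>s u t. f s t)"
    and st: "0 \<le> s" "s \<le> t" "t \<le> T"
  shows "f s t = 0"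
proof -
  obtain C where C: "0 \<le> C" "\<And>s u t. \<lbrakk>0 \<le> s; s \<le> u; u \<le> t; t \<le> T\<rbrakk> \<Longrightarrow> \<bar>f s t\<bar> \<le> C * scale s t ^ Suc N"
    using small by (rule errE) (rule that; assumption)
  have sum: "\<bar>f a t\<bar> \<le> C * Wsum F" if "partition_of a t F" "0 \<le> a" for F a
    using that
  proof (induction F arbitrary: a rule: induct_list012)
    case (2 x)
    then have "a = t" by (simp add: partition_of_single)
    then have "f a t = f a t + f a t" using add[of t t t] st by simp
    then show ?case by simp
  next
    case (3 x y F)
    have xy: "x = a" "a < y" "partition_of y t (y # F)"
      using "3.prems"(1) by (auto simp: partition_of_Cons)
    then have "y \<le> t" using partition_of_bounds[OF xy(3), of y] by simp
    then have "f a t = f a y + f y t" "\<bar>f a y\<bar> \<le> C * W a y"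
      using add[of a y t] C(2)[of a a y] xy "3.prems"(2) st by (simp_all only: W_eq)
    moreover have "\<bar>f y t\<bar> \<le> C * Wsum (y # F)"
      using "3.IH"(2)[OF xy(3)] "3.prems"(2) xy(2) by simp
    ultimately show ?case by (simp add: xy(1) distrib_left)
  qed (simp add: partition_of_def)
  have "\<bar>f s t\<bar> \<le> C * e" if e: "0 < e" for e
  proof -
    obtain \<delta> where \<delta>: "0 < \<delta>" "\<And>ts. admissible ts \<Longrightarrow> mesh_below \<delta> ts \<Longrightarrow> Wsum ts \<le> e"
      using Wsum_small[OF e] by blast
    obtain F where F: "partition_of s t F" "mesh_below \<delta> F"
      using mesh_below_partition_exists[OF st(2) \<delta>(1)] by blast
    have "C * Wsum F \<le> C * e"
      using \<delta>(2) partition_of_admissible[OF F(1)] st F(2) C(1) by (intro mult_left_mono) auto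
    then show ?thesis using sum[OF F(1) st(1)] by simp
  qed
  then have "\<bar>f s t\<bar> \<le> 0" by (rule le_0_if_le_mult_eps[OF C(1)])
  then show ?thesis by simp
qed

section \<open>Integration by parts: pairing the limit with shuffle products\<close>

definition shuffle_sum :: "'u tensor \<Rightarrow> 'u list \<Rightarrow> 'u list \<Rightarrow> real" where
  "shuffle_sum a x y = (\<Sum>w\<in>words (length x + length y). a w * shuffle_count x y w)"

lemma shuffle_sum_Nil:
  assumes "set x \<subseteq> Basis"
  shows "shuffle_sum a x [] = a x" "shuffle_sum a [] x = a x"
proof -
  have "shuffle_sum a x [] = (\<Sum>w\<in>words (length x). of_bool (w = x) * a w)"
    "shuffle_sum a [] x = (\<Sum>w\<in>words (length x). of_bool (w = x) * a w)"
    unfolding shuffle_sum_def by (auto intro!: sum.cong)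
  then show "shuffle_sum a x [] = a x" "shuffle_sum a [] x = a x"
    using assms by (simp_all add: sum_of_bool_mult words_iff)
qed

text \<open>The dual form of \<open>shuffle_count_append\<close>. Once \<open>x\<close> and
  \<open>y\<close> are cut at \<open>i\<close> and \<open>j\<close>, counting letters forces the cut
  of the shuffled word to be at \<open>i + j\<close>.\<close>

lemma shuffle_sum_tprod:
  "shuffle_sum (tprod a b) x y = (\<Sum>i\<le>length x. \<Sum>j\<le>length y.
     shuffle_sum a (take i x) (take j y) * shuffle_sum b (drop i x) (drop j y))"
proof -
  let ?n = "length x + length y"
  let ?A = "\<lambda>i j k. \<Sum>v\<in>words k. a v * shuffle_count (take i x) (take j y) v"
  let ?B = "\<lambda>i j k. \<Sum>v\<in>words (?n - k). b v * shuffle_count (drop i x) (drop j y) v"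
  have "shuffle_sum (tprod a b) x y
      = (\<Sum>w\<in>words ?n. \<Sum>k\<le>?n. a (take k w) * b (drop k w) * shuffle_count x y (take k w @ drop k w))"
    unfolding shuffle_sum_def tprod_def sum_distrib_right
    by (rule sum.cong) (auto simp: words_iff)
  also have "\<dots> = (\<Sum>k\<le>?n. \<Sum>w\<in>words ?n. a (take k w) * b (drop k w) * shuffle_count x y (take k w @
      drop k w))"
    by (rule sum.swap)
  also have "\<dots> = (\<Sum>k\<le>?n. \<Sum>v\<in>words k. \<Sum>v'\<in>words (?n - k). a v * b v' * shuffle_count x y (v @ v'))"
    by (rule sum.cong[OF refl],
        rule sum_words_cut[where f = "\<lambda>v v'. a v * b v' * shuffle_count x y (v @ v')"]) simp
  also have "\<dots> = (\<Sum>k\<le>?n. \<Sum>i\<le>length x. \<Sum>j\<le>length y. ?A i j k * ?B i j k)"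
  proof (rule sum.cong[OF refl])
    fix k
    have "(\<Sum>v\<in>words k. \<Sum>v'\<in>words (?n - k). a v * b v' * shuffle_count x y (v @ v'))
      = (\<Sum>v\<in>words k. \<Sum>v'\<in>words (?n - k). \<Sum>i\<le>length x. \<Sum>j\<le>length y.
          (a v * shuffle_count (take i x) (take j y) v) * (b v' * shuffle_count (drop i x) (drop j
              y) v'))"
      by (simp add: shuffle_count_append sum_distrib_left mult_ac)
    also have "\<dots> = (\<Sum>v\<in>words k. \<Sum>i\<le>length x. \<Sum>j\<le>length y. \<Sum>v'\<in>words (?n - k).
          (a v * shuffle_count (take i x) (take j y) v) * (b v' * shuffle_count (drop i x) (drop j
              y) v'))"
      by (rule sum.cong[OF refl], subst sum.swap, rule sum.cong[OF refl], rule sum.swap)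
    also have "\<dots> = (\<Sum>i\<le>length x. \<Sum>j\<le>length y. \<Sum>v\<in>words k. \<Sum>v'\<in>words (?n - k).
          (a v * shuffle_count (take i x) (take j y) v) * (b v' * shuffle_count (drop i x) (drop j
              y) v'))"
      by (subst sum.swap, rule sum.cong[OF refl], rule sum.swap)
    also have "\<dots> = (\<Sum>i\<le>length x. \<Sum>j\<le>length y. ?A i j k * ?B i j k)"
      by (simp only: sum_product)
    finally show "(\<Sum>v\<in>words k. \<Sum>v'\<in>words (?n - k). a v * b v' * shuffle_count x y (v @ v'))
      = (\<Sum>i\<le>length x. \<Sum>j\<le>length y. ?A i j k * ?B i j k)" .
  qed
  also have "\<dots> = (\<Sum>i\<le>length x. \<Sum>j\<le>length y. \<Sum>k\<le>?n. ?A i j k * ?B i j k)"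
    by (subst sum.swap, rule sum.cong[OF refl], rule sum.swap)
  also have "\<dots> = (\<Sum>i\<le>length x. \<Sum>j\<le>length y.
     shuffle_sum a (take i x) (take j y) * shuffle_sum b (drop i x) (drop j y))"
  proof (intro sum.cong refl)
    fix i j assume ij: "i \<in> {..length x}" "j \<in> {..length y}"
    have "(\<Sum>k\<le>?n. ?A i j k * ?B i j k) = (\<Sum>k\<le>?n. of_bool (k = i + j) * (?A i j k * ?B i j k))"
    proof (rule sum.cong[OF refl])
      fix k
      have "?A i j k = 0" if "k \<noteq> i + j"
        using that ij by (intro sum.neutral) (auto simp: words_iff shuffle_count_eq_0)
      then show "?A i j k * ?B i j k = of_bool (k = i + j) * (?A i j k * ?B i j k)" by auto
    qed
    also have "\<dots> = ?A i j (i + j) * ?B i j (i + j)"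
      using ij by (simp add: sum_of_bool_mult)
    finally show "(\<Sum>k\<le>?n. ?A i j k * ?B i j k)
      = shuffle_sum a (take i x) (take j y) * shuffle_sum b (drop i x) (drop j y)"
      using ij by (simp add: shuffle_sum_def min_def)
  qed
  finally show ?thesis .
qed

lemma Y_shuffle_sum_err:
  assumes "set x \<subseteq> Basis" "set y \<subseteq> Basis" "length x + length y \<le> N"
  shows "err (Suc N) (\<lambda>s u t. Y s t x * Y s t y - shuffle_sum (Y s t) x y)"
proof -
  let ?a = "length x" and ?b = "length y"
  let ?f = "\<lambda>s t ws. ext_prod [tcomp ?a (Y s t), tcomp ?b (Y s t)] ws - Delta_sh ?a ?b (tcomp (?a
      + ?b) (Y s t)) ws"
  have xy: "x \<in> words ?a" "y \<in> words ?b" using assms by (auto simp: words_iff)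
  have f: "?f s t [x, y] = Y s t x * Y s t y - shuffle_sum (Y s t) x y" for s t
    using xy by (simp add: Delta_sh_eq tcomp_def words_iff shuffle_sum_def)
  have "bigO_ctrl p T \<omega> (Suc N) (\<lambda>s t. ext_norm [?a, ?b] (?f s t))"
    using Y assms(3) by (simp add: almost_rough_path_def)
  then have "bigO_ctrl p T \<omega> (Suc N) (\<lambda>s t. \<bar>?f s t [x, y]\<bar>)"
  proof (rule bigO_ctrl_mono)
    fix s t
    have "[x, y] \<in> listset (map words [?a, ?b])" using xy by (auto simp: set_Cons_def)
    then show "\<bar>?f s t [x, y]\<bar> \<le> ext_norm [?a, ?b] (?f s t)"
      using member_le_L2_set[of "listset (map words [?a, ?b])" "[x, y]" "\<lambda>ws. \<bar>?f s t ws\<bar>"]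
      by (simp only: ext_norm_def L2_set_def power2_abs finite_listset_words)
  qed
  then show ?thesis
    unfolding f by (rule iffD2[OF err_iff_bigO_ctrl, rotated]) simp
qed

text \<open>The defect in the shuffle relation is additive once it vanishes in all lower degrees.\<close>

lemma Z_shuffle:
  assumes "set x \<subseteq> Basis" "set y \<subseteq> Basis" "length x + length y \<le> N" "0 \<le> s" "s \<le> t" "t \<le> T"
  shows "Z s t x * Z s t y = shuffle_sum (Z s t) x y"
  using assms
proof (induction "length x + length y" arbitrary: x y s t rule: less_induct)
  case less
  let ?D = "\<lambda>s t. Z s t x * Z s t y - shuffle_sum (Z s t) x y"
  show ?case
  proof (cases "x = [] \<and> y = []")
    case True
    then show ?thesis using less.prems by (simp add: shuffle_sum_Nil Z_Nil)
  next
    case False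
    have xyN: "x \<in> words_upto N" "y \<in> words_upto N" using less.prems by (auto simp: words_upto_iff)
    have "?D s t = 0"
    proof (rule additive_eq_0[OF _ _ less.prems(4-6)])
      have bounded: "err 0 (\<lambda>s u t. Z s t y)" "err 0 (\<lambda>s u t. Y s t x)"
        using err_mono[OF Z_err[OF xyN(2)]] err_mono[OF regular_tensor_map_err[OF Y_regular]] by
            auto
      \<comment> \<open>The defect of \<open>Z\<close> is that of \<open>Y\<close> plus terms which
        each contain a difference of \<open>Z\<close> and \<open>Y\<close>; all of them have order
        \<open>Suc N\<close>.\<close>
      have "err (Suc N) (\<lambda>s u t. (Y s t x * Y s t y - shuffle_sum (Y s t) x y)
          + (Z s t x - Y s t x) * Z s t y + Y s t x * (Z s t y - Y s t y)
          - (\<Sum>w\<in>words (length x + length y). (Z s t w - Y s t w) * shuffle_count x y w))"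
        using less.prems xyN
        by (intro err_diff err_add Y_shuffle_sum_err err_mult'[OF Z_near_err bounded(1)]
            err_mult'[OF bounded(2) Z_near_err] err_sum err_cmult Z_near_err)
          (auto simp: words_iff words_upto_iff)
      then show "err (Suc N) (\<lambda>s u t. ?D s t)"
        by (simp add: shuffle_sum_def left_diff_distrib right_diff_distrib sum_subtractf)
    next
      fix s u t assume sut: "0 \<le> s" "s \<le> u" "u \<le> t" "t \<le> T"
      have dom: "s \<le> t" "0 \<le> u" "u \<le> T" using sut by auto
      let ?a = "length x" and ?b = "length y"
      let ?P = "\<lambda>s t x y. Z s t x * Z s t y" and ?S = "\<lambda>s t. shuffle_sum (Z s t)"
      let ?E = "\<lambda>(i, j). ?P s u (take i x) (take j y) * ?P u t (drop i x) (drop j y)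
          - ?S s u (take i x) (take j y) * ?S u t (drop i x) (drop j y)"
      have "?P s t x y = (\<Sum>i\<le>?a. \<Sum>j\<le>?b. ?P s u (take i x) (take j y) * ?P u t (drop i x) (drop j
          y))"
        using less.prems(3) by (simp add: Z_mult_coeff[OF sut] tprod_def sum_product mult_ac)
      moreover have "?S s t x y = (\<Sum>i\<le>?a. \<Sum>j\<le>?b. ?S s u (take i x) (take j y) * ?S u t (drop i x)
          (drop j y))"
      proof -
        have "?S s t x y = shuffle_sum (tprod (Z s u) (Z u t)) x y"
          unfolding shuffle_sum_def using less.prems(3)
          by (intro sum.cong) (auto simp: Z_mult_coeff[OF sut] words_iff)
        then show ?thesis by (simp only: shuffle_sum_tprod)
      qed
      ultimately have "?D s t = (\<Sum>z\<in>{..?a} \<times> {..?b}. ?E z)"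
        by (simp add: sum_subtractf[symmetric] sum.cartesian_product case_prod_unfold)
      \<comment> \<open>At every other cut both pieces have smaller total length and the induction
        hypothesis makes the two products equal. At the two extreme cuts one piece is empty and
        contributes the factor 1, which leaves the defects on \<open>[u, t]\<close> and on
        \<open>[s, u]\<close>.\<close>
      also have "\<dots> = (\<Sum>z\<in>{(0, 0), (?a, ?b)}. ?E z)"
      proof (rule sum.mono_neutral_right)
        show "\<forall>z\<in>{..?a} \<times> {..?b} - {(0, 0), (?a, ?b)}. ?E z = 0"
        proof
          fix z assume z: "z \<in> {..?a} \<times> {..?b} - {(0, 0), (?a, ?b)}"
          obtain i j where ij: "z = (i, j)" by (cases z)
          have b: "i \<le> ?a" "j \<le> ?b" "0 < i + j" "i + j < ?a + ?b"
            using z by (auto simp: ij)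
          have sub: "set (take i x) \<subseteq> Basis" "set (drop i x) \<subseteq> Basis"
            "set (take j y) \<subseteq> Basis" "set (drop j y) \<subseteq> Basis"
            using less.prems(1,2) by (auto dest!: in_set_takeD in_set_dropD)
          have "?P s u (take i x) (take j y) = ?S s u (take i x) (take j y)"
            by (rule less.hyps) (use b less.prems sub sut dom in auto)
          moreover have "?P u t (drop i x) (drop j y) = ?S u t (drop i x) (drop j y)"
            by (rule less.hyps) (use b less.prems sub sut dom in auto)
          ultimately show "?E z = 0" by (simp add: ij)
        qed
      qed auto
      also have "\<dots> = ?E (0, 0) + ?E (?a, ?b)"
        using False by (subst sum.insert) auto
      also have "\<dots> = ?D s u + ?D u t"
        using sut dom by (simp add: shuffle_sum_Nil Z_Nil)
      finally show "?D s t = ?D s u + ?D u t" .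
    qed
    then show ?thesis by simp
  qed
qed

theorem rough_path_Z: "rough_path p T \<omega> Z"
  unfolding rough_path_def
proof (intro conjI allI impI)
  show "regular_tensor_map p T \<omega> Z"
    by (rule regular_tensor_mapI)
      (auto simp: simplex2_def Z_trunc Z_Nil continuous_Z[simplified simplex2_def] Z_err)
next
  fix s u t assume "0 \<le> s \<and> s \<le> u \<and> u \<le> t \<and> t \<le> T"
  then show "Z s t = ttrunc N (tprod (Z s u) (Z u t))" by (intro Z_mult) auto
next
  fix a b assume ab: "a + b \<le> N"
  show "\<forall>(s, t)\<in>simplex2 T. ext_prod [tcomp a (Z s t), tcomp b (Z s t)] = Delta_sh a b (tcomp (a
      + b) (Z s t))"
  proof clarify
    fix s t assume "(s, t) \<in> simplex2 T"
    then have st: "0 \<le> s" "s \<le> t" "t \<le> T" by (auto simp: simplex2_def)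
    show "ext_prod [tcomp a (Z s t), tcomp b (Z s t)] = Delta_sh a b (tcomp (a + b) (Z s t))"
    proof
      fix ws
      show "ext_prod [tcomp a (Z s t), tcomp b (Z s t)] ws = Delta_sh a b (tcomp (a
          + b) (Z s t)) ws"
      proof (cases "ws \<in> listset (map words [a, b])")
        case True
        then obtain x y where ws: "ws = [x, y]" and xy: "x \<in> words a" "y \<in> words b"
          by (auto simp: set_Cons_def)
        then show ?thesis
          using Z_shuffle[of x y s t] ab st by (simp add: Delta_sh_eq tcomp_def words_iff
              shuffle_sum_def)
      next
        case False
        have vanish: "tcomp k (Z s t) x = 0" if "x \<notin> words k" for k x
          using that Z_eq_0[OF st, of x] by (auto simp: tcomp_def words_iff words_upto_iff)
        have "ext_prod [tcomp a (Z s t), tcomp b (Z s t)] ws = 0"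
        proof (cases "\<exists>x y. ws = [x, y]")
          case True
          then obtain x y where ws: "ws = [x, y]" by blast
          with False have "x \<notin> words a \<or> y \<notin> words b" by (auto simp: set_Cons_def)
          then show ?thesis using vanish by (auto simp: ws)
        next
          case False
          then show ?thesis by (cases ws rule: remdups_adj.cases; cases "tl (tl ws)") auto
        qed
        then show ?thesis using Delta_sh_eq_0[OF False] by simp
      qed
    qed
  qed
qed

section \<open>Convergence along sequences of partitions and the trace\<close>

lemma partition_prod_tendsto:
  assumes st: "0 \<le> s" "s \<le> t" "t \<le> T"
    and \<pi>: "\<And>n. partition_of s t (\<pi> n)" and mesh: "(\<lambda>n. mesh (\<pi> n)) \<longlonglongrightarrow> 0"
  shows "(\<lambda>n. partition_prod N Y (\<pi> n)) \<longlonglongrightarrow> Z s t"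
proof (rule LIMSEQ_coordinatewise)
  fix w
  \<comment> \<open>Convergence is required at every list, also at those with letters outside
    \<open>Basis\<close>. However such a list is cut, one of the pieces contains a foreign letter,
    so these coefficients vanish on both sides.\<close>
  have zero: "path_prod Y ts w = 0" if "admissible ts" "\<not> set w \<subseteq> Basis" for ts w
    using that
  proof (induction ts arbitrary: w rule: induct_list012)
    case (3 x y ts)
    have "Y x y (take i w) * path_prod Y (y # ts) (drop i w) = 0" for i
    proof (cases "set (take i w) \<subseteq> Basis")
      case True
      then have "\<not> set (drop i w) \<subseteq> Basis"
        using "3.prems"(2) set_append[of "take i w" "drop i w"] by auto
      then show ?thesis
        using "3.IH"(2) "3.prems"(1) admissible_append2[of "[x]" y ts] by simp
    next
      case False
      then show ?thesis
        using Y_eq_0[of x y "take i w"] "3.prems"(1) by (auto simp: words_upto_iff admissible_def)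
    qed
    then show ?case unfolding path_prod.simps tprod_def by (rule sum.neutral[OF ballI])
  qed (auto simp: tone_def)
  have ad: "admissible (\<pi> n)" for n using partition_of_admissible[OF \<pi>] st by simp
  show "(\<lambda>n. partition_prod N Y (\<pi> n) w) \<longlonglongrightarrow> Z s t w"
  proof (cases "w \<in> words_upto N")
    case False
    then have "partition_prod N Y (\<pi> n) w = 0" for n
      using zero[OF ad] by (auto simp: partition_prod_eq_path_prod ttrunc_def words_upto_iff)
    then show ?thesis using False st by (simp add: Z_eq_0)
  next
    case True
    have "(\<lambda>n. path_prod Y (\<pi> n) w) \<longlonglongrightarrow> Z s t w"
    proof (rule LIMSEQ_I)
      fix e :: real assume "0 < e"
      then have "0 < e / 2" by simp
      then obtain \<delta> where \<delta>: "0 < \<delta>" "\<And>F. partition_of s t F \<Longrightarrow> mesh_below \<delta> F \<Longrightarrow>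
          coeff_norm N (\<lambda>w. path_prod Y F w - Z s t w) \<le> e / 2"
        using Z_approx[OF st] by blast
      have "\<forall>\<^sub>F n in sequentially. mesh (\<pi> n) < \<delta>"
        using order_tendstoD(2)[OF mesh \<delta>(1)] .
      then obtain n0 where n0: "\<And>n. n0 \<le> n \<Longrightarrow> mesh (\<pi> n) < \<delta>"
        unfolding eventually_sequentially by blast
      have "\<bar>path_prod Y (\<pi> n) w - Z s t w\<bar> < e" if "n0 \<le> n" for n
        using \<delta>(2)[OF \<pi> mesh_belowI[OF n0[OF that]]] \<open>0 < e\<close>
          abs_le_coeff_norm[OF True, of "\<lambda>w. path_prod Y (\<pi> n) w - Z s t w"] by linarith
      then show "\<exists>n0. \<forall>n\<ge>n0. norm (path_prod Y (\<pi> n) w - Z s t w) < e" by auto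
    qed
    then show ?thesis
      using True by (simp add: partition_prod_eq_path_prod ttrunc_def words_upto_iff)
  qed
qed

text \<open>In degree \<open>1\<close> multiplicativity means additivity, so the difference of
  \<open>Z\<close> and \<open>Y\<close> is additive and of order \<open>Suc N\<close>, hence
  zero.\<close>

lemma Z_letter:
  assumes add: "\<And>s u t. \<lbrakk>0 \<le> s; s \<le> u; u \<le> t; t \<le> T\<rbrakk> \<Longrightarrow> Y s t [c] = Y s u [c] + Y u t [c]"
    and c: "c \<in> Basis" and st: "0 \<le> s" "s \<le> t" "t \<le> T"
  shows "Z s t [c] = Y s t [c]"
proof -
  have "Z s t [c] - Y s t [c] = 0"
  proof (rule additive_eq_0[OF _ _ st])
    fix s u t assume sut: "0 \<le> s" "s \<le> u" "u \<le> t" "t \<le> T"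
    have "Z s t [c] = Z u t [c] + Z s u [c]"
      using Z_mult_coeff[OF sut, of "[c]"] level_ge_1 sut by (simp add: tprod_def Z_Nil)
    then show "Z s t [c] - Y s t [c] = Z s u [c] - Y s u [c] + (Z u t [c] - Y u t [c])"
      using add[OF sut] by simp
  qed (use c level_ge_1 in \<open>auto intro!: Z_near_err simp: words_upto_iff\<close>)
  then show ?thesis by simp
qed

end

theorem theorem2p9:
  fixes p T :: real and \<omega> :: "real \<Rightarrow> real \<Rightarrow> real"
    and X :: "real \<Rightarrow> real \<Rightarrow> 'v::euclidean_space tensor"
    and H :: "real \<Rightarrow> 'v list \<Rightarrow> 'u::euclidean_space"
  assumes "1 \<le> p" and "0 < T" and "control T \<omega>"
    and "rough_path p T \<omega> X" and "controlled_path p T \<omega> X H"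
  shows "almost_rough_path p T \<omega> (almost_lift (level p) X H) \<and>
    (\<exists>Z :: real \<Rightarrow> real \<Rightarrow> 'u tensor.
       (\<forall>(s, t)\<in>simplex2 T. \<forall>\<pi> :: nat \<Rightarrow> real list.
          (\<forall>n. partition_of s t (\<pi> n)) \<and> (\<lambda>n. mesh (\<pi> n)) \<longlonglongrightarrow> 0 \<longrightarrow>
          (\<lambda>n. partition_prod (level p) (almost_lift (level p) X H) (\<pi> n)) \<longlonglongrightarrow> Z s t) \<and>
       rough_path p T \<omega> Z \<and>
       (\<forall>(s, t)\<in>simplex2 T. tcomp 1 (Z s t) = pure_tensor [ctrace H t - ctrace H s]))"
proof -
  interpret lift_setting p T \<omega> X H
    using assms by unfold_locales
  let ?Y = "almost_lift (level p) X H"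
  have Y: "almost_rough_path p T \<omega> ?Y"
    by (rule almost_rough_path_almost_lift)
  \<comment> \<open>The limit is built from the almost rough path alone. The formula for the lift is
    used once more in degree \<open>1\<close>, where its exact additivity identifies the
    trace.\<close>
  interpret S: sewing p T \<omega> ?Y
    by unfold_locales (rule Y)
  have "tcomp 1 (S.Z s t) = pure_tensor [ctrace H t - ctrace H s]" if "(s, t) \<in> simplex2 T" for s t
  proof
    fix w
    have st: "0 \<le> s" "s \<le> t" "t \<le> T" using that by (auto simp: simplex2_def)
    show "tcomp 1 (S.Z s t) w = pure_tensor [ctrace H t - ctrace H s] w"
    proof (cases "w \<in> words 1")
      case True
      then obtain c where c: "w = [c]" "c \<in> Basis" by (auto simp: words_iff length_Suc_conv)
      have "S.Z s t [c] = ?Y s t [c]"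
        by (rule S.Z_letter[OF _ c(2) st]) (use c level_ge_1 in \<open>simp add: almost_lift_letter\<close>)
      then show ?thesis
        using c level_ge_1
        by (simp add: tcomp_def almost_lift_letter pure_tensor_def words_iff ctrace_def
            inner_diff_left)
    next
      case False
      then show ?thesis
        using S.Z_eq_0[OF st, of w] by (auto simp: tcomp_def pure_tensor_def words_iff
            words_upto_iff)
    qed
  qed
  moreover have "(\<lambda>n. partition_prod (level p) ?Y (\<pi> n)) \<longlonglongrightarrow> S.Z s t"
    if "(s, t) \<in> simplex2 T" "\<And>n. partition_of s t (\<pi> n)" "(\<lambda>n. mesh (\<pi> n)) \<longlonglongrightarrow> 0" for s t \<pi>
    using that by (intro S.partition_prod_tendsto) (auto simp: simplex2_def)
  ultimately show ?thesis
    using Y S.rough_path_Z by (intro conjI exI[of _ S.Z]) auto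
qed

end
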